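(* Let $K$ be a field and let $\mathcal P$ be a finite poset whose Hasse quiver is Dynkin of type $A$. Then the barcode $\underline{\mathrm{bar}}:K_0^{split}(I(\mathcal P))\to F$, where $F$ is the free abelian group generated by the closed intervals of $(\{1,\dots,|\mathcal P|\},\le)$, is a homological invariant.
   Context: Write $(\mathcal P,\preceq)$ with underlying set $\{1,\dots,|\mathcal P|\}$, such that all cover relations of $\preceq$ are of the form $i\prec i+1$ or $i+1\prec i$, with exactly one of these for each $1\le i<|\mathcal P|$ (Hasse quiver of Dynkin type $A$); $\le$ denotes the standard linear order on $\{1,\dots,|\mathcal P|\}$. $I(\mathcal P)$ is the incidence algebra over $K$, and $\mathrm{mod}\,I(\mathcal P)$ its category of finitely generated modules, identified with functors from $\mathcal P$ to finite-dimensional $K$-vector spaces. The indecomposable $I(\mathcal P)$-modules are exactly the modules that are $K$ on the points of a closed interval $\{i,i+1,\dots,j\}$ of $\le$, $0$ elsewhere, with identity maps inside the interval and zero maps otherwise. $K_0^{split}(I(\mathcal P))$ is the free abelian group on isomorphism classes of modules modulo $[M\oplus N]=[M]+[N]$; it is free on the indecomposables. The barcode $\underline{\mathrm{bar}}$ is the isomorphism $K_0^{split}(I(\mathcal P))\to F$ sending each indecomposable to the corresponding interval. Write $\Lambda=I(\mathcal P)$. An invariant is a surjective group homomorphism $K_0^{split}(\Lambda)\to\mathbb Z^n$; two invariants are equivalent if they have the same kernel. For a finite set $\mathcal X$ of indecomposables, $\mathcal E_{\mathcal X}$ is the class of short exact sequences $0\to M\to N\xrightarrow{g}L\to0$ with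 $\operatorname{Hom}_\Lambda(R,g)$ surjective for all $R\in\mathcal X$, and $K_0(\Lambda,\mathcal X)$ is the free abelian group on isomorphism classes of modules modulo all $[M]-[N]+[L]$ for sequences in $\mathcal E_{\mathcal X}$. $\mathrm{add}(\mathcal X)$ consists of finite direct sums of modules in $\mathcal X$. An $\mathcal X$-approximation of $M$ is $f:R\to M$ with $R\in\mathrm{add}(\mathcal X)$ through which every morphism from $\mathrm{add}(\mathcal X)$ to $M$ factors; it is minimal if every $g$ with $fg=f$ is an isomorphism. A minimal $\mathcal X$-resolution $R_\bullet$ of $M$ is obtained by iteratively taking minimal $\mathcal X$-approximations of $M$ and of successive kernels; the $\mathcal X$-dimension of $M$ is $\min(\{j\mid R_{j+1}=0\}\cup\{\infty\})$; the $\mathcal X$-dimension of $\Lambda$ is properly infinite if some module has infinite $\mathcal X$-dimension. An invariant is homological if for some finite set $\mathcal X$ of indecomposables: $\mathcal X$ contains all indecomposable projectives, the $\mathcal X$-dimension of $\Lambda$ is not properly infinite, and the invariant is equivalent to the quotient map $K_0^{split}(\Lambda)\to K_0(\Lambda,\mathcal X)\simeq\mathbb Z^{|\mathcal X|}$. *)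

theory Defs
  imports
    "Jordan_Normal_Form.Matrix_Kernel"
    "HOL-Algebra.Free_Abelian_Groups"
    "HOL-Library.Extended_Nat"
begin

section \<open>Finite posets of Dynkin type A\<close>

definition covers :: "'p rel \<Rightarrow> 'p \<Rightarrow> 'p \<Rightarrow> bool" where
  "covers r x y \<longleftrightarrow> (x, y) \<in> r \<and> x \<noteq> y \<and> \<not> (\<exists>z. z \<noteq> x \<and> z \<noteq> y \<and> (x, z) \<in> r \<and> (z, y) \<in> r)"

definition type_A_poset :: "nat \<Rightarrow> nat rel \<Rightarrow> bool" where
  "type_A_poset n r \<longleftrightarrow>
     partial_order_on {1..n} r \<and>
     (\<forall>i j. covers r i j \<longrightarrow> j = i + 1 \<or> i = j + 1) \<and>
     (\<forall>i. 1 \<le> i \<and> i < n \<longrightarrow> (covers r i (i + 1) \<noteq> covers r (i + 1) i))"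


section \<open>Modules over the incidence algebra\<close>

text \<open>
  A finite poset is given by its (reflexive) order relation r; its underlying set is the field
  of r. Finite-dimensional modules over the incidence algebra of r are functors from r to
  finite-dimensional vector spaces. These are taken in the skeleton of coordinate spaces: the
  space at the point x is the space of column vectors of length vdim M x over 'k, and the
  linear map for x below y is multiplication by the matrix vmap M x y. Values of vdim outside
  the field of r and of vmap outside r (and likewise components of morphisms outside the
  field of r) carry no information.
\<close>

record ('p, 'k) pmod =
  vdim :: "'p \<Rightarrow> nat"
  vmap :: "'p \<Rightarrow> 'p \<Rightarrow> 'k mat"

type_synonym ('p, 'k) pmor = "'p \<Rightarrow> 'k mat"

definition is_module :: "'p rel \<Rightarrow> ('p, 'k::field) pmod \<Rightarrow> bool" where
  "is_module r M \<longleftrightarrow>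
     (\<forall>x y. (x, y) \<in> r \<longrightarrow> vmap M x y \<in> carrier_mat (vdim M y) (vdim M x)) \<and>
     (\<forall>x\<in>Field r. vmap M x x = 1\<^sub>m (vdim M x)) \<and>
     (\<forall>x y z. (x, y) \<in> r \<longrightarrow> (y, z) \<in> r \<longrightarrow> vmap M y z * vmap M x y = vmap M x z)"

definition is_hom ::
  "'p rel \<Rightarrow> ('p, 'k::field) pmod \<Rightarrow> ('p, 'k) pmod \<Rightarrow> ('p, 'k) pmor \<Rightarrow> bool" where
  "is_hom r M N f \<longleftrightarrow>
     (\<forall>x\<in>Field r. f x \<in> carrier_mat (vdim N x) (vdim M x)) \<and>
     (\<forall>x y. (x, y) \<in> r \<longrightarrow> f y * vmap M x y = vmap N x y * f x)"

definition eq_mor :: "'p rel \<Rightarrow> ('p, 'k::field) pmor \<Rightarrow> ('p, 'k) pmor \<Rightarrow> bool" where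
  "eq_mor r f g \<longleftrightarrow> (\<forall>x\<in>Field r. f x = g x)"

definition comp_mor :: "('p, 'k::field) pmor \<Rightarrow> ('p, 'k) pmor \<Rightarrow> ('p, 'k) pmor" where
  "comp_mor g f = (\<lambda>x. g x * f x)"

definition id_mor :: "('p, 'k::field) pmod \<Rightarrow> ('p, 'k) pmor" where
  "id_mor M = (\<lambda>x. 1\<^sub>m (vdim M x))"

definition is_iso_mor ::
  "'p rel \<Rightarrow> ('p, 'k::field) pmod \<Rightarrow> ('p, 'k) pmod \<Rightarrow> ('p, 'k) pmor \<Rightarrow> bool" where
  "is_iso_mor r M N f \<longleftrightarrow>
     is_hom r M N f \<and>
     (\<exists>g. is_hom r N M g \<and>
          eq_mor r (comp_mor g f) (id_mor M) \<and> eq_mor r (comp_mor f g) (id_mor N))"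

definition isomorphic :: "'p rel \<Rightarrow> ('p, 'k::field) pmod \<Rightarrow> ('p, 'k) pmod \<Rightarrow> bool" where
  "isomorphic r M N \<longleftrightarrow> (\<exists>f. is_iso_mor r M N f)"

definition iso_class :: "'p rel \<Rightarrow> ('p, 'k::field) pmod \<Rightarrow> ('p, 'k) pmod set" where
  "iso_class r M = {N. is_module r N \<and> isomorphic r M N}"

definition iso_classes :: "'p rel \<Rightarrow> ('p, 'k::field) pmod set set" where
  "iso_classes r = {iso_class r M | M. is_module r M}"

definition zero_module :: "('p, 'k::field) pmod" where
  "zero_module = \<lparr>vdim = (\<lambda>_. 0), vmap = (\<lambda>_ _. 0\<^sub>m 0 0)\<rparr>"

definition is_zero :: "'p rel \<Rightarrow> ('p, 'k::field) pmod \<Rightarrow> bool" where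
  "is_zero r M \<longleftrightarrow> (\<forall>x\<in>Field r. vdim M x = 0)"

definition dsum :: "('p, 'k::field) pmod \<Rightarrow> ('p, 'k) pmod \<Rightarrow> ('p, 'k) pmod" where
  "dsum M N =
     \<lparr>vdim = (\<lambda>x. vdim M x + vdim N x),
      vmap = (\<lambda>x y. four_block_mat
        (vmap M x y) (0\<^sub>m (vdim M y) (vdim N x))
        (0\<^sub>m (vdim N y) (vdim M x)) (vmap N x y))\<rparr>"

definition indecomposable :: "'p rel \<Rightarrow> ('p, 'k::field) pmod \<Rightarrow> bool" where
  "indecomposable r M \<longleftrightarrow>
     is_module r M \<and> \<not> is_zero r M \<and>
     (\<forall>A B. is_module r A \<longrightarrow> is_module r B \<longrightarrow> isomorphic r M (dsum A B) \<longrightarrow>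
        is_zero r A \<or> is_zero r B)"

definition mono_mor ::
  "'p rel \<Rightarrow> ('p, 'k::field) pmod \<Rightarrow> ('p, 'k) pmor \<Rightarrow> bool" where
  "mono_mor r M f \<longleftrightarrow> (\<forall>x\<in>Field r. inj_on (\<lambda>v. f x *\<^sub>v v) (carrier_vec (vdim M x)))"

definition epi_mor ::
  "'p rel \<Rightarrow> ('p, 'k::field) pmod \<Rightarrow> ('p, 'k) pmod \<Rightarrow> ('p, 'k) pmor \<Rightarrow> bool" where
  "epi_mor r M N f \<longleftrightarrow>
     (\<forall>x\<in>Field r. (\<lambda>v. f x *\<^sub>v v) ` carrier_vec (vdim M x) = carrier_vec (vdim N x))"

definition is_kernel ::
  "'p rel \<Rightarrow> ('p, 'k::field) pmod \<Rightarrow> ('p, 'k) pmod \<Rightarrow> ('p, 'k) pmor \<Rightarrow> ('p, 'k) pmor \<Rightarrow> bool" where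
  "is_kernel r L M \<iota> f \<longleftrightarrow>
     is_module r L \<and> is_hom r L M \<iota> \<and> mono_mor r L \<iota> \<and>
     (\<forall>x\<in>Field r. (\<lambda>v. \<iota> x *\<^sub>v v) ` carrier_vec (vdim L x) = mat_kernel (f x))"

definition short_exact ::
  "'p rel \<Rightarrow> ('p, 'k::field) pmod \<Rightarrow> ('p, 'k) pmor \<Rightarrow> ('p, 'k) pmod \<Rightarrow> ('p, 'k) pmor \<Rightarrow>
     ('p, 'k) pmod \<Rightarrow> bool" where
  "short_exact r M f N g L \<longleftrightarrow>
     is_module r N \<and> is_module r L \<and> is_hom r N L g \<and>
     is_kernel r M N f g \<and> epi_mor r N L g"

definition projective :: "'p rel \<Rightarrow> ('p, 'k::field) pmod \<Rightarrow> bool" where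
  "projective r M \<longleftrightarrow>
     is_module r M \<and>
     (\<forall>A B g h. is_module r A \<longrightarrow> is_module r B \<longrightarrow>
        is_hom r A B g \<longrightarrow> epi_mor r A B g \<longrightarrow> is_hom r M B h \<longrightarrow>
        (\<exists>k. is_hom r M A k \<and> eq_mor r (comp_mor g k) h))"


section \<open>Relative homological algebra\<close>

text \<open>Sets of indecomposables are sets X of isomorphism classes throughout.\<close>

definition in_add ::
  "'p rel \<Rightarrow> ('p, 'k::field) pmod set set \<Rightarrow> ('p, 'k) pmod \<Rightarrow> bool" where
  "in_add r X R \<longleftrightarrow>
     is_module r R \<and>
     (\<exists>Ms. (\<forall>M\<in>set Ms. is_module r M \<and> iso_class r M \<in> X) \<and>
           isomorphic r R (foldr dsum Ms zero_module))"

definition in_exact_class ::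
  "'p rel \<Rightarrow> ('p, 'k::field) pmod set set \<Rightarrow>
     ('p, 'k) pmod \<Rightarrow> ('p, 'k) pmor \<Rightarrow> ('p, 'k) pmod \<Rightarrow> ('p, 'k) pmor \<Rightarrow> ('p, 'k) pmod \<Rightarrow> bool" where
  "in_exact_class r X M f N g L \<longleftrightarrow>
     short_exact r M f N g L \<and>
     (\<forall>R h. is_module r R \<longrightarrow> iso_class r R \<in> X \<longrightarrow> is_hom r R L h \<longrightarrow>
        (\<exists>k. is_hom r R N k \<and> eq_mor r (comp_mor g k) h))"

definition approximation ::
  "'p rel \<Rightarrow> ('p, 'k::field) pmod set set \<Rightarrow>
     ('p, 'k) pmod \<Rightarrow> ('p, 'k) pmod \<Rightarrow> ('p, 'k) pmor \<Rightarrow> bool" where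
  "approximation r X R M f \<longleftrightarrow>
     in_add r X R \<and> is_module r M \<and> is_hom r R M f \<and>
     (\<forall>Q h. in_add r X Q \<longrightarrow> is_hom r Q M h \<longrightarrow>
        (\<exists>k. is_hom r Q R k \<and> eq_mor r (comp_mor f k) h))"

definition minimal_approximation ::
  "'p rel \<Rightarrow> ('p, 'k::field) pmod set set \<Rightarrow>
     ('p, 'k) pmod \<Rightarrow> ('p, 'k) pmod \<Rightarrow> ('p, 'k) pmor \<Rightarrow> bool" where
  "minimal_approximation r X R M f \<longleftrightarrow>
     approximation r X R M f \<and>
     (\<forall>g. is_hom r R R g \<longrightarrow> eq_mor r (comp_mor f g) f \<longrightarrow> is_iso_mor r R R g)"

text \<open>
  In a minimal resolution, L 0 = M and L (j + 1) is the kernel of the minimal approximation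
  R j \<rightarrow> L j.
\<close>

definition minimal_resolution ::
  "'p rel \<Rightarrow> ('p, 'k::field) pmod set set \<Rightarrow> ('p, 'k) pmod \<Rightarrow> (nat \<Rightarrow> ('p, 'k) pmod) \<Rightarrow> bool" where
  "minimal_resolution r X M R \<longleftrightarrow>
     (\<exists>L f \<iota>. L 0 = M \<and>
        (\<forall>j. minimal_approximation r X (R j) (L j) (f j) \<and>
             is_kernel r (L (Suc j)) (R j) (\<iota> j) (f j)))"

text \<open>Minimal resolutions are unique up to isomorphism; the infimum of the empty set is \<infinity>.\<close>

definition X_dim :: "'p rel \<Rightarrow> ('p, 'k::field) pmod set set \<Rightarrow> ('p, 'k) pmod \<Rightarrow> enat" where
  "X_dim r X M =
     (let R = (SOME R. minimal_resolution r X M R)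
      in Inf {enat j | j. is_zero r (R (j + 1))})"

definition X_dim_properly_infinite :: "'p rel \<Rightarrow> ('p, 'k::field) pmod set set \<Rightarrow> bool" where
  "X_dim_properly_infinite r X \<longleftrightarrow> (\<exists>M. is_module r M \<and> X_dim r X M = \<infinity>)"


section \<open>Grothendieck groups and invariants\<close>

text \<open>Groups from HOL-Algebra are written multiplicatively, but free Abelian groups are additive
  on formal integer combinations.\<close>

definition free_on_classes :: "'p rel \<Rightarrow> (('p, 'k::field) pmod set \<Rightarrow>\<^sub>0 int) monoid" where
  "free_on_classes r = free_Abelian_group (iso_classes r)"

definition split_relations :: "'p rel \<Rightarrow> (('p, 'k::field) pmod set \<Rightarrow>\<^sub>0 int) set" where
  "split_relations r =
     generate (free_on_classes r)
       {frag_of (iso_class r (dsum M N)) - (frag_of (iso_class r M) + frag_of (iso_class r N))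
        | M N. is_module r M \<and> is_module r N}"

definition K0_split :: "'p rel \<Rightarrow> (('p, 'k::field) pmod set \<Rightarrow>\<^sub>0 int) set monoid" where
  "K0_split r = free_on_classes r Mod split_relations r"

definition split_class ::
  "'p rel \<Rightarrow> ('p, 'k::field) pmod \<Rightarrow> (('p, 'k) pmod set \<Rightarrow>\<^sub>0 int) set" where
  "split_class r M = split_relations r #>\<^bsub>free_on_classes r\<^esub> frag_of (iso_class r M)"

definition exact_relations ::
  "'p rel \<Rightarrow> ('p, 'k::field) pmod set set \<Rightarrow> (('p, 'k) pmod set \<Rightarrow>\<^sub>0 int) set" where
  "exact_relations r X =
     generate (free_on_classes r)
       {frag_of (iso_class r M) - frag_of (iso_class r N) + frag_of (iso_class r L)
        | M f N g L. in_exact_class r X M f N g L}"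

definition K0_rel ::
  "'p rel \<Rightarrow> ('p, 'k::field) pmod set set \<Rightarrow> (('p, 'k) pmod set \<Rightarrow>\<^sub>0 int) set monoid" where
  "K0_rel r X = free_on_classes r Mod exact_relations r X"

text \<open>The map sending the coset of c modulo the split relations to the coset of c modulo the
  relations of the exact structure (which include the split relations).\<close>

definition quotient_map ::
  "'p rel \<Rightarrow> ('p, 'k::field) pmod set set \<Rightarrow>
     (('p, 'k) pmod set \<Rightarrow>\<^sub>0 int) set \<Rightarrow> (('p, 'k) pmod set \<Rightarrow>\<^sub>0 int) set" where
  "quotient_map r X C =
     the_elem ((\<lambda>c. exact_relations r X #>\<^bsub>free_on_classes r\<^esub> c) ` C)"

abbreviation Z_pow :: "nat \<Rightarrow> (nat \<Rightarrow> int) monoid" where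
  "Z_pow m \<equiv> product_group {..<m} (\<lambda>_. integer_group)"

text \<open>The target of an invariant is only required to be isomorphic to a finite power of the
  integers, so that the barcode and the quotient maps need no choice of basis; the kernel is
  unaffected by such a choice.\<close>

definition is_invariant ::
  "'p rel \<Rightarrow> ('b, 'c) monoid_scheme \<Rightarrow> ((('p, 'k::field) pmod set \<Rightarrow>\<^sub>0 int) set \<Rightarrow> 'b) \<Rightarrow> bool" where
  "is_invariant r H \<phi> \<longleftrightarrow> group H \<and> (\<exists>m. H \<cong> Z_pow m) \<and> \<phi> \<in> epi (K0_split r) H"

definition equivalent_invariants ::
  "'p rel \<Rightarrow> ('b, 'c) monoid_scheme \<Rightarrow> ((('p, 'k::field) pmod set \<Rightarrow>\<^sub>0 int) set \<Rightarrow> 'b) \<Rightarrow>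
     ('d, 'e) monoid_scheme \<Rightarrow> ((('p, 'k) pmod set \<Rightarrow>\<^sub>0 int) set \<Rightarrow> 'd) \<Rightarrow> bool" where
  "equivalent_invariants r H \<phi> H' \<psi> \<longleftrightarrow>
     is_invariant r H \<phi> \<and> is_invariant r H' \<psi> \<and>
     Coset.kernel (K0_split r) H \<phi> = Coset.kernel (K0_split r) H' \<psi>"

definition homological_invariant ::
  "'p rel \<Rightarrow> ('b, 'c) monoid_scheme \<Rightarrow> ((('p, 'k::field) pmod set \<Rightarrow>\<^sub>0 int) set \<Rightarrow> 'b) \<Rightarrow> bool" where
  "homological_invariant r H \<phi> \<longleftrightarrow>
     is_invariant r H \<phi> \<and>
     (\<exists>X. finite X \<and>
          X \<subseteq> {iso_class r M | M. indecomposable r M} \<and>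
          (\<forall>M. indecomposable r M \<longrightarrow> projective r M \<longrightarrow> iso_class r M \<in> X) \<and>
          \<not> X_dim_properly_infinite r X \<and>
          K0_rel r X \<cong> Z_pow (card X) \<and>
          equivalent_invariants r H \<phi> (K0_rel r X) (quotient_map r X))"


section \<open>The barcode\<close>

definition closed_intervals :: "nat \<Rightarrow> nat set set" where
  "closed_intervals n = {{i..j} | i j. 1 \<le> i \<and> i \<le> j \<and> j \<le> n}"

definition interval_module :: "'p set \<Rightarrow> ('p, 'k::field) pmod" where
  "interval_module I =
     (let d = (\<lambda>x. if x \<in> I then 1 else 0)
      in \<lparr>vdim = d,
          vmap = (\<lambda>x y. if x \<in> I \<and> y \<in> I then 1\<^sub>m 1 else 0\<^sub>m (d y) (d x))\<rparr>)"

definition interval_group :: "nat \<Rightarrow> (nat set \<Rightarrow>\<^sub>0 int) monoid" where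
  "interval_group n = free_Abelian_group (closed_intervals n)"

text \<open>Extensionality only pins down the values off the carrier, making the isomorphism unique as
  a HOL function.\<close>

definition barcode ::
  "nat \<Rightarrow> nat rel \<Rightarrow> ((nat, 'k::field) pmod set \<Rightarrow>\<^sub>0 int) set \<Rightarrow> (nat set \<Rightarrow>\<^sub>0 int)" where
  "barcode n r =
     (THE h. h \<in> iso (K0_split r) (interval_group n) \<and>
             h \<in> extensional (carrier (K0_split r)) \<and>
             (\<forall>I\<in>closed_intervals n. h (split_class r (interval_module I)) = frag_of I))"

end

theory Submission
  imports Defs
begin

text \<open>
  Take X to be the set of all indecomposables. Then add X contains every module, so for every
  sequence of the exact structure the identity of its right end lifts to the middle term, and the
  sequence splits (in_exact_class_splits). Hence K0_rel r X coincides with K0_split r, and the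
  quotient map between them is the identity, with trivial kernel like that of the isomorphism
  barcode. Minimal approximations have sections and are therefore isomorphisms, so all X-dimensions
  are 0 (X_dim_not_properly_infinite).

  The substance is that the barcode exists, which is the Krull-Schmidt theorem for representations
  of type A together with the classification of the indecomposables.

  For the existence of decompositions (interval_decomposition) it suffices to split off one interval
  module from a nonzero module M. Let x be the last point of its support. By left_summand_exists, any
  proper inclusion of subspaces A \<subset> B of the space at x is detected by some interval ending at x:
  there are morphisms from the interval module to the part of M up to x and back, with composite the
  identity, such that at x the first takes a value in B and the second kills A. This is shown by moving
  the pair A, B to the left along the line, by preimages or images according to the direction of the
  arrows, until the two subspaces would become equal; there the interval starts. The case A = 0
  with B the whole space gives the summand.

  Uniqueness (interval_decomposition_unique) rests on a bound for the number of summands whose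
  intervals contain a given interval I. Consider m morphisms from the constant module on I to the
  restriction of M to I, and m morphisms back. Their pairing matrix is constant along I; each summand
  of M whose interval contains I contributes rank at most one to it, and every other summand
  contributes zero. If the pairing matrix is the identity, m is therefore at most the number of
  summands containing I, and these numbers determine all multiplicities.

  Sending a module to the formal sum of its intervals then defines a homomorphism from the free
  abelian group on isomorphism classes onto the free abelian group on intervals. Its kernel consists
  of the split relations, because modulo these every class is the sum of the classes of its interval
  summands (interval_class_map_vector_map). The isomorphism induced on the quotient is the barcode.
\<close>

section \<open>Matrices with side conditions on dimensions\<close>

lemma mat_assoc:
  "dim_col A = dim_row B \<Longrightarrow> dim_col B = dim_row C \<Longrightarrow> (A * B) * C = A * (B * C)"
  for A B C :: "'a::semiring_0 mat"
  by (rule assoc_mult_mat[of _ "dim_row A" "dim_col A" _ "dim_col B" _ "dim_col C"]) auto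

lemma mat_distrib_right:
  "dim_row A = dim_row B \<Longrightarrow> dim_col A = dim_col B \<Longrightarrow> dim_col B = dim_row C \<Longrightarrow>
    (A + B) * C = A * C + B * C"
  for A B C :: "'a::semiring_0 mat"
  by (rule add_mult_distrib_mat[of _ "dim_row A" "dim_col A" _ _ "dim_col C"]) auto

lemma mat_distrib_left:
  "dim_row B = dim_row C \<Longrightarrow> dim_col B = dim_col C \<Longrightarrow> dim_col A = dim_row C \<Longrightarrow>
    A * (B + C) = A * B + A * C"
  for A B C :: "'a::semiring_0 mat"
  by (rule mult_add_distrib_mat[of _ "dim_row A" "dim_col A" _ "dim_col B" _]) auto

lemma mat_one_left: "dim_row A = n \<Longrightarrow> 1\<^sub>m n * A = A" for A :: "'a::semiring_1 mat"
  by auto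

lemma mat_one_right: "dim_col A = n \<Longrightarrow> A * 1\<^sub>m n = A" for A :: "'a::semiring_1 mat"
  by auto

lemma mat_zero_left: "dim_row A = n \<Longrightarrow> 0\<^sub>m m n * A = 0\<^sub>m m (dim_col A)"
  for A :: "'a::semiring_0 mat"
  by (rule left_mult_zero_mat[of _ _ "dim_col A"]) auto

lemma mat_zero_right: "dim_col A = n \<Longrightarrow> A * 0\<^sub>m n m = 0\<^sub>m (dim_row A) m"
  for A :: "'a::semiring_0 mat"
  by (rule right_mult_zero_mat[of _ "dim_row A"]) auto

lemma mat_add_zero_left: "dim_row A = m \<Longrightarrow> dim_col A = n \<Longrightarrow> 0\<^sub>m m n + A = A"
  for A :: "'a::monoid_add mat"
  by (rule left_add_zero_mat) auto

lemma mat_add_zero_right: "dim_row A = m \<Longrightarrow> dim_col A = n \<Longrightarrow> A + 0\<^sub>m m n = A"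
  for A :: "'a::monoid_add mat"
  by (rule right_add_zero_mat) auto

lemma mat_add_cancel_zero:
  fixes A B :: "'a::ab_group_add mat"
  assumes "A + B = A" "dim_row A = dim_row B" "dim_col A = dim_col B"
  shows "B = 0\<^sub>m (dim_row B) (dim_col B)"
proof (rule eq_matI)
  fix i j assume ij: "i < dim_row (0\<^sub>m (dim_row B) (dim_col B) :: 'a mat)"
    "j < dim_col (0\<^sub>m (dim_row B) (dim_col B) :: 'a mat)"
  have "(A + B) $$ (i, j) = A $$ (i, j)" using assms by simp
  then show "B $$ (i, j) = 0\<^sub>m (dim_row B) (dim_col B) $$ (i, j)" using ij assms(2,3) by simp
qed auto

lemmas mat_algebra = mat_assoc mat_distrib_right mat_distrib_left mat_one_left mat_one_right
  mat_zero_left mat_zero_right mat_add_zero_left mat_add_zero_right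

text \<open>Replaces a product of two neighbours inside a right-nested product.\<close>

lemma mat_mult_cong_left:
  fixes A B C :: "'a::semiring_0 mat"
  assumes "A * B = D" "dim_col A = dim_row B" "dim_col B = dim_row C"
  shows "A * (B * C) = D * C"
  using assms by (metis mat_assoc)

lemma mat_empty_eq:
  "dim_row A = dim_row B \<Longrightarrow> dim_col A = dim_col B \<Longrightarrow> dim_row A = 0 \<or> dim_col A = 0 \<Longrightarrow> A = B"
  by (rule eq_matI) auto

section \<open>Morphisms\<close>

lemma rel_in_Field: "(x, y) \<in> r \<Longrightarrow> x \<in> Field r \<and> y \<in> Field r"
  by (auto simp: Field_def)

lemma module_dim:
  assumes "is_module r M" "(x, y) \<in> r"
  shows "dim_row (vmap M x y) = vdim M y" "dim_col (vmap M x y) = vdim M x"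
  using assms unfolding is_module_def by auto

lemma hom_dim:
  assumes "is_hom r M N f" "x \<in> Field r"
  shows "dim_row (f x) = vdim N x" "dim_col (f x) = vdim M x"
  using assms unfolding is_hom_def by auto

lemma hom_commute:
  "is_hom r M N f \<Longrightarrow> (x, y) \<in> r \<Longrightarrow> f y * vmap M x y = vmap N x y * f x"
  unfolding is_hom_def by auto

lemma homI:
  assumes "\<And>x. x \<in> Field r \<Longrightarrow> dim_row (f x) = vdim N x"
    and "\<And>x. x \<in> Field r \<Longrightarrow> dim_col (f x) = vdim M x"
    and "\<And>x y. (x, y) \<in> r \<Longrightarrow> x \<in> Field r \<Longrightarrow> y \<in> Field r \<Longrightarrow>
      f y * vmap M x y = vmap N x y * f x"
  shows "is_hom r M N f"
  using assms unfolding is_hom_def by (auto simp: rel_in_Field intro!: carrier_matI)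

lemma hom_comp:
  assumes f: "is_hom r L M f" and g: "is_hom r M N g"
    and M: "is_module r L" "is_module r M" "is_module r N"
  shows "is_hom r L N (\<lambda>x. g x * f x)"
proof (rule homI)
  fix x y assume xy: "(x, y) \<in> r" and F: "x \<in> Field r" "y \<in> Field r"
  note d = hom_dim[OF f F(1)] hom_dim[OF f F(2)] hom_dim[OF g F(1)] hom_dim[OF g F(2)]
    module_dim[OF M(1) xy] module_dim[OF M(2) xy] module_dim[OF M(3) xy]
  have "g y * f y * vmap L x y = g y * (vmap M x y * f x)"
    using d by (simp add: mat_algebra hom_commute[OF f xy])
  also have "\<dots> = vmap N x y * (g x * f x)"
    using d by (simp add: mat_mult_cong_left[OF hom_commute[OF g xy]] mat_algebra)
  finally show "g y * f y * vmap L x y = vmap N x y * (g x * f x)" .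
qed (simp_all add: hom_dim[OF f] hom_dim[OF g])

lemma hom_id: "is_module r M \<Longrightarrow> is_hom r M M (\<lambda>x. 1\<^sub>m (vdim M x))"
  by (rule homI) (auto simp: mat_algebra module_dim)

lemma hom_zero:
  "is_module r M \<Longrightarrow> is_module r N \<Longrightarrow> is_hom r M N (\<lambda>x. 0\<^sub>m (vdim N x) (vdim M x))"
  by (rule homI) (auto simp: mat_algebra module_dim)

lemma hom_add:
  assumes f: "is_hom r M N f" and g: "is_hom r M N g" and M: "is_module r M" "is_module r N"
  shows "is_hom r M N (\<lambda>x. f x + g x)"
proof (rule homI)
  fix x y assume xy: "(x, y) \<in> r" and F: "x \<in> Field r" "y \<in> Field r"
  note d = hom_dim[OF f F(1)] hom_dim[OF f F(2)] hom_dim[OF g F(1)] hom_dim[OF g F(2)]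
    module_dim[OF M(1) xy] module_dim[OF M(2) xy]
  show "(f y + g y) * vmap M x y = vmap N x y * (f x + g x)"
    using d by (simp add: mat_algebra hom_commute[OF f xy] hom_commute[OF g xy])
qed (simp_all add: hom_dim[OF f] hom_dim[OF g])

lemma iso_morI:
  assumes "is_hom r M N f" "is_hom r N M g"
    and "\<And>x. x \<in> Field r \<Longrightarrow> g x * f x = 1\<^sub>m (vdim M x)"
    and "\<And>x. x \<in> Field r \<Longrightarrow> f x * g x = 1\<^sub>m (vdim N x)"
  shows "is_iso_mor r M N f"
  unfolding is_iso_mor_def eq_mor_def comp_mor_def id_mor_def using assms by blast

lemma isomorphicI:
  assumes "is_hom r M N f" "is_hom r N M g"
    and "\<And>x. x \<in> Field r \<Longrightarrow> g x * f x = 1\<^sub>m (vdim M x)"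
    and "\<And>x. x \<in> Field r \<Longrightarrow> f x * g x = 1\<^sub>m (vdim N x)"
  shows "isomorphic r M N"
  using iso_morI[OF assms] unfolding isomorphic_def by blast

lemma iso_morE:
  assumes "is_iso_mor r M N f"
  obtains g where "is_hom r M N f" "is_hom r N M g"
    "\<And>x. x \<in> Field r \<Longrightarrow> g x * f x = 1\<^sub>m (vdim M x)"
    "\<And>x. x \<in> Field r \<Longrightarrow> f x * g x = 1\<^sub>m (vdim N x)"
  using assms unfolding is_iso_mor_def eq_mor_def comp_mor_def id_mor_def by blast

lemma isomorphicE:
  assumes "isomorphic r M N"
  obtains f g where "is_hom r M N f" "is_hom r N M g"
    "\<And>x. x \<in> Field r \<Longrightarrow> g x * f x = 1\<^sub>m (vdim M x)"
    "\<And>x. x \<in> Field r \<Longrightarrow> f x * g x = 1\<^sub>m (vdim N x)"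
proof -
  obtain f where "is_iso_mor r M N f" using assms unfolding isomorphic_def by blast
  then obtain g where "is_hom r M N f" "is_hom r N M g"
    "\<And>x. x \<in> Field r \<Longrightarrow> g x * f x = 1\<^sub>m (vdim M x)"
    "\<And>x. x \<in> Field r \<Longrightarrow> f x * g x = 1\<^sub>m (vdim N x)"
    by (rule iso_morE) (rule that)
  then show thesis by (rule that)
qed

lemma isomorphic_refl: "is_module r M \<Longrightarrow> isomorphic r M M"
  by (rule isomorphicI[OF hom_id hom_id]) auto

lemma isomorphic_sym:
  assumes "isomorphic r M N"
  shows "isomorphic r N M"
proof -
  obtain f g where fg: "is_hom r M N f" "is_hom r N M g"
    "\<And>x. x \<in> Field r \<Longrightarrow> g x * f x = 1\<^sub>m (vdim M x)"
    "\<And>x. x \<in> Field r \<Longrightarrow> f x * g x = 1\<^sub>m (vdim N x)"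
    using assms by (rule isomorphicE) (rule that)
  show ?thesis by (rule isomorphicI[OF fg(2,1,4,3)])
qed

lemma isomorphic_trans:
  assumes "isomorphic r L M" "isomorphic r M N"
    and M: "is_module r L" "is_module r M" "is_module r N"
  shows "isomorphic r L N"
proof -
  obtain f g where f: "is_hom r L M f" "is_hom r M L g"
    "\<And>x. x \<in> Field r \<Longrightarrow> g x * f x = 1\<^sub>m (vdim L x)"
    "\<And>x. x \<in> Field r \<Longrightarrow> f x * g x = 1\<^sub>m (vdim M x)"
    using assms(1) by (rule isomorphicE) (rule that)
  obtain f' g' where f': "is_hom r M N f'" "is_hom r N M g'"
    "\<And>x. x \<in> Field r \<Longrightarrow> g' x * f' x = 1\<^sub>m (vdim M x)"
    "\<And>x. x \<in> Field r \<Longrightarrow> f' x * g' x = 1\<^sub>m (vdim N x)"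
    using assms(2) by (rule isomorphicE) (rule that)
  show ?thesis
  proof (rule isomorphicI[OF hom_comp[OF f(1) f'(1) M] hom_comp[OF f'(2) f(2) M(3,2,1)]])
    fix x assume x: "x \<in> Field r"
    note d = hom_dim[OF f(1) x] hom_dim[OF f(2) x] hom_dim[OF f'(1) x] hom_dim[OF f'(2) x]
    show "g x * g' x * (f' x * f x) = 1\<^sub>m (vdim L x)"
      using d by (simp add: mat_algebra mat_mult_cong_left[OF f'(3)[OF x]] f(3)[OF x])
    show "f' x * f x * (g x * g' x) = 1\<^sub>m (vdim N x)"
      using d by (simp add: mat_algebra mat_mult_cong_left[OF f(4)[OF x]] f'(4)[OF x])
  qed
qed

lemma iso_class_eq_iff:
  assumes "is_module r M" "is_module r N"
  shows "iso_class r M = iso_class r N \<longleftrightarrow> isomorphic r M N"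
proof
  assume "iso_class r M = iso_class r N"
  moreover have "N \<in> iso_class r N"
    using assms(2) isomorphic_refl unfolding iso_class_def by blast
  ultimately show "isomorphic r M N"
    unfolding iso_class_def by blast
next
  assume MN: "isomorphic r M N"
  have "isomorphic r M L \<longleftrightarrow> isomorphic r N L" if "is_module r L" for L
    using isomorphic_trans[OF MN _ assms that] isomorphic_trans[OF isomorphic_sym[OF MN] _ assms(2,1) that]
    by blast
  then show "iso_class r M = iso_class r N"
    unfolding iso_class_def by blast
qed

section \<open>Direct sums as biproducts\<close>

text \<open>A direct sum decomposition of M recorded by its inclusions i, j and projections p, q. Unlike
  block matrices, such data survive the replacement of M or a summand by an isomorphic module. The
  relations p j = 0 and q i = 0 follow from the three equations below.\<close>

definition biproduct ::
  "'p rel \<Rightarrow> ('p, 'k::field) pmod \<Rightarrow> ('p, 'k) pmod \<Rightarrow> ('p, 'k) pmod \<Rightarrow>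
    ('p, 'k) pmor \<Rightarrow> ('p, 'k) pmor \<Rightarrow> ('p, 'k) pmor \<Rightarrow> ('p, 'k) pmor \<Rightarrow> bool" where
  "biproduct r M A B i p j q \<longleftrightarrow>
    is_hom r A M i \<and> is_hom r M A p \<and> is_hom r B M j \<and> is_hom r M B q \<and>
    (\<forall>x\<in>Field r. p x * i x = 1\<^sub>m (vdim A x) \<and> q x * j x = 1\<^sub>m (vdim B x) \<and>
       i x * p x + j x * q x = 1\<^sub>m (vdim M x))"

lemma biproduct_hom:
  assumes "biproduct r M A B i p j q"
  shows "is_hom r A M i" "is_hom r M A p" "is_hom r B M j" "is_hom r M B q"
  using assms unfolding biproduct_def by auto

lemma biproduct_eq:
  assumes "biproduct r M A B i p j q" "x \<in> Field r"
  shows "p x * i x = 1\<^sub>m (vdim A x)" "q x * j x = 1\<^sub>m (vdim B x)"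
    "i x * p x + j x * q x = 1\<^sub>m (vdim M x)"
  using assms unfolding biproduct_def by auto

lemma biproduct_dim:
  assumes b: "biproduct r M A B i p j q" and x: "x \<in> Field r"
  shows "dim_row (i x) = vdim M x" "dim_col (i x) = vdim A x"
    "dim_row (p x) = vdim A x" "dim_col (p x) = vdim M x"
    "dim_row (j x) = vdim M x" "dim_col (j x) = vdim B x"
    "dim_row (q x) = vdim B x" "dim_col (q x) = vdim M x"
  by (simp_all add: hom_dim[OF biproduct_hom(1)[OF b] x] hom_dim[OF biproduct_hom(2)[OF b] x]
      hom_dim[OF biproduct_hom(3)[OF b] x] hom_dim[OF biproduct_hom(4)[OF b] x])

lemma biproduct_swap:
  assumes b: "biproduct r M A B i p j q"
  shows "biproduct r M B A j q i p"
proof -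
  have "j x * q x + i x * p x = i x * p x + j x * q x" if "x \<in> Field r" for x
    using biproduct_dim[OF b that] by (intro comm_add_mat[of _ "vdim M x" "vdim M x"]) auto
  then show ?thesis using b unfolding biproduct_def by auto
qed

lemma complementary_matrices_orthogonal:
  fixes i p j q :: "'a::field mat"
  assumes e: "p * i = 1\<^sub>m a" "q * j = 1\<^sub>m b" "i * p + j * q = 1\<^sub>m m"
    and d: "dim_row i = m" "dim_col i = a" "dim_row p = a" "dim_col p = m"
      "dim_row j = m" "dim_col j = b" "dim_row q = b" "dim_col q = m"
  shows "p * j = 0\<^sub>m a b"
proof -
  have "p * (i * p + j * q) = p" using d by (simp add: e mat_algebra)
  then have "p + p * (j * q) = p"
    using d by (simp add: mat_distrib_left mat_mult_cong_left[OF e(1)] mat_one_left)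
  from mat_add_cancel_zero[OF this] d
  have "p * (j * q) = 0\<^sub>m a m" by simp
  then have "p * (j * q) * j = 0\<^sub>m a m * j" by simp
  then show ?thesis using d by (simp add: mat_algebra e)
qed

lemma biproduct_orthogonal:
  assumes b: "biproduct r M A B i p j q" and x: "x \<in> Field r"
  shows "p x * j x = 0\<^sub>m (vdim A x) (vdim B x)"
  by (rule complementary_matrices_orthogonal[OF biproduct_eq[OF b x] biproduct_dim[OF b x]])

text \<open>Both composites of the matrix (i' p + j' q) with its mirror image collapse to identities, so
  direct sum decompositions determine a module up to isomorphism.\<close>

lemma biproduct_unique:
  assumes b: "biproduct r M A B i p j q" and c: "biproduct r N A B i' p' j' q'"
    and M: "is_module r M" "is_module r N" "is_module r A" "is_module r B"
  shows "isomorphic r M N"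
proof (rule isomorphicI)
  show "is_hom r M N (\<lambda>x. i' x * p x + j' x * q x)"
    by (intro hom_add hom_comp[OF biproduct_hom(2)[OF b] biproduct_hom(1)[OF c]]
        hom_comp[OF biproduct_hom(4)[OF b] biproduct_hom(3)[OF c]] M)
  show "is_hom r N M (\<lambda>x. i x * p' x + j x * q' x)"
    by (intro hom_add hom_comp[OF biproduct_hom(2)[OF c] biproduct_hom(1)[OF b]]
        hom_comp[OF biproduct_hom(4)[OF c] biproduct_hom(3)[OF b]] M)
  fix x assume x: "x \<in> Field r"
  note d = biproduct_dim[OF b x] biproduct_dim[OF c x]
  note e = biproduct_eq[OF b x] biproduct_orthogonal[OF b x] biproduct_orthogonal[OF biproduct_swap[OF b] x]
  note e' = biproduct_eq[OF c x] biproduct_orthogonal[OF c x] biproduct_orthogonal[OF biproduct_swap[OF c] x]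
  show "(i x * p' x + j x * q' x) * (i' x * p x + j' x * q x) = 1\<^sub>m (vdim M x)"
    using d by (simp add: mat_algebra e' e mat_mult_cong_left[OF e'(1)] mat_mult_cong_left[OF e'(2)]
        mat_mult_cong_left[OF e'(4)] mat_mult_cong_left[OF e'(5)])
  show "(i' x * p x + j' x * q x) * (i x * p' x + j x * q' x) = 1\<^sub>m (vdim N x)"
    using d by (simp add: mat_algebra e' e mat_mult_cong_left[OF e(1)] mat_mult_cong_left[OF e(2)]
        mat_mult_cong_left[OF e(4)] mat_mult_cong_left[OF e(5)])
qed

lemma dsum_sel [simp]:
  "vdim (dsum M N) x = vdim M x + vdim N x"
  "vmap (dsum M N) x y = four_block_mat
        (vmap M x y) (0\<^sub>m (vdim M y) (vdim N x))
        (0\<^sub>m (vdim N y) (vdim M x)) (vmap N x y)"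
  by (simp_all add: dsum_def)

lemma module_dsum:
  assumes M: "is_module r M" and N: "is_module r N"
  shows "is_module r (dsum M N)"
  unfolding is_module_def
proof (intro conjI allI impI ballI)
  fix x y assume "(x, y) \<in> r"
  then show "vmap (dsum M N) x y \<in> carrier_mat (vdim (dsum M N) y) (vdim (dsum M N) x)"
    using M N unfolding is_module_def by (auto intro!: four_block_carrier_mat)
next
  fix x assume x: "x \<in> Field r"
  then show "vmap (dsum M N) x x = 1\<^sub>m (vdim (dsum M N) x)"
    using M N unfolding is_module_def by (simp add: four_block_one_mat)
next
  fix x y z assume xy: "(x, y) \<in> r" and yz: "(y, z) \<in> r"
  note c = M[unfolded is_module_def] N[unfolded is_module_def]
  have *: "vmap M x y \<in> carrier_mat (vdim M y) (vdim M x)" "vmap M y z \<in> carrier_mat (vdim M z) (vdim M y)"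
    "vmap N x y \<in> carrier_mat (vdim N y) (vdim N x)" "vmap N y z \<in> carrier_mat (vdim N z) (vdim N y)"
    "vmap M y z * vmap M x y = vmap M x z" "vmap N y z * vmap N x y = vmap N x z"
    using c xy yz by blast+
  have d: "dim_row (vmap M x z) = vdim M z" "dim_col (vmap M x z) = vdim M x"
     "dim_row (vmap N x z) = vdim N z" "dim_col (vmap N x z) = vdim N x"
    using *(1-4) *(5,6)[symmetric] by auto
  show "vmap (dsum M N) y z * vmap (dsum M N) x y = vmap (dsum M N) x z"
    using * d by (simp add: mult_four_block_mat[OF *(2) _ _ *(4) *(1) _ _ *(3)] mat_algebra)
qed

lemma biproduct_dsum:
  assumes M: "is_module r M" and N: "is_module r N"
  shows "biproduct r (dsum M N) M N
    (\<lambda>x. four_block_mat (1\<^sub>m (vdim M x)) (0\<^sub>m (vdim M x) 0) (0\<^sub>m (vdim N x) (vdim M x)) (0\<^sub>m (vdim N x) 0))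
    (\<lambda>x. four_block_mat (1\<^sub>m (vdim M x)) (0\<^sub>m (vdim M x) (vdim N x)) (0\<^sub>m 0 (vdim M x)) (0\<^sub>m 0 (vdim N x)))
    (\<lambda>x. four_block_mat (0\<^sub>m (vdim M x) 0) (0\<^sub>m (vdim M x) (vdim N x)) (0\<^sub>m (vdim N x) 0) (1\<^sub>m (vdim N x)))
    (\<lambda>x. four_block_mat (0\<^sub>m 0 (vdim M x)) (0\<^sub>m 0 (vdim N x)) (0\<^sub>m (vdim N x) (vdim M x)) (1\<^sub>m (vdim N x)))"
    (is "biproduct _ _ _ _ ?i ?p ?j ?q")
proof -
  have four: "four_block_mat A (0\<^sub>m a 0) (0\<^sub>m 0 b) (0\<^sub>m 0 0) = A" if "dim_row A = a" "dim_col A = b"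
    for A :: "'b mat" and a b
    using that by (auto intro!: eq_matI)
  have four': "four_block_mat (0\<^sub>m 0 0) (0\<^sub>m 0 b) (0\<^sub>m a 0) A = A" if "dim_row A = a" "dim_col A = b"
    for A :: "'b mat" and a b
    using that by (auto intro!: eq_matI)
  show ?thesis
    unfolding biproduct_def
  proof (intro conjI ballI)
    show "is_hom r M (dsum M N) ?i"
    proof (rule homI)
      fix x y assume xy: "(x, y) \<in> r"
      note d = module_dim[OF M xy] module_dim[OF N xy]
      have "?i y * vmap M x y = ?i y * four_block_mat (vmap M x y) (0\<^sub>m (vdim M y) 0) (0\<^sub>m 0 (vdim M x)) (0\<^sub>m 0 0)"
        using d by (simp add: four)
      also have "\<dots> = four_block_mat (vmap M x y) (0\<^sub>m (vdim M y) 0) (0\<^sub>m (vdim N y) (vdim M x)) (0\<^sub>m (vdim N y) 0)"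
        using d by (subst mult_four_block_mat) (auto simp: mat_algebra)
      also have "\<dots> = vmap (dsum M N) x y * ?i x"
        using d by (simp, subst mult_four_block_mat) (auto simp: mat_algebra)
      finally show "?i y * vmap M x y = vmap (dsum M N) x y * ?i x" .
    qed auto
    show "is_hom r (dsum M N) M ?p"
    proof (rule homI)
      fix x y assume xy: "(x, y) \<in> r"
      note d = module_dim[OF M xy] module_dim[OF N xy]
      have "vmap M x y * ?p x = four_block_mat (vmap M x y) (0\<^sub>m (vdim M y) 0) (0\<^sub>m 0 (vdim M x)) (0\<^sub>m 0 0) * ?p x"
        using d by (simp add: four)
      also have "\<dots> = four_block_mat (vmap M x y) (0\<^sub>m (vdim M y) (vdim N x)) (0\<^sub>m 0 (vdim M x)) (0\<^sub>m 0 (vdim N x))"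
        using d by (subst mult_four_block_mat) (auto simp: mat_algebra)
      also have "\<dots> = ?p y * vmap (dsum M N) x y"
        using d by (simp, subst mult_four_block_mat) (auto simp: mat_algebra)
      finally show "?p y * vmap (dsum M N) x y = vmap M x y * ?p x" by simp
    qed auto
    show "is_hom r N (dsum M N) ?j"
    proof (rule homI)
      fix x y assume xy: "(x, y) \<in> r"
      note d = module_dim[OF M xy] module_dim[OF N xy]
      have "?j y * vmap N x y = ?j y * four_block_mat (0\<^sub>m 0 0) (0\<^sub>m 0 (vdim N x)) (0\<^sub>m (vdim N y) 0) (vmap N x y)"
        using d by (simp add: four')
      also have "\<dots> = four_block_mat (0\<^sub>m (vdim M y) 0) (0\<^sub>m (vdim M y) (vdim N x)) (0\<^sub>m (vdim N y) 0) (vmap N x y)"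
        using d by (subst mult_four_block_mat) (auto simp: mat_algebra)
      also have "\<dots> = vmap (dsum M N) x y * ?j x"
        using d by (simp, subst mult_four_block_mat) (auto simp: mat_algebra)
      finally show "?j y * vmap N x y = vmap (dsum M N) x y * ?j x" .
    qed auto
    show "is_hom r (dsum M N) N ?q"
    proof (rule homI)
      fix x y assume xy: "(x, y) \<in> r"
      note d = module_dim[OF M xy] module_dim[OF N xy]
      have "vmap N x y * ?q x = four_block_mat (0\<^sub>m 0 0) (0\<^sub>m 0 (vdim N x)) (0\<^sub>m (vdim N y) 0) (vmap N x y) * ?q x"
        using d by (simp add: four')
      also have "\<dots> = four_block_mat (0\<^sub>m 0 (vdim M x)) (0\<^sub>m 0 (vdim N x)) (0\<^sub>m (vdim N y) (vdim M x)) (vmap N x y)"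
        using d by (subst mult_four_block_mat) (auto simp: mat_algebra)
      also have "\<dots> = ?q y * vmap (dsum M N) x y"
        using d by (simp, subst mult_four_block_mat) (auto simp: mat_algebra)
      finally show "?q y * vmap (dsum M N) x y = vmap N x y * ?q x" by simp
    qed auto
    fix x assume "x \<in> Field r"
    show "?p x * ?i x = 1\<^sub>m (vdim M x)"
      by (subst mult_four_block_mat) (auto simp: mat_algebra four)
    show "?q x * ?j x = 1\<^sub>m (vdim N x)"
      by (subst mult_four_block_mat) (auto simp: mat_algebra four')
    show "?i x * ?p x + ?j x * ?q x = 1\<^sub>m (vdim (dsum M N) x)"
      by (subst mult_four_block_mat, auto, subst mult_four_block_mat) 
       (auto simp: mat_algebra intro!: eq_matI)
  qed
qed


lemma isomorphic_dsumI:
  assumes "biproduct r M A B i p j q" "is_module r M" "is_module r A" "is_module r B"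
  shows "isomorphic r M (dsum A B)"
  using biproduct_unique[OF assms(1) biproduct_dsum] assms module_dsum by blast

lemma biproduct_iso_left:
  assumes b: "biproduct r M A B i p j q" and "isomorphic r A A'"
    and M: "is_module r M" "is_module r A" "is_module r A'" "is_module r B"
  shows "\<exists>i' p'. biproduct r M A' B i' p' j q"
proof -
  obtain f g where f: "is_hom r A A' f" "is_hom r A' A g"
    "\<And>x. x \<in> Field r \<Longrightarrow> g x * f x = 1\<^sub>m (vdim A x)"
    "\<And>x. x \<in> Field r \<Longrightarrow> f x * g x = 1\<^sub>m (vdim A' x)"
    using assms(2) by (rule isomorphicE) (rule that)
  have "biproduct r M A' B (\<lambda>x. i x * g x) (\<lambda>x. f x * p x) j q"
    unfolding biproduct_def
  proof (intro conjI ballI)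
    fix x assume x: "x \<in> Field r"
    note d = biproduct_dim[OF b x] hom_dim[OF f(1) x] hom_dim[OF f(2) x]
    note e = biproduct_eq[OF b x]
    show "f x * p x * (i x * g x) = 1\<^sub>m (vdim A' x)"
      using d by (simp add: mat_algebra mat_mult_cong_left[OF e(1)] f(4)[OF x])
    show "q x * j x = 1\<^sub>m (vdim B x)" by (rule e(2))
    show "i x * g x * (f x * p x) + j x * q x = 1\<^sub>m (vdim M x)"
      using d by (simp add: mat_assoc mat_mult_cong_left[OF f(3)[OF x]] mat_one_left e(3))
  qed (use biproduct_hom[OF b] f(1,2) M in \<open>auto intro: hom_comp\<close>)
  then show ?thesis by blast
qed

lemma dsum_cong:
  assumes "isomorphic r A A'" "isomorphic r B B'"
    and M: "is_module r A" "is_module r A'" "is_module r B" "is_module r B'"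
  shows "isomorphic r (dsum A B) (dsum A' B')"
proof -
  note D = module_dsum[OF M(1,3)]
  obtain i p j q where "biproduct r (dsum A B) A' B i p j q"
    using biproduct_iso_left[OF biproduct_dsum[OF M(1,3)] assms(1) D M(1,2,3)] by blast
  from biproduct_iso_left[OF biproduct_swap[OF this] assms(2) D M(3,4,2)]
  obtain j' q' where "biproduct r (dsum A B) B' A' j' q' i p" by blast
  from isomorphic_dsumI[OF biproduct_swap[OF this] D M(2,4)] show ?thesis .
qed

lemma isomorphic_if_equal:
  assumes M: "is_module r M" and d: "\<And>x. x \<in> Field r \<Longrightarrow> vdim M x = vdim N x"
    and v: "\<And>x y. (x, y) \<in> r \<Longrightarrow> vmap M x y = vmap N x y"
  shows "isomorphic r M N"
proof (rule isomorphicI)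
  show "is_hom r M N (\<lambda>x. 1\<^sub>m (vdim M x))"
    by (rule homI) (auto simp: d rel_in_Field v[symmetric] mat_algebra module_dim[OF M])
  show "is_hom r N M (\<lambda>x. 1\<^sub>m (vdim M x))"
    by (rule homI) (auto simp: d rel_in_Field v[symmetric] mat_algebra module_dim[OF M])
qed (auto simp: d)

lemma dsum_assoc:
  assumes M: "is_module r A" "is_module r B" "is_module r C"
  shows "isomorphic r (dsum (dsum A B) C) (dsum A (dsum B C))"
proof (rule isomorphic_if_equal)
  show "is_module r (dsum (dsum A B) C)" by (intro module_dsum M)
  fix x y assume xy: "(x, y) \<in> r"
  show "vmap (dsum (dsum A B) C) x y = vmap (dsum A (dsum B C)) x y"
    using assoc_four_block_mat[of "vmap A x y" "vmap B x y" "vmap C x y"]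
    by (simp add: module_dim[OF M(1) xy] module_dim[OF M(2) xy] module_dim[OF M(3) xy])
qed simp

lemma dsum_zero_left:
  assumes M: "is_module r A" "is_module r Z" and Z: "is_zero r Z"
  shows "isomorphic r A (dsum Z A)"
proof -
  have "biproduct r A Z A (\<lambda>x. 0\<^sub>m (vdim A x) (vdim Z x)) (\<lambda>x. 0\<^sub>m (vdim Z x) (vdim A x))
    (\<lambda>x. 1\<^sub>m (vdim A x)) (\<lambda>x. 1\<^sub>m (vdim A x))"
    using Z unfolding biproduct_def is_zero_def
    by (auto simp: hom_zero hom_id M mat_algebra)
  from isomorphic_dsumI[OF this M(1,2,1)] show ?thesis .
qed

lemma dsum_zero_right:
  assumes M: "is_module r A" "is_module r Z" and Z: "is_zero r Z"
  shows "isomorphic r A (dsum A Z)"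
proof -
  have "biproduct r A A Z (\<lambda>x. 1\<^sub>m (vdim A x)) (\<lambda>x. 1\<^sub>m (vdim A x))
    (\<lambda>x. 0\<^sub>m (vdim A x) (vdim Z x)) (\<lambda>x. 0\<^sub>m (vdim Z x) (vdim A x))"
    using Z unfolding biproduct_def is_zero_def
    by (auto simp: hom_zero hom_id M mat_algebra)
  from isomorphic_dsumI[OF this M(1,1,2)] show ?thesis .
qed

lemma module_zero [simp]: "is_module r zero_module"
  unfolding is_module_def zero_module_def by auto

lemma is_zero_zero_module [simp]: "is_zero r zero_module"
  unfolding is_zero_def zero_module_def by simp

lemma is_zero_isomorphic:
  assumes "isomorphic r M N" "is_zero r M"
  shows "is_zero r N"
  unfolding is_zero_def
proof
  obtain f g where f: "is_hom r M N f" "is_hom r N M g"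
    "\<And>x. x \<in> Field r \<Longrightarrow> g x * f x = 1\<^sub>m (vdim M x)"
    "\<And>x. x \<in> Field r \<Longrightarrow> f x * g x = 1\<^sub>m (vdim N x)"
    using assms(1) by (rule isomorphicE) (rule that)
  fix x assume x: "x \<in> Field r"
  show "vdim N x = 0"
  proof (rule ccontr)
    assume "vdim N x \<noteq> 0"
    then have "(f x * g x) $$ (0, 0) = 1" by (simp add: f(4)[OF x])
    moreover have "(f x * g x) $$ (0, 0) = 0"
      using \<open>vdim N x \<noteq> 0\<close> assms(2) x hom_dim[OF f(1) x] hom_dim[OF f(2) x]
      by (simp add: is_zero_def scalar_prod_def)
    ultimately show False by simp
  qed
qed

lemma module_foldr_dsum:
  "(\<And>M. M \<in> set Ms \<Longrightarrow> is_module r M) \<Longrightarrow> is_module r (foldr dsum Ms zero_module)"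
  by (induction Ms) (auto intro: module_dsum)

lemma foldr_dsum_append:
  assumes "\<And>M. M \<in> set Ms \<Longrightarrow> is_module r M" "\<And>M. M \<in> set Ns \<Longrightarrow> is_module r M"
  shows "isomorphic r (foldr dsum (Ms @ Ns) zero_module)
    (dsum (foldr dsum Ms zero_module) (foldr dsum Ns zero_module))"
  using assms
proof (induction Ms)
  case Nil
  then show ?case by (auto intro!: dsum_zero_left module_foldr_dsum)
next
  case (Cons M Ms)
  let ?S = "\<lambda>Ls. foldr dsum Ls zero_module"
  have m: "is_module r M" "is_module r (?S Ms)" "is_module r (?S Ns)" "is_module r (?S (Ms @ Ns))"
    using Cons.prems by (auto intro!: module_foldr_dsum simp del: foldr_append)
  have "isomorphic r (dsum M (?S (Ms @ Ns))) (dsum M (dsum (?S Ms) (?S Ns)))"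
    using Cons m by (intro dsum_cong isomorphic_refl module_dsum) auto
  moreover have "isomorphic r (dsum M (dsum (?S Ms) (?S Ns))) (dsum (dsum M (?S Ms)) (?S Ns))"
    by (intro isomorphic_sym[OF dsum_assoc] m)
  ultimately show ?case
    using m by (auto intro: isomorphic_trans[of r _ "dsum M (dsum (?S Ms) (?S Ns))"] module_dsum)
qed

section \<open>Splitting off a summand\<close>

text \<open>The complement is carried by the matrices e M c: the off-diagonal terms e M i and p M c
  vanish because i and p are morphisms and e i = 0, p c = 0.\<close>

lemma complement_biproduct:
  fixes M A :: "('p, 'k::field) pmod"
  assumes M: "is_module r M" "is_module r A"
    and i: "is_hom r A M i" and p: "is_hom r M A p"
    and d: "\<And>x. x \<in> Field r \<Longrightarrow> c x \<in> carrier_mat (vdim M x) (k x)"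
      "\<And>x. x \<in> Field r \<Longrightarrow> e x \<in> carrier_mat (k x) (vdim M x)"
    and pi: "\<And>x. x \<in> Field r \<Longrightarrow> p x * i x = 1\<^sub>m (vdim A x)"
    and ec: "\<And>x. x \<in> Field r \<Longrightarrow> e x * c x = 1\<^sub>m (k x)"
    and sum: "\<And>x. x \<in> Field r \<Longrightarrow> i x * p x + c x * e x = 1\<^sub>m (vdim M x)"
  defines "C \<equiv> \<lparr>vdim = k, vmap = (\<lambda>x y. e y * (vmap M x y * c x))\<rparr>"
  shows "is_module r C" "biproduct r M A C i p c e"
proof -
  have D: "dim_row (i x) = vdim M x" "dim_col (i x) = vdim A x"
    "dim_row (p x) = vdim A x" "dim_col (p x) = vdim M x"
    "dim_row (c x) = vdim M x" "dim_col (c x) = k x"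
    "dim_row (e x) = k x" "dim_col (e x) = vdim M x" if "x \<in> Field r" for x
    using hom_dim[OF i that] hom_dim[OF p that] d[OF that] by auto
  have pc: "p x * c x = 0\<^sub>m (vdim A x) (k x)" if "x \<in> Field r" for x
    by (rule complementary_matrices_orthogonal[OF pi ec sum]) (use that D in auto)
  have ei: "e x * i x = 0\<^sub>m (k x) (vdim A x)" if "x \<in> Field r" for x
  proof (rule complementary_matrices_orthogonal[OF ec pi])
    show "c x * e x + i x * p x = 1\<^sub>m (vdim M x)"
      unfolding sum[OF that, symmetric] by (rule comm_add_mat[of _ "vdim M x" "vdim M x"]) (use that D in auto)
  qed (use that D in auto)
  have eM: "e y * vmap M x y = e y * (vmap M x y * (c x * e x))" if xy: "(x, y) \<in> r" for x y
  proof -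
    have F: "x \<in> Field r" "y \<in> Field r" using rel_in_Field[OF xy] by auto
    note dd = D[OF F(1)] D[OF F(2)] module_dim[OF M(1) xy] module_dim[OF M(2) xy]
    have "e y * vmap M x y = e y * (vmap M x y * (i x * p x + c x * e x))"
      using dd by (simp add: sum[OF F(1)] mat_one_right)
    also have "\<dots> = e y * (vmap M x y * (i x * p x)) + e y * (vmap M x y * (c x * e x))"
      using dd by (simp add: mat_distrib_left)
    also have "e y * (vmap M x y * (i x * p x)) = 0\<^sub>m (k y) (vdim M x)"
      using dd by (simp add: mat_mult_cong_left[OF hom_commute[OF i xy, symmetric]] mat_assoc
          mat_mult_cong_left[OF ei[OF F(2)]] mat_zero_left)
    finally show ?thesis using dd by (simp add: mat_add_zero_left)
  qed
  have Mc: "vmap M x y * c x = c y * (e y * (vmap M x y * c x))" if xy: "(x, y) \<in> r" for x y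
  proof -
    have F: "x \<in> Field r" "y \<in> Field r" using rel_in_Field[OF xy] by auto
    note dd = D[OF F(1)] D[OF F(2)] module_dim[OF M(1) xy] module_dim[OF M(2) xy]
    have "vmap M x y * c x = (i y * p y + c y * e y) * (vmap M x y * c x)"
      using dd by (simp add: sum[OF F(2)] mat_one_left)
    also have "\<dots> = i y * (p y * (vmap M x y * c x)) + c y * (e y * (vmap M x y * c x))"
      using dd by (simp add: mat_distrib_right mat_assoc)
    also have "i y * (p y * (vmap M x y * c x)) = 0\<^sub>m (vdim M y) (k x)"
      using dd by (simp add: mat_mult_cong_left[OF hom_commute[OF p xy]] mat_assoc
          pc[OF F(1)] mat_zero_right)
    finally show ?thesis using dd by (simp add: mat_add_zero_left)
  qed
  show C: "is_module r C"
    unfolding is_module_def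
  proof (intro conjI allI impI ballI)
    fix x y assume xy: "(x, y) \<in> r"
    then have F: "x \<in> Field r" "y \<in> Field r" by (auto simp: Field_def)
    show "vmap C x y \<in> carrier_mat (vdim C y) (vdim C x)"
      using D[OF F(1)] D[OF F(2)] unfolding C_def by auto
  next
    fix x assume x: "x \<in> Field r"
    then have "vmap M x x = 1\<^sub>m (vdim M x)" using M(1) unfolding is_module_def by auto
    then show "vmap C x x = 1\<^sub>m (vdim C x)"
      using D[OF x] ec[OF x] by (simp add: C_def mat_one_left)
  next
    fix x y z assume xy: "(x, y) \<in> r" and yz: "(y, z) \<in> r"
    have F: "x \<in> Field r" "y \<in> Field r" "z \<in> Field r"
      using rel_in_Field[OF xy] rel_in_Field[OF yz] by auto
    note dd = D[OF F(1)] D[OF F(2)] D[OF F(3)] module_dim[OF M(1) xy] module_dim[OF M(1) yz]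
    have "vmap M x z = vmap M y z * vmap M x y"
      using M(1) xy yz unfolding is_module_def by auto
    then have "vmap C x z = e z * (vmap M y z * (vmap M x y * c x))"
      using dd by (simp add: C_def mat_assoc)
    also have "\<dots> = e z * (vmap M y z * (c y * (e y * (vmap M x y * c x))))"
      by (simp add: Mc[OF xy, symmetric])
    also have "\<dots> = vmap C y z * vmap C x y"
      using dd by (simp add: C_def mat_assoc)
    finally show "vmap C y z * vmap C x y = vmap C x z" by simp
  qed
  show "biproduct r M A C i p c e"
    unfolding biproduct_def
  proof (intro conjI ballI i p)
    show "is_hom r C M c"
      by (rule homI) (simp_all add: D C_def Mc[symmetric])
    show "is_hom r M C e"
    proof (rule homI)
      fix x y assume xy: "(x, y) \<in> r" and F: "x \<in> Field r" "y \<in> Field r"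
      note dd = D[OF F(1)] D[OF F(2)] module_dim[OF M(1) xy] module_dim[OF M(2) xy]
      show "e y * vmap M x y = vmap C x y * e x"
        by (subst eM[OF xy]) (use dd in \<open>simp add: C_def mat_assoc\<close>)
    qed (simp_all add: D C_def)
  qed (simp_all add: pi ec sum C_def)
qed

lemma bij_skip: "p < d \<Longrightarrow> bij_betw (\<lambda>j. if j < p then j else Suc j) {0..<d - 1} ({0..<d} - {p})"
  by (rule bij_betw_byWitness[where f' = "\<lambda>s. if s < p then s else s - 1"]) auto

text \<open>If the column a and the row b satisfy b a = 1, some entry of a at a position p is nonzero,
  and the unit vectors away from p, corrected by multiples of a so that b kills them, span the
  kernel of b.\<close>

lemma complement_matrices:
  fixes a b :: "'a::field mat"
  assumes a: "a \<in> carrier_mat d 1" and b: "b \<in> carrier_mat 1 d" and ba: "b * a = 1\<^sub>m 1"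
  shows "\<exists>c\<in>carrier_mat d (d - 1). \<exists>e\<in>carrier_mat (d - 1) d.
    e * c = 1\<^sub>m (d - 1) \<and> a * b + c * e = 1\<^sub>m d \<and> 0 < d"
proof -
  define u where "u = (\<lambda>s. a $$ (s, 0))"
  define w where "w = (\<lambda>s. b $$ (0, s))"
  have "(b * a) $$ (0, 0) = 1" by (simp add: ba)
  then have wu: "(\<Sum>s\<in>{0..<d}. w s * u s) = 1"
    using a b by (simp add: scalar_prod_def u_def w_def)
  obtain p where p: "p < d" "u p \<noteq> 0"
    by (metis (no_types, lifting) atLeastLessThan_iff mult_zero_right sum.neutral wu zero_neq_one)
  define s where "s = (\<lambda>j. if j < p then j else Suc j)"
  have s_lt: "s j < d" "s j \<noteq> p" if "j < d - 1" for j using that p by (auto simp: s_def)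
  have s_inj: "s i = s j \<longleftrightarrow> i = j" for i j by (auto simp: s_def)
  have s_bij: "bij_betw s {0..<d - 1} ({0..<d} - {p})" unfolding s_def by (rule bij_skip[OF p(1)])
  define cc where "cc = (\<lambda>l t. (if l = t then 1 else 0) - u l * w t)"
  define ee where "ee = (\<lambda>t m. (if t = m then 1 else 0) - (if m = p then u t / u p else 0))"
  define c where "c = mat d (d - 1) (\<lambda>(l, j). cc l (s j))"
  define e where "e = mat (d - 1) d (\<lambda>(j, m). ee (s j) m)"
  have "e * c = 1\<^sub>m (d - 1)"
  proof (rule eq_matI)
    fix i j assume "i < dim_row (1\<^sub>m (d - 1) :: 'a mat)" "j < dim_col (1\<^sub>m (d - 1) :: 'a mat)"
    then have ij: "i < d - 1" "j < d - 1" by auto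
    have "(e * c) $$ (i, j) = (\<Sum>l\<in>{0..<d}. ee (s i) l * cc l (s j))"
      using ij by (simp add: e_def c_def scalar_prod_def)
    also have "\<dots> = (\<Sum>l\<in>{0..<d}. (if s i = l then cc l (s j) else 0) -
        (if l = p then u (s i) / u p * cc l (s j) else 0))"
      by (rule sum.cong) (auto simp: ee_def algebra_simps)
    also have "\<dots> = cc (s i) (s j) - u (s i) / u p * cc p (s j)"
      using s_lt[OF ij(1)] p by (simp add: sum_subtractf)
    also have "\<dots> = (if i = j then 1 else 0)"
      using s_lt[OF ij(2)] p by (auto simp: cc_def s_inj)
    finally show "(e * c) $$ (i, j) = 1\<^sub>m (d - 1) $$ (i, j)" using ij by simp
  qed (auto simp: e_def c_def)
  moreover have "a * b + c * e = 1\<^sub>m d"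
  proof (rule eq_matI)
    fix l m assume "l < dim_row (1\<^sub>m d :: 'a mat)" "m < dim_col (1\<^sub>m d :: 'a mat)"
    then have lm: "l < d" "m < d" by auto
    have "(c * e) $$ (l, m) = (\<Sum>j\<in>{0..<d - 1}. cc l (s j) * ee (s j) m)"
      using lm by (simp add: e_def c_def scalar_prod_def)
    also have "\<dots> = (\<Sum>t\<in>{0..<d} - {p}. cc l t * ee t m)"
      by (rule sum.reindex_bij_betw[OF s_bij])
    also have "\<dots> = (\<Sum>t\<in>{0..<d}. cc l t * ee t m) - cc l p * ee p m"
      using p by (simp add: sum_diff1)
    also have "cc l p * ee p m = 0" using p by (simp add: ee_def)
    also have "(\<Sum>t\<in>{0..<d}. cc l t * ee t m) =
        (\<Sum>t\<in>{0..<d}. (if t = m then cc l t else 0) -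
          (if m = p then ((if l = t then u t else 0) - u l * (w t * u t)) / u p else 0))"
      by (rule sum.cong) (auto simp: ee_def cc_def field_simps)
    also have "\<dots> = cc l m - (if m = p
        then (\<Sum>t\<in>{0..<d}. ((if l = t then u t else 0) - u l * (w t * u t)) / u p) else 0)"
      using lm by (simp add: sum_subtractf)
    also have "(\<Sum>t\<in>{0..<d}. ((if l = t then u t else 0) - u l * (w t * u t)) / u p) = 0"
      using lm by (simp add: sum_subtractf wu flip: sum_divide_distrib sum_distrib_left)
    finally have "(c * e) $$ (l, m) = cc l m" by simp
    then show "(a * b + c * e) $$ (l, m) = 1\<^sub>m d $$ (l, m)"
      using lm a b by (simp add: cc_def c_def e_def scalar_prod_def u_def w_def)
  qed (use a b in \<open>auto simp: e_def c_def\<close>)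
  moreover have "c \<in> carrier_mat d (d - 1)" "e \<in> carrier_mat (d - 1) d"
    by (auto simp: c_def e_def)
  moreover have "0 < d" using p by simp
  ultimately show ?thesis by blast
qed

text \<open>The complement of the image of i is the kernel of p; where A has dimension one, the previous
  lemma provides coordinates on it.\<close>

lemma thin_summand_splits:
  fixes M A :: "('p, 'k::field) pmod"
  assumes M: "is_module r M" "is_module r A"
    and thin: "\<And>x. x \<in> Field r \<Longrightarrow> vdim A x \<le> 1"
    and i: "is_hom r A M i" and p: "is_hom r M A p"
    and pi: "\<And>x. x \<in> Field r \<Longrightarrow> p x * i x = 1\<^sub>m (vdim A x)"
  obtains C where "is_module r C" "isomorphic r M (dsum A C)"
    "\<And>x. x \<in> Field r \<Longrightarrow> vdim M x = vdim A x + vdim C x"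
proof -
  have "\<exists>c e. c \<in> carrier_mat (vdim M x) (vdim M x - vdim A x) \<and>
      e \<in> carrier_mat (vdim M x - vdim A x) (vdim M x) \<and>
      e * c = 1\<^sub>m (vdim M x - vdim A x) \<and> i x * p x + c * e = 1\<^sub>m (vdim M x) \<and> vdim A x \<le> vdim M x"
    if x: "x \<in> Field r" for x
  proof (cases "vdim A x = 0")
    case True
    have "i x * p x = 0\<^sub>m (vdim M x) (vdim M x)"
      using True hom_dim[OF i x] hom_dim[OF p x] by (intro eq_matI) (auto simp: scalar_prod_def)
    then show ?thesis using True
      by (intro exI[of _ "1\<^sub>m (vdim M x)"]) (auto simp: mat_algebra)
  next
    case False
    then have 1: "vdim A x = 1" using thin[OF x] by auto
    have "i x \<in> carrier_mat (vdim M x) 1" "p x \<in> carrier_mat 1 (vdim M x)" "p x * i x = 1\<^sub>m 1"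
      using 1 hom_dim[OF i x] hom_dim[OF p x] pi[OF x] by (auto intro!: carrier_matI)
    from complement_matrices[OF this] obtain c e where
      "c \<in> carrier_mat (vdim M x) (vdim M x - 1)" "e \<in> carrier_mat (vdim M x - 1) (vdim M x)"
      "e * c = 1\<^sub>m (vdim M x - 1)" "i x * p x + c * e = 1\<^sub>m (vdim M x)" "0 < vdim M x"
      by blast
    then show ?thesis unfolding 1 by (intro exI[of _ c] exI[of _ e]) simp
  qed
  then obtain c e where ce: "\<And>x. x \<in> Field r \<Longrightarrow> c x \<in> carrier_mat (vdim M x) (vdim M x - vdim A x)"
      "\<And>x. x \<in> Field r \<Longrightarrow> e x \<in> carrier_mat (vdim M x - vdim A x) (vdim M x)"
      "\<And>x. x \<in> Field r \<Longrightarrow> e x * c x = 1\<^sub>m (vdim M x - vdim A x)"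
      "\<And>x. x \<in> Field r \<Longrightarrow> i x * p x + c x * e x = 1\<^sub>m (vdim M x)"
      "\<And>x. x \<in> Field r \<Longrightarrow> vdim A x \<le> vdim M x"
    by metis
  note C = complement_biproduct[OF M i p ce(1,2) pi ce(3,4)]
  show thesis
    by (rule that[OF C(1) isomorphic_dsumI[OF C(2) M C(1)]]) (use ce(5) in auto)
qed

section \<open>Linear functionals on coordinate spaces\<close>

definition vec_subspace :: "nat \<Rightarrow> 'k::field vec set \<Rightarrow> bool" where
  "vec_subspace d A \<longleftrightarrow> A \<subseteq> carrier_vec d \<and> 0\<^sub>v d \<in> A \<and>
     (\<forall>u\<in>A. \<forall>v\<in>A. u + v \<in> A) \<and> (\<forall>c. \<forall>u\<in>A. c \<cdot>\<^sub>v u \<in> A)"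

lemma vec_subspaceD:
  assumes "vec_subspace d A"
  shows "u \<in> A \<Longrightarrow> u \<in> carrier_vec d" "0\<^sub>v d \<in> A" "u \<in> A \<Longrightarrow> v \<in> A \<Longrightarrow> u + v \<in> A"
    "u \<in> A \<Longrightarrow> c \<cdot>\<^sub>v u \<in> A"
  using assms unfolding vec_subspace_def by auto

lemma vec_diff_eq_add_smult:
  "u \<in> carrier_vec d \<Longrightarrow> v \<in> carrier_vec d \<Longrightarrow> u - v = u + (- 1) \<cdot>\<^sub>v v" for u v :: "'k::field vec"
  by auto

lemma vec_subspace_diff:
  assumes "vec_subspace d A" "u \<in> A" "v \<in> A"
  shows "u - v \<in> A"
  using vec_diff_eq_add_smult[of u d v] vec_subspaceD[OF assms(1)] assms(2,3) by auto

text \<open>Induction on the number k of coordinates in use: if some a \<in> A has a nonzero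
  coordinate k, subtracting multiples of a removes this coordinate from all vectors.\<close>

lemma separating_functional_supported:
  assumes "vec_subspace d A" "v \<in> carrier_vec d" "v \<notin> A"
    and "k \<le> d" "\<And>u i. u \<in> insert v A \<Longrightarrow> k \<le> i \<Longrightarrow> i < d \<Longrightarrow> u $ i = 0"
  shows "\<exists>w\<in>carrier_vec d. w \<bullet> v = 1 \<and> (\<forall>u\<in>A. w \<bullet> u = 0)"
  using assms
proof (induction k arbitrary: A v)
  case 0
  then have "v = 0\<^sub>v d" by (intro eq_vecI) auto
  then show ?case using 0 vec_subspaceD(2) by blast
next
  case (Suc k)
  note A = vec_subspaceD[OF Suc.prems(1)]
  have k: "k < d" using Suc.prems(4) by simp
  consider (pivot) a where "a \<in> A" "a $ k \<noteq> 0" | (nopivot) "\<forall>a\<in>A. a $ k = 0" by blast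
  then show ?case
  proof cases
    case pivot
    define e where "e = (1 / a $ k) \<cdot>\<^sub>v a"
    have e: "e \<in> A" "e \<in> carrier_vec d" "e $ k = 1"
      using pivot A(1)[OF pivot(1)] A(4)[OF pivot(1)] k by (auto simp: e_def)
    have dim_A: "dim_vec u = d" if "u \<in> A" for u using A(1)[OF that] by auto
    define red where "red = (\<lambda>u. u - (u $ k) \<cdot>\<^sub>v e)"
    have red_car: "red u \<in> carrier_vec d" if "u \<in> carrier_vec d" for u
      using that e by (auto simp: red_def)
    have red_k: "red u $ k = 0" if "u \<in> carrier_vec d" for u
      using that e k by (auto simp: red_def)
    have red_A: "red u \<in> A" if "u \<in> A" for u
      unfolding red_def using that e A by (intro vec_subspace_diff[OF Suc.prems(1)]) auto
    have red_add: "u = red u + (u $ k) \<cdot>\<^sub>v e" if "u \<in> carrier_vec d" for u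
      using that e by (auto simp: red_def)
    let ?A = "{u \<in> A. u $ k = 0}"
    have sub: "vec_subspace d ?A"
      unfolding vec_subspace_def using A k by (auto simp: dim_A)
    have red_v: "red v \<notin> A"
    proof
      assume "red v \<in> A"
      then have "red v + (v $ k) \<cdot>\<^sub>v e \<in> A" using e A by blast
      then show False using red_add[OF Suc.prems(2)] Suc.prems(3) by simp
    qed
    have supp: "u $ i = 0" if "u \<in> insert (red v) ?A" "k \<le> i" "i < d" for u i
    proof (cases "i = k")
      case True
      then show ?thesis using that red_k Suc.prems(2) by auto
    next
      case False
      then have "Suc k \<le> i" using that by simp
      then have "v $ i = 0" "e $ i = 0" "u \<in> A \<longrightarrow> u $ i = 0"
        using Suc.prems(5)[of _ i] that e by auto
      then show ?thesis using that e Suc.prems(2) by (auto simp: red_def)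
    qed
    have "\<exists>w\<in>carrier_vec d. w \<bullet> red v = 1 \<and> (\<forall>u\<in>?A. w \<bullet> u = 0)"
      by (rule Suc.IH[OF sub red_car[OF Suc.prems(2)] _ less_imp_le[OF k] supp])
        (use red_v in auto)
    then obtain w where w: "w \<in> carrier_vec d" "w \<bullet> red v = 1" "\<And>u. u \<in> ?A \<Longrightarrow> w \<bullet> u = 0"
      by blast
    define w' where "w' = w - (w \<bullet> e) \<cdot>\<^sub>v unit_vec d k"
    have w'_car: "w' \<in> carrier_vec d" using w by (auto simp: w'_def)
    have w'_scalar: "w' \<bullet> u = w \<bullet> red u" if "u \<in> carrier_vec d" for u
      using that w(1) e k
      by (simp add: w'_def red_def minus_scalar_prod_distrib scalar_prod_minus_distrib
          scalar_prod_left_unit mult.commute)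
    show ?thesis
      using w'_car w'_scalar w Suc.prems(2) red_A red_k A(1) by (intro bexI[of _ w']) auto
  next
    case nopivot
    show ?thesis
    proof (cases "v $ k = 0")
      case True
      have "u $ i = 0" if "u \<in> insert v A" "k \<le> i" "i < d" for u i
        using that nopivot True Suc.prems(5)[of u i] by (cases "i = k") auto
      then show ?thesis using Suc.IH[OF Suc.prems(1-3)] k by simp
    next
      case False
      define w where "w = (1 / v $ k) \<cdot>\<^sub>v unit_vec d k"
      have "w \<in> carrier_vec d" by (auto simp: w_def)
      moreover have "w \<bullet> u = u $ k / v $ k" if "u \<in> carrier_vec d" for u
        using that k by (simp add: w_def scalar_prod_left_unit)
      ultimately show ?thesis
        using False nopivot Suc.prems(2) A(1) by (intro bexI[of _ w]) auto
    qed
  qed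
qed

lemma separating_functional:
  assumes "vec_subspace d A" "v \<in> carrier_vec d" "v \<notin> A"
  obtains w where "w \<in> carrier_vec d" "w \<bullet> v = 1" "\<And>u. u \<in> A \<Longrightarrow> w \<bullet> u = 0"
  using separating_functional_supported[OF assms order_refl] by auto

lemma vec_subspace_image_plus:
  assumes f: "f \<in> carrier_mat m d" and "vec_subspace d K" "vec_subspace m A"
  shows "vec_subspace m {f *\<^sub>v u + w | u w. u \<in> K \<and> w \<in> A}"
proof -
  note K = vec_subspaceD[OF assms(2)] and A = vec_subspaceD[OF assms(3)]
  show ?thesis
    unfolding vec_subspace_def
  proof (intro conjI ballI allI)
    show "{f *\<^sub>v u + w | u w. u \<in> K \<and> w \<in> A} \<subseteq> carrier_vec m"
      using f K(1) A(1) by auto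
    have "0\<^sub>v m = f *\<^sub>v 0\<^sub>v d + 0\<^sub>v m" using f by auto
    then show "0\<^sub>v m \<in> {f *\<^sub>v u + w | u w. u \<in> K \<and> w \<in> A}" using K(2) A(2) by blast
  next
    fix x y
    assume "x \<in> {f *\<^sub>v u + w | u w. u \<in> K \<and> w \<in> A}" "y \<in> {f *\<^sub>v u + w | u w. u \<in> K \<and> w \<in> A}"
    then obtain u w u' w' where x: "x = f *\<^sub>v u + w" "u \<in> K" "w \<in> A" and y: "y = f *\<^sub>v u' + w'" "u' \<in> K" "w' \<in> A"
      by auto
    note c = K(1)[OF x(2)] K(1)[OF y(2)] A(1)[OF x(3)] A(1)[OF y(3)]
    have "x + y = f *\<^sub>v (u + u') + (w + w')"
      unfolding x y mult_add_distrib_mat_vec[OF f c(1,2)] using f c by (intro eq_vecI) auto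
    then show "x + y \<in> {f *\<^sub>v u + w | u w. u \<in> K \<and> w \<in> A}" using x y K(3) A(3) by blast
  next
    fix c x
    assume "x \<in> {f *\<^sub>v u + w | u w. u \<in> K \<and> w \<in> A}"
    then obtain u w where x: "x = f *\<^sub>v u + w" "u \<in> K" "w \<in> A" by auto
    have "c \<cdot>\<^sub>v x = f *\<^sub>v (c \<cdot>\<^sub>v u) + c \<cdot>\<^sub>v w"
      unfolding x mult_mat_vec[OF f K(1)[OF x(2)]]
      using f K(1)[OF x(2)] A(1)[OF x(3)] by (intro smult_add_distrib_vec) auto
    then show "c \<cdot>\<^sub>v x \<in> {f *\<^sub>v u + w | u w. u \<in> K \<and> w \<in> A}" using x K(4) A(4) by blast
  qed
qed

lemma vec_subspace_carrier: "vec_subspace d (carrier_vec d)"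
  unfolding vec_subspace_def by auto

lemma vec_subspace_zero: "vec_subspace d {0\<^sub>v d}"
  unfolding vec_subspace_def by auto

lemma vec_subspace_kernel:
  assumes "b \<in> carrier_vec d"
  shows "vec_subspace d {u \<in> carrier_vec d. b \<bullet> u = 0}"
  using assms unfolding vec_subspace_def by (auto simp: scalar_prod_add_distrib[of _ d])

lemma vec_subspace_image:
  assumes f: "f \<in> carrier_mat m d" and K: "vec_subspace d K"
  shows "vec_subspace m ((\<lambda>u. f *\<^sub>v u) ` K)"
proof -
  have "f *\<^sub>v u + 0\<^sub>v m = f *\<^sub>v u" for u using f by auto
  then have "{f *\<^sub>v u + w | u w. u \<in> K \<and> w \<in> {0\<^sub>v m}} = (\<lambda>u. f *\<^sub>v u) ` K"
    by auto
  then show ?thesis using vec_subspace_image_plus[OF f K vec_subspace_zero] by simp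
qed

lemma vec_subspace_preimage:
  assumes f: "f \<in> carrier_mat m d" and A: "vec_subspace m A"
  shows "vec_subspace d {u \<in> carrier_vec d. f *\<^sub>v u \<in> A}"
proof -
  have "f *\<^sub>v 0\<^sub>v d = 0\<^sub>v m" using f by auto
  then show ?thesis
    using A unfolding vec_subspace_def
    by (auto simp: mult_add_distrib_mat_vec[OF f] mult_mat_vec[OF f])
qed

text \<open>If b u = 1, then f u lies outside the sum of A and the image of the kernel of b. A functional that
  kills this sum and is 1 at f u agrees with b on the kernel of b and at u, hence everywhere.\<close>

lemma functional_extension:
  fixes f :: "'k::field mat"
  assumes f: "f \<in> carrier_mat m d" and A: "vec_subspace m A" and b: "b \<in> carrier_vec d"
    and bA: "\<And>u. u \<in> carrier_vec d \<Longrightarrow> f *\<^sub>v u \<in> A \<Longrightarrow> b \<bullet> u = 0"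
  obtains c where "c \<in> carrier_vec m" "\<And>w. w \<in> A \<Longrightarrow> c \<bullet> w = 0"
    "\<And>u. u \<in> carrier_vec d \<Longrightarrow> c \<bullet> (f *\<^sub>v u) = b \<bullet> u"
proof (cases "\<forall>u\<in>carrier_vec d. b \<bullet> u = 0")
  case True
  show thesis
    by (rule that[of "0\<^sub>v m"]) (use True f vec_subspaceD(1)[OF A] in auto)
next
  case False
  then obtain u1 where u1: "u1 \<in> carrier_vec d" "b \<bullet> u1 \<noteq> 0" by blast
  define u where "u = (1 / (b \<bullet> u1)) \<cdot>\<^sub>v u1"
  have u: "u \<in> carrier_vec d" "b \<bullet> u = 1" using u1 b by (auto simp: u_def)
  let ?K = "{u \<in> carrier_vec d. b \<bullet> u = 0}"
  let ?T = "{f *\<^sub>v k + w | k w. k \<in> ?K \<and> w \<in> A}"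
  have T: "vec_subspace m ?T"
    by (rule vec_subspace_image_plus[OF f vec_subspace_kernel[OF b] A])
  have "f *\<^sub>v u \<notin> ?T"
  proof
    assume "f *\<^sub>v u \<in> ?T"
    then obtain k w where k: "f *\<^sub>v u = f *\<^sub>v k + w" "k \<in> carrier_vec d" "b \<bullet> k = 0" "w \<in> A" by auto
    have "f *\<^sub>v (u - k) = w"
      unfolding mult_minus_distrib_mat_vec[OF f u(1) k(2)] k(1)
      using f k vec_subspaceD(1)[OF A k(4)] by (intro eq_vecI) auto
    then have "b \<bullet> (u - k) = 0" using bA[of "u - k"] u k by auto
    then show False using u k b by (simp add: scalar_prod_minus_distrib)
  qed
  moreover have "f *\<^sub>v u \<in> carrier_vec m" using f u by auto
  ultimately obtain c where c: "c \<in> carrier_vec m" "c \<bullet> (f *\<^sub>v u) = 1" "\<And>w. w \<in> ?T \<Longrightarrow> c \<bullet> w = 0"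
    using separating_functional[OF T] by blast
  show thesis
  proof (rule that[OF c(1)])
    fix w assume w: "w \<in> A"
    have "w = f *\<^sub>v 0\<^sub>v d + w" using f vec_subspaceD(1)[OF A w] by auto
    then have "w \<in> ?T" using w b by force
    then show "c \<bullet> w = 0" by (rule c(3))
  next
    fix x :: "'k vec" assume x: "x \<in> carrier_vec d"
    define k where "k = x - (b \<bullet> x) \<cdot>\<^sub>v u"
    have k: "k \<in> ?K" using x u b by (auto simp: k_def scalar_prod_minus_distrib)
    then have "f *\<^sub>v k = f *\<^sub>v k + 0\<^sub>v m" using f by auto
    then have "f *\<^sub>v k \<in> ?T" using k vec_subspaceD(2)[OF A] by blast
    then have "c \<bullet> (f *\<^sub>v k) = 0" by (rule c(3))
    moreover have "f *\<^sub>v k = f *\<^sub>v x - (b \<bullet> x) \<cdot>\<^sub>v (f *\<^sub>v u)"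
      unfolding k_def using x u f by (simp add: mult_minus_distrib_mat_vec[OF f] mult_mat_vec[OF f])
    ultimately show "c \<bullet> (f *\<^sub>v x) = b \<bullet> x"
      using c f x u by (simp add: scalar_prod_minus_distrib[of _ m])
  qed
qed

section \<open>The order relation of a type A poset\<close>

lemma type_A_poset_Field: "type_A_poset n r \<Longrightarrow> Field r = {1..n}"
  unfolding type_A_poset_def partial_order_on_def preorder_on_def refl_on_def Field_def by fast

lemma type_A_poset_refl: "type_A_poset n r \<Longrightarrow> x \<in> {1..n} \<Longrightarrow> (x, x) \<in> r"
  unfolding type_A_poset_def partial_order_on_def preorder_on_def refl_on_def by fast

lemma type_A_poset_trans: "type_A_poset n r \<Longrightarrow> (x, y) \<in> r \<Longrightarrow> (y, z) \<in> r \<Longrightarrow> (x, z) \<in> r"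
  unfolding type_A_poset_def partial_order_on_def preorder_on_def by (meson transD)

lemma type_A_poset_antisym: "type_A_poset n r \<Longrightarrow> (x, y) \<in> r \<Longrightarrow> (y, x) \<in> r \<Longrightarrow> x = y"
  unfolding type_A_poset_def partial_order_on_def by (meson antisymD)

lemma type_A_poset_adjacent:
  "type_A_poset n r \<Longrightarrow> 1 \<le> i \<Longrightarrow> i < n \<Longrightarrow> (i, Suc i) \<in> r \<or> (Suc i, i) \<in> r"
  unfolding type_A_poset_def covers_def by auto

text \<open>A saturated chain from x to y moves by steps of size one, so it meets every number between
  x and y.\<close>

lemma type_A_poset_between:
  assumes r: "type_A_poset n r"
    and "(x, y) \<in> r" "min x y \<le> k" "k \<le> max x y"
  shows "(x, k) \<in> r \<and> (k, y) \<in> r"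
  using assms(2-4)
proof (induction "card {z. (x, z) \<in> r \<and> (z, y) \<in> r}" arbitrary: x y rule: less_induct)
  case less
  note F = type_A_poset_Field[OF r] and tr = type_A_poset_trans[OF r]
  have xy: "x \<in> {1..n}" "y \<in> {1..n}" using F less.prems(1) by (auto simp: Field_def)
  show ?case
  proof (cases "x = y \<or> covers r x y")
    case True
    then have "x = y \<or> y = x + 1 \<or> x = y + 1" using r unfolding type_A_poset_def by auto
    then have "k = x \<or> k = y" using less.prems(2,3) by auto
    then show ?thesis using type_A_poset_refl[OF r] xy less.prems(1) by auto
  next
    case False
    then obtain z where z: "z \<noteq> x" "z \<noteq> y" "(x, z) \<in> r" "(z, y) \<in> r"
      using less.prems(1) unfolding covers_def by blast
    have fin: "finite {w. (x, w) \<in> r \<and> (w, y) \<in> r}"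
      by (rule finite_subset[of _ "{1..n}"]) (use F in \<open>auto simp: Field_def\<close>)
    have "{w. (x, w) \<in> r \<and> (w, z) \<in> r} \<subset> {w. (x, w) \<in> r \<and> (w, y) \<in> r}"
      using z tr type_A_poset_antisym[OF r] less.prems(1) type_A_poset_refl[OF r xy(2)] by blast
    note 1 = psubset_card_mono[OF fin this]
    have "{w. (z, w) \<in> r \<and> (w, y) \<in> r} \<subset> {w. (x, w) \<in> r \<and> (w, y) \<in> r}"
      using z tr type_A_poset_antisym[OF r] less.prems(1) type_A_poset_refl[OF r xy(1)] by blast
    note 2 = psubset_card_mono[OF fin this]
    consider (left) "min x z \<le> k" "k \<le> max x z" | (right) "min z y \<le> k" "k \<le> max z y"
      using less.prems(2,3) by linarith
    then show ?thesis
    proof cases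
      case left
      then show ?thesis using less.hyps[OF 1 z(3)] z tr by blast
    next
      case right
      then show ?thesis using less.hyps[OF 2 z(4)] z tr by blast
    qed
  qed
qed

text \<open>The composition law needs that I is convex in the order. If x and z lie in I, and y outside I
  lies above x and below z, then on the line x lies between y and z, or z lies between x and y; by
  type_A_poset_between this contradicts antisymmetry.\<close>

lemma module_interval:
  assumes r: "type_A_poset n r" and I: "I \<in> closed_intervals n"
  shows "is_module r (interval_module I :: (nat, 'k::field) pmod)"
  unfolding is_module_def
proof (intro conjI allI impI ballI)
  fix x y z assume xy: "(x, y) \<in> r" and yz: "(y, z) \<in> r"
  have "y \<in> I" if "x \<in> I" "z \<in> I"
  proof (rule ccontr)
    assume y: "y \<notin> I"
    obtain i j where ij: "I = {i..j}" using I unfolding closed_intervals_def by auto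
    have "x \<noteq> y" "z \<noteq> y" using that y by auto
    have "min y z \<le> x \<and> x \<le> max y z \<or> min x y \<le> z \<and> z \<le> max x y"
      using that y unfolding ij by auto
    then consider "min y z \<le> x" "x \<le> max y z" | "min x y \<le> z" "z \<le> max x y"
      by blast
    then show False
    proof cases
      case 1
      then show ?thesis
        using type_A_poset_between[OF r yz 1] xy type_A_poset_antisym[OF r] \<open>x \<noteq> y\<close> by blast
    next
      case 2
      then show ?thesis
        using type_A_poset_between[OF r xy 2] yz type_A_poset_antisym[OF r] \<open>z \<noteq> y\<close> by blast
    qed
  qed
  then show "vmap (interval_module I) y z * vmap (interval_module I) x y
      = (vmap (interval_module I) x z :: 'k mat)"
    by (auto simp: interval_module_def Let_def mat_algebra intro!: mat_empty_eq)
qed (auto simp: interval_module_def Let_def)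

section \<open>Interval summands\<close>

text \<open>On the points up to x, the vectors a form a morphism from the interval module of {i..x} to
  M, and the functionals b form a retraction of it. Below i both families vanish, so that the
  boundary conditions of these morphisms are instances of the compatibility conditions.\<close>

definition left_summand ::
  "nat rel \<Rightarrow> (nat, 'k::field) pmod \<Rightarrow> nat \<Rightarrow> nat \<Rightarrow> (nat \<Rightarrow> 'k vec) \<Rightarrow> (nat \<Rightarrow> 'k vec) \<Rightarrow> bool" where
  "left_summand r M x i a b \<longleftrightarrow> 1 \<le> i \<and> i \<le> x \<and>
     (\<forall>y. a y \<in> carrier_vec (vdim M y) \<and> b y \<in> carrier_vec (vdim M y)) \<and>
     (\<forall>y<i. a y = 0\<^sub>v (vdim M y) \<and> b y = 0\<^sub>v (vdim M y)) \<and>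
     (\<forall>y\<in>{i..x}. b y \<bullet> a y = 1) \<and>
     (\<forall>y z. (y, z) \<in> r \<longrightarrow> y \<le> x \<longrightarrow> z \<le> x \<longrightarrow>
        (i \<le> y \<longrightarrow> vmap M y z *\<^sub>v a y = a z) \<and>
        (i \<le> z \<longrightarrow> (\<forall>u\<in>carrier_vec (vdim M y). b z \<bullet> (vmap M y z *\<^sub>v u) = b y \<bullet> u)))"

lemma module_vec_comp:
  assumes "is_module r M" "(x, y) \<in> r" "(y, z) \<in> r" "u \<in> carrier_vec (vdim M x)"
  shows "vmap M x z *\<^sub>v u = vmap M y z *\<^sub>v (vmap M x y *\<^sub>v u)"
    "vmap M x y *\<^sub>v u \<in> carrier_vec (vdim M y)"
proof -
  have c: "vmap M x y \<in> carrier_mat (vdim M y) (vdim M x)" "vmap M y z \<in> carrier_mat (vdim M z) (vdim M y)"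
    "vmap M x z = vmap M y z * vmap M x y"
    using assms(1-3) unfolding is_module_def by auto
  show "vmap M x z *\<^sub>v u = vmap M y z *\<^sub>v (vmap M x y *\<^sub>v u)"
    unfolding c(3) by (rule assoc_mult_mat_vec[OF c(2,1) assms(4)])
  show "vmap M x y *\<^sub>v u \<in> carrier_vec (vdim M y)" using c(1) assms(4) by auto
qed

lemma module_id_vec:
  assumes "is_module r M" "x \<in> Field r" "u \<in> carrier_vec (vdim M x)"
  shows "vmap M x x *\<^sub>v u = u"
  using assms unfolding is_module_def by auto

lemma left_summand_start:
  assumes r: "type_A_poset n r" and M: "is_module r M" and x: "1 \<le> x" "x \<le> n"
    and v: "v \<in> carrier_vec (vdim M x)" and b: "b \<in> carrier_vec (vdim M x)" and bv: "b \<bullet> v = 1"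
    and out: "\<And>z. (x, z) \<in> r \<Longrightarrow> Suc z = x \<Longrightarrow> vmap M x z *\<^sub>v v = 0\<^sub>v (vdim M z)"
    and into: "\<And>y u. (y, x) \<in> r \<Longrightarrow> Suc y = x \<Longrightarrow> u \<in> carrier_vec (vdim M y) \<Longrightarrow> b \<bullet> (vmap M y x *\<^sub>v u) = 0"
  shows "left_summand r M x x (\<lambda>y. if y = x then v else 0\<^sub>v (vdim M y))
    (\<lambda>y. if y = x then b else 0\<^sub>v (vdim M y))"
proof -
  have xF: "x \<in> Field r" using x type_A_poset_Field[OF r] by auto
  have out': "vmap M x z *\<^sub>v v = 0\<^sub>v (vdim M z)" if xz: "(x, z) \<in> r" and lt: "z < x" for z
  proof -
    have e: "(x, x - 1) \<in> r" "(x - 1, z) \<in> r"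
      using type_A_poset_between[OF r xz, of "x - 1"] lt by auto
    have "vmap M x z *\<^sub>v v = vmap M (x - 1) z *\<^sub>v 0\<^sub>v (vdim M (x - 1))"
      using module_vec_comp(1)[OF M e v] out[OF e(1)] lt by auto
    also have "\<dots> = 0\<^sub>v (vdim M z)"
      using module_dim[OF M e(2)] by (intro eq_vecI) (auto simp: scalar_prod_def)
    finally show ?thesis .
  qed
  have into': "b \<bullet> (vmap M y x *\<^sub>v u) = 0"
    if yx: "(y, x) \<in> r" and lt: "y < x" and u: "u \<in> carrier_vec (vdim M y)" for y u
  proof -
    have e: "(y, x - 1) \<in> r" "(x - 1, x) \<in> r"
      using type_A_poset_between[OF r yx, of "x - 1"] lt by auto
    show ?thesis
      using module_vec_comp[OF M e u] into[OF e(2)] lt by auto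
  qed
  show ?thesis
    unfolding left_summand_def
    using x v b bv out' into' module_id_vec[OF M xF] by auto
qed

lemma left_summand_extend:
  assumes r: "type_A_poset n r" and M: "is_module r M" and w: "Suc w \<le> n"
    and S: "left_summand r M w i a b"
    and v: "v \<in> carrier_vec (vdim M (Suc w))" and c: "c \<in> carrier_vec (vdim M (Suc w))"
    and link: "(w, Suc w) \<in> r \<and> vmap M w (Suc w) *\<^sub>v a w = v \<and>
        (\<forall>u\<in>carrier_vec (vdim M w). c \<bullet> (vmap M w (Suc w) *\<^sub>v u) = b w \<bullet> u) \<and> c \<bullet> v = 1 \<or>
      (Suc w, w) \<in> r \<and> vmap M (Suc w) w *\<^sub>v v = a w \<and>
        (\<forall>u\<in>carrier_vec (vdim M (Suc w)). b w \<bullet> (vmap M (Suc w) w *\<^sub>v u) = c \<bullet> u) \<and> c \<bullet> v = 1"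
  shows "left_summand r M (Suc w) i (a(Suc w := v)) (b(Suc w := c))"
proof -
  have F: "Suc w \<in> Field r" using w type_A_poset_Field[OF r] by auto
  have S': "1 \<le> i" "i \<le> w" "\<And>y. a y \<in> carrier_vec (vdim M y)" "\<And>y. b y \<in> carrier_vec (vdim M y)"
    "\<And>y. y < i \<Longrightarrow> a y = 0\<^sub>v (vdim M y)" "\<And>y. y < i \<Longrightarrow> b y = 0\<^sub>v (vdim M y)"
    "\<And>y. i \<le> y \<Longrightarrow> y \<le> w \<Longrightarrow> b y \<bullet> a y = 1"
    "\<And>y z. (y, z) \<in> r \<Longrightarrow> y \<le> w \<Longrightarrow> z \<le> w \<Longrightarrow> i \<le> y \<Longrightarrow> vmap M y z *\<^sub>v a y = a z"
    "\<And>y z u. (y, z) \<in> r \<Longrightarrow> y \<le> w \<Longrightarrow> z \<le> w \<Longrightarrow> i \<le> z \<Longrightarrow> u \<in> carrier_vec (vdim M y) \<Longrightarrow>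
      b z \<bullet> (vmap M y z *\<^sub>v u) = b y \<bullet> u"
    using S unfolding left_summand_def by auto
  have into: "(i \<le> y \<longrightarrow> vmap M y (Suc w) *\<^sub>v a y = v) \<and>
      (\<forall>u\<in>carrier_vec (vdim M y). c \<bullet> (vmap M y (Suc w) *\<^sub>v u) = b y \<bullet> u)"
    if yx: "(y, Suc w) \<in> r" and lt: "y \<le> w" for y
  proof -
    have e: "(y, w) \<in> r" "(w, Suc w) \<in> r"
      using type_A_poset_between[OF r yx, of w] lt by auto
    then have "(Suc w, w) \<notin> r" using type_A_poset_antisym[OF r] by fastforce
    then have l: "vmap M w (Suc w) *\<^sub>v a w = v"
        "\<And>u. u \<in> carrier_vec (vdim M w) \<Longrightarrow> c \<bullet> (vmap M w (Suc w) *\<^sub>v u) = b w \<bullet> u"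
      using link by auto
    show ?thesis
      using module_vec_comp[OF M e] l S'(8)[OF e(1) lt order_refl] S'(9)[OF e(1) lt order_refl S'(2)] S'(3)
      by auto
  qed
  have out: "vmap M (Suc w) z *\<^sub>v v = a z \<and>
      (i \<le> z \<longrightarrow> (\<forall>u\<in>carrier_vec (vdim M (Suc w)). b z \<bullet> (vmap M (Suc w) z *\<^sub>v u) = c \<bullet> u))"
    if xz: "(Suc w, z) \<in> r" and lt: "z \<le> w" for z
  proof -
    have e: "(Suc w, w) \<in> r" "(w, z) \<in> r"
      using type_A_poset_between[OF r xz, of w] lt by auto
    then have "(w, Suc w) \<notin> r" using type_A_poset_antisym[OF r] by fastforce
    then have l: "vmap M (Suc w) w *\<^sub>v v = a w"
        "\<And>u. u \<in> carrier_vec (vdim M (Suc w)) \<Longrightarrow> b w \<bullet> (vmap M (Suc w) w *\<^sub>v u) = c \<bullet> u"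
      using link by auto
    show ?thesis
      using module_vec_comp[OF M e] l v S'(8)[OF e(2) order_refl lt S'(2)] S'(9)[OF e(2) order_refl lt]
      by auto
  qed
  have "c \<bullet> v = 1" using link by auto
  then show ?thesis
    unfolding left_summand_def
    using S' v c into out module_id_vec[OF M F] by (auto simp: le_Suc_eq)
qed

text \<open>The pair of subspaces A \<subset> B is there to let the induction along the line pass through arrows of
  both directions. If the arrow next to x points towards x, either some
  v \<in> B lies outside the sum of A and the image of the arrow, and the interval starts at x, or the
  preimages of A and B are still distinct; if it points away from x, either some v \<in> B outside A is
  killed by the arrow, and the interval starts at x, or the images of A and B are still distinct.\<close>

lemma left_summand_exists:
  fixes M :: "(nat, 'k::field) pmod" and A B :: "'k vec set"
  assumes r: "type_A_poset n r" and M: "is_module r M" and "1 \<le> x" "x \<le> n"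
    and "vec_subspace (vdim M x) A" "vec_subspace (vdim M x) B" "A \<subseteq> B" "v \<in> B" "v \<notin> A"
  shows "\<exists>i a b. left_summand r M x i a b \<and> a x \<in> B \<and> (\<forall>u\<in>A. b x \<bullet> u = 0)"
  using assms(3-)
proof (induction x arbitrary: A B v)
  case 0
  then show ?case by simp
next
  case (Suc w)
  note A = vec_subspaceD[OF Suc.prems(3)] and B = vec_subspaceD[OF Suc.prems(4)]
  have start: ?case
    if v: "v \<in> B" and b: "b \<in> carrier_vec (vdim M (Suc w))" "b \<bullet> v = 1" "\<And>u. u \<in> A \<Longrightarrow> b \<bullet> u = 0"
      and out: "(Suc w, w) \<in> r \<Longrightarrow> 1 \<le> w \<Longrightarrow> vmap M (Suc w) w *\<^sub>v v = 0\<^sub>v (vdim M w)"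
      and into: "\<And>u. (w, Suc w) \<in> r \<Longrightarrow> 1 \<le> w \<Longrightarrow> u \<in> carrier_vec (vdim M w) \<Longrightarrow> b \<bullet> (vmap M w (Suc w) *\<^sub>v u) = 0"
    for v b
  proof -
    have pos: "(Suc w, w) \<in> r \<or> (w, Suc w) \<in> r \<Longrightarrow> 1 \<le> w"
      using type_A_poset_Field[OF r] by (auto simp: Field_def)
    define a' where "a' = (\<lambda>y. if y = Suc w then v else 0\<^sub>v (vdim M y))"
    define b' where "b' = (\<lambda>y. if y = Suc w then b else 0\<^sub>v (vdim M y))"
    have "left_summand r M (Suc w) (Suc w) a' b'"
      unfolding a'_def b'_def
      using left_summand_start[OF r M Suc.prems(1,2) B(1)[OF v] b(1,2)] out into pos by auto
    moreover have "a' (Suc w) \<in> B" "\<forall>u\<in>A. b' (Suc w) \<bullet> u = 0"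
      using v b(3) by (auto simp: a'_def b'_def)
    ultimately show ?thesis by blast
  qed
  show ?case
  proof (cases "w = 0")
    case True
    obtain b where "b \<in> carrier_vec (vdim M (Suc w))" "b \<bullet> v = 1" "\<And>u. u \<in> A \<Longrightarrow> b \<bullet> u = 0"
      using separating_functional[OF Suc.prems(3) B(1)[OF Suc.prems(6)] Suc.prems(7)] by blast
    then show ?thesis using start[OF Suc.prems(6)] True by auto
  next
    case False
    then have w: "1 \<le> w" "w \<le> n" "w < n" using Suc.prems(2) by auto
    show ?thesis
    proof (cases "(w, Suc w) \<in> r")
      case True
      then have no: "(Suc w, w) \<notin> r" using type_A_poset_antisym[OF r] by fastforce
      let ?f = "vmap M w (Suc w)"
      have f: "?f \<in> carrier_mat (vdim M (Suc w)) (vdim M w)" using M True unfolding is_module_def by auto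
      let ?T = "{?f *\<^sub>v u + a | u a. u \<in> carrier_vec (vdim M w) \<and> a \<in> A}"
      have T: "vec_subspace (vdim M (Suc w)) ?T"
        by (rule vec_subspace_image_plus[OF f vec_subspace_carrier Suc.prems(3)])
      show ?thesis
      proof (cases "B \<subseteq> ?T")
        case False
        then obtain v where v: "v \<in> B" "v \<notin> ?T" by blast
        obtain b where b: "b \<in> carrier_vec (vdim M (Suc w))" "b \<bullet> v = 1" "\<And>u. u \<in> ?T \<Longrightarrow> b \<bullet> u = 0"
          using separating_functional[OF T B(1)[OF v(1)] v(2)] by blast
        show ?thesis
        proof (rule start[OF v(1) b(1,2)])
          fix u :: "'k vec" assume u: "u \<in> A"
          have "u = ?f *\<^sub>v 0\<^sub>v (vdim M w) + u" using f A(1)[OF u] by auto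
          then have "u \<in> ?T" using u by force
          then show "b \<bullet> u = 0" by (rule b(3))
        next
          fix u :: "'k vec" assume u: "u \<in> carrier_vec (vdim M w)"
          have "?f *\<^sub>v u = ?f *\<^sub>v u + 0\<^sub>v (vdim M (Suc w))" using f u by auto
          then have "?f *\<^sub>v u \<in> ?T" using u A(2) by blast
          then show "b \<bullet> (?f *\<^sub>v u) = 0" by (rule b(3))
        qed (use no in auto)
      next
        case BT: True
        let ?A = "{u \<in> carrier_vec (vdim M w). ?f *\<^sub>v u \<in> A}"
        let ?B = "{u \<in> carrier_vec (vdim M w). ?f *\<^sub>v u \<in> B}"
        obtain u a where u: "v = ?f *\<^sub>v u + a" "u \<in> carrier_vec (vdim M w)" "a \<in> A"
          using BT Suc.prems(6) by blast
        have fu: "?f *\<^sub>v u = v - a" using u f A(1)[OF u(3)] by (intro eq_vecI) auto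
        have "v - a \<in> B"
          using u(3) vec_subspace_diff[OF Suc.prems(4,6)] Suc.prems(5) by blast
        then have "u \<in> ?B" using u(2) by (simp add: fu)
        moreover have "u \<notin> ?A" using u A(3) Suc.prems(7) by auto
        ultimately have "\<exists>i a b. left_summand r M w i a b \<and> a w \<in> ?B \<and> (\<forall>u\<in>?A. b w \<bullet> u = 0)"
          using Suc.prems(5) by (intro Suc.IH[OF w(1,2) vec_subspace_preimage[OF f Suc.prems(3)]
              vec_subspace_preimage[OF f Suc.prems(4)]]) auto
        then obtain i a b where S: "left_summand r M w i a b" "a w \<in> ?B" "\<And>u. u \<in> ?A \<Longrightarrow> b w \<bullet> u = 0"
          by blast
        have S': "a w \<in> carrier_vec (vdim M w)" "b w \<in> carrier_vec (vdim M w)" "b w \<bullet> a w = 1"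
          using S(1) unfolding left_summand_def by auto
        obtain c where c: "c \<in> carrier_vec (vdim M (Suc w))" "\<And>u. u \<in> A \<Longrightarrow> c \<bullet> u = 0"
          "\<And>u. u \<in> carrier_vec (vdim M w) \<Longrightarrow> c \<bullet> (?f *\<^sub>v u) = b w \<bullet> u"
          using functional_extension[OF f Suc.prems(3) S'(2)] S(3) by blast
        define a' where "a' = a(Suc w := ?f *\<^sub>v a w)"
        define b' where "b' = b(Suc w := c)"
        have "left_summand r M (Suc w) i a' b'"
          unfolding a'_def b'_def
          by (rule left_summand_extend[OF r M Suc.prems(2) S(1)])
            (use True c S' f in auto)
        moreover have "a' (Suc w) \<in> B" "\<forall>u\<in>A. b' (Suc w) \<bullet> u = 0"
          using S(2) c(2) by (auto simp: a'_def b'_def)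
        ultimately show ?thesis by blast
      qed
    next
      case no: False
      then have e: "(Suc w, w) \<in> r" using type_A_poset_adjacent[OF r w(1,3)] by auto
      let ?f = "vmap M (Suc w) w"
      have f: "?f \<in> carrier_mat (vdim M w) (vdim M (Suc w))" using M e unfolding is_module_def by auto
      show ?thesis
      proof (cases "\<exists>v\<in>B. ?f *\<^sub>v v = 0\<^sub>v (vdim M w) \<and> v \<notin> A")
        case True
        then obtain v where v: "v \<in> B" "?f *\<^sub>v v = 0\<^sub>v (vdim M w)" "v \<notin> A" by blast
        obtain b where b: "b \<in> carrier_vec (vdim M (Suc w))" "b \<bullet> v = 1" "\<And>u. u \<in> A \<Longrightarrow> b \<bullet> u = 0"
          using separating_functional[OF Suc.prems(3) B(1)[OF v(1)] v(3)] by blast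
        show ?thesis by (rule start[OF v(1) b]) (use v no in auto)
      next
        case False
        let ?A = "(\<lambda>u. ?f *\<^sub>v u) ` A" let ?B = "(\<lambda>u. ?f *\<^sub>v u) ` B"
        have "?f *\<^sub>v v \<notin> ?A"
        proof
          assume "?f *\<^sub>v v \<in> ?A"
          then obtain a where a: "a \<in> A" "?f *\<^sub>v v = ?f *\<^sub>v a" by blast
          have va: "v - a \<in> B" using vec_subspace_diff[OF Suc.prems(4,6)] a(1) Suc.prems(5) by auto
          moreover have "?f *\<^sub>v (v - a) = 0\<^sub>v (vdim M w)"
            unfolding mult_minus_distrib_mat_vec[OF f B(1)[OF Suc.prems(6)] A(1)[OF a(1)]] a(2)
            using f A(1)[OF a(1)] by (intro eq_vecI) auto
          ultimately have "v - a \<in> A" using False by blast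
          then have "(v - a) + a \<in> A" using a(1) A(3) by blast
          moreover have "(v - a) + a = v" using A(1)[OF a(1)] B(1)[OF Suc.prems(6)] by auto
          ultimately show False using Suc.prems(7) by simp
        qed
        then have "\<exists>i a b. left_summand r M w i a b \<and> a w \<in> ?B \<and> (\<forall>u\<in>?A. b w \<bullet> u = 0)"
          using Suc.prems(5,6) by (intro Suc.IH[OF w(1,2) vec_subspace_image[OF f Suc.prems(3)]
              vec_subspace_image[OF f Suc.prems(4)]]) auto
        then obtain i a b where S: "left_summand r M w i a b" "a w \<in> ?B" "\<And>u. u \<in> A \<Longrightarrow> b w \<bullet> (?f *\<^sub>v u) = 0"
          by blast
        have S': "b w \<in> carrier_vec (vdim M w)" "b w \<bullet> a w = 1"
          using S(1) unfolding left_summand_def by auto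
        obtain v' where v': "v' \<in> B" "?f *\<^sub>v v' = a w" using S(2) by (metis imageE)
        define c where "c = transpose_mat ?f *\<^sub>v b w"
        have c: "c \<in> carrier_vec (vdim M (Suc w))"
          "\<And>u. u \<in> carrier_vec (vdim M (Suc w)) \<Longrightarrow> c \<bullet> u = b w \<bullet> (?f *\<^sub>v u)"
          using f S' transpose_vec_mult_scalar[OF f] unfolding c_def by auto
        define a' where "a' = a(Suc w := v')"
        define b' where "b' = b(Suc w := c)"
        have "left_summand r M (Suc w) i a' b'"
          unfolding a'_def b'_def
          by (rule left_summand_extend[OF r M Suc.prems(2) S(1) B(1)[OF v'(1)] c(1)])
            (use e c v' S' B(1)[OF v'(1)] in auto)
        moreover have "a' (Suc w) \<in> B" "\<forall>u\<in>A. b' (Suc w) \<bullet> u = 0"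
          using v'(1) S(3) c(2) A(1) by (auto simp: a'_def b'_def)
        ultimately show ?thesis by blast
      qed
    qed
  qed
qed

lemma interval_module_sel [simp]:
  "vdim (interval_module I) x = (if x \<in> I then 1 else 0)"
  "vmap (interval_module I) x y = (if x \<in> I \<and> y \<in> I then 1\<^sub>m 1
     else 0\<^sub>m (if y \<in> I then 1 else 0) (if x \<in> I then 1 else 0))"
  by (simp_all add: interval_module_def Let_def)

text \<open>Starting from the last point x in the support of M, with A = 0 and B the whole space, there
  is no condition at the right end of the interval.\<close>

lemma interval_summand_exists:
  fixes M :: "(nat, 'k::field) pmod"
  assumes r: "type_A_poset n r" and M: "is_module r M" and nz: "\<not> is_zero r M"
  obtains I i p where "I \<in> closed_intervals n" "is_hom r (interval_module I) M i" "is_hom r M (interval_module I) p"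
    "\<And>x. x \<in> Field r \<Longrightarrow> p x * i x = 1\<^sub>m (vdim (interval_module I :: (nat, 'k) pmod) x)"
proof -
  note F = type_A_poset_Field[OF r]
  define x where "x = Max {x \<in> {1..n}. vdim M x \<noteq> 0}"
  have "{x \<in> {1..n}. vdim M x \<noteq> 0} \<noteq> {}" using nz unfolding is_zero_def F by auto
  then have "x \<in> {x \<in> {1..n}. vdim M x \<noteq> 0}" unfolding x_def by (intro Max_in) auto
  then have x: "1 \<le> x" "x \<le> n" "vdim M x \<noteq> 0" by auto
  have last: "vdim M y = 0" if "x < y" "y \<in> Field r" for y
  proof (rule ccontr)
    assume "vdim M y \<noteq> 0"
    then have "y \<le> x" unfolding x_def using that F by (intro Max_ge) auto
    then show False using that by simp
  qed
  have "(unit_vec (vdim M x) 0 :: 'k vec) $ 0 \<noteq> 0\<^sub>v (vdim M x) $ 0" using x by simp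
  then have "unit_vec (vdim M x) 0 \<notin> {0\<^sub>v (vdim M x) :: 'k vec}" by auto
  then obtain i a b where S: "left_summand r M x i a b"
    using left_summand_exists[OF r M x(1,2) vec_subspace_zero vec_subspace_carrier,
        of "unit_vec (vdim M x) 0"] by auto
  have S': "1 \<le> i" "i \<le> x" "\<And>y. a y \<in> carrier_vec (vdim M y)" "\<And>y. b y \<in> carrier_vec (vdim M y)"
    "\<And>y. y < i \<Longrightarrow> a y = 0\<^sub>v (vdim M y)" "\<And>y. y < i \<Longrightarrow> b y = 0\<^sub>v (vdim M y)"
    "\<And>y. i \<le> y \<Longrightarrow> y \<le> x \<Longrightarrow> b y \<bullet> a y = 1"
    "\<And>y z. (y, z) \<in> r \<Longrightarrow> y \<le> x \<Longrightarrow> z \<le> x \<Longrightarrow> i \<le> y \<Longrightarrow> vmap M y z *\<^sub>v a y = a z"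
    "\<And>y z u. (y, z) \<in> r \<Longrightarrow> y \<le> x \<Longrightarrow> z \<le> x \<Longrightarrow> i \<le> z \<Longrightarrow> u \<in> carrier_vec (vdim M y) \<Longrightarrow>
      b z \<bullet> (vmap M y z *\<^sub>v u) = b y \<bullet> u"
    using S unfolding left_summand_def by auto
  let ?I = "{i..x}"
  let ?N = "interval_module ?I :: (nat, 'k) pmod"
  define f where "f = (\<lambda>y. mat (vdim M y) (vdim ?N y) (\<lambda>(s, _). a y $ s))"
  define g where "g = (\<lambda>y. mat (vdim ?N y) (vdim M y) (\<lambda>(_, s). b y $ s))"
  have I: "?I \<in> closed_intervals n"
    unfolding closed_intervals_def using S'(1,2) x by auto
  show thesis
  proof (rule that[OF I])
    show "is_hom r ?N M f"
    proof (rule homI)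
      fix y z assume yz: "(y, z) \<in> r" and Fyz: "y \<in> Field r" "z \<in> Field r"
      note d = module_dim[OF M yz]
      show "f z * vmap ?N y z = vmap M y z * f y"
      proof (cases "y \<in> ?I \<and> z \<le> x")
        case False
        then show ?thesis using last[OF _ Fyz(2)] d
          by (intro mat_empty_eq) (auto simp: f_def)
      next
        case True
        then have "vmap M y z *\<^sub>v a y = a z" using S'(8)[OF yz] by auto
        then have e: "row (vmap M y z) s \<bullet> a y = a z $ s" if "s < vdim M z" for s
          using that d by (metis index_mult_mat_vec)
        have "vmap M y z * f y = mat (vdim M z) 1 (\<lambda>(s, _). a z $ s)"
        proof (rule eq_matI)
          fix s t assume "s < dim_row (mat (vdim M z) 1 (\<lambda>(s, _). a z $ s))"
            "t < dim_col (mat (vdim M z) 1 (\<lambda>(s, _). a z $ s))"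
          then have st: "s < vdim M z" "t = 0" by auto
          have "col (f y) 0 = a y" using True S'(3)[of y] by (intro eq_vecI) (auto simp: f_def)
          then show "(vmap M y z * f y) $$ (s, t) = mat (vdim M z) 1 (\<lambda>(s, _). a z $ s) $$ (s, t)"
            using st d True e by (simp add: f_def)
        qed (use d True in \<open>auto simp: f_def\<close>)
        moreover have "f z * vmap ?N y z = mat (vdim M z) 1 (\<lambda>(s, _). a z $ s)"
        proof (cases "z \<in> ?I")
          case z: True
          then show ?thesis using True by (auto simp: f_def)
        next
          case z: False
          then have "a z = 0\<^sub>v (vdim M z)" using True S'(5) by auto
          then show ?thesis using z True by (auto simp: f_def mat_algebra intro!: eq_matI)
        qed
        ultimately show ?thesis by simp
      qed
    qed (auto simp: f_def)
    show "is_hom r M ?N g"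
    proof (rule homI)
      fix y z assume yz: "(y, z) \<in> r" and Fyz: "y \<in> Field r" "z \<in> Field r"
      note d = module_dim[OF M yz]
      show "g z * vmap M y z = vmap ?N y z * g y"
      proof (cases "z \<in> ?I \<and> y \<le> x")
        case False
        then show ?thesis using last[OF _ Fyz(1)] d
          by (intro mat_empty_eq) (auto simp: g_def)
      next
        case True
        have "g z * vmap M y z = mat 1 (vdim M y) (\<lambda>(_, s). b y $ s)"
        proof (rule eq_matI)
          fix t s assume "t < dim_row (mat 1 (vdim M y) (\<lambda>(_, s). b y $ s))"
            "s < dim_col (mat 1 (vdim M y) (\<lambda>(_, s). b y $ s))"
          then have st: "s < vdim M y" "t = 0" by auto
          have "row (g z) 0 = b z" using True S'(4)[of z] by (intro eq_vecI) (auto simp: g_def)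
          moreover have "col (vmap M y z) s = vmap M y z *\<^sub>v unit_vec (vdim M y) s"
            using st d by (intro eq_vecI) auto
          moreover have "b z \<bullet> (vmap M y z *\<^sub>v unit_vec (vdim M y) s) = b y $ s"
            using S'(9)[OF yz, of "unit_vec (vdim M y) s"] True S'(4)[of y] st by auto
          ultimately show "(g z * vmap M y z) $$ (t, s) = mat 1 (vdim M y) (\<lambda>(_, s). b y $ s) $$ (t, s)"
            using st d True by (simp add: g_def)
        qed (use d True in \<open>auto simp: g_def\<close>)
        moreover have "vmap ?N y z * g y = mat 1 (vdim M y) (\<lambda>(_, s). b y $ s)"
        proof (cases "y \<in> ?I")
          case y: True
          then show ?thesis using True by (auto simp: g_def)
        next
          case y: False
          then have "b y = 0\<^sub>v (vdim M y)" using True S'(6) by auto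
          then show ?thesis using y True by (auto simp: g_def mat_algebra intro!: eq_matI)
        qed
        ultimately show ?thesis by simp
      qed
    qed (auto simp: g_def)
    fix y assume "y \<in> Field r"
    show "g y * f y = 1\<^sub>m (vdim ?N y)"
    proof (cases "y \<in> ?I")
      case True
      then have "row (g y) 0 = b y" "col (f y) 0 = a y"
        using S'(3,4)[of y] by (auto intro!: eq_vecI simp: f_def g_def)
      then show ?thesis using True S'(7)[of y] by (intro eq_matI) (auto simp: f_def g_def)
    qed (auto simp: f_def g_def intro!: mat_empty_eq)
  qed
qed

abbreviation interval_sum :: "nat set list \<Rightarrow> (nat, 'k::field) pmod" where
  "interval_sum Is \<equiv> foldr dsum (map interval_module Is) zero_module"

lemma module_interval_sum:
  "type_A_poset n r \<Longrightarrow> set Is \<subseteq> closed_intervals n \<Longrightarrow> is_module r (interval_sum Is)"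
  by (rule module_foldr_dsum) (auto intro: module_interval)

lemma is_zero_isomorphic_zero_module:
  assumes M: "is_module r M" and Z: "is_zero r M"
  shows "isomorphic r M zero_module"
proof -
  have *: "vdim M x = 0" if "x \<in> Field r" for x using Z that unfolding is_zero_def by auto
  show ?thesis
    by (rule isomorphicI[OF hom_zero[OF M module_zero] hom_zero[OF module_zero M]])
      (auto simp: * zero_module_def)
qed

text \<open>Splitting off one interval summand after another lowers the total dimension.\<close>

theorem interval_decomposition:
  fixes M :: "(nat, 'k::field) pmod"
  assumes r: "type_A_poset n r" and "is_module r M"
  shows "\<exists>Is. set Is \<subseteq> closed_intervals n \<and> isomorphic r M (interval_sum Is)"
  using assms(2)
proof (induction "\<Sum>x\<in>Field r. vdim M x" arbitrary: M rule: less_induct)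
  case less
  show ?case
  proof (cases "is_zero r M")
    case True
    then show ?thesis using is_zero_isomorphic_zero_module[OF less.prems]
      by (intro exI[of _ "[]"]) auto
  next
    case False
    then obtain I i p where I: "I \<in> closed_intervals n"
      and h: "is_hom r (interval_module I) M i" "is_hom r M (interval_module I) p"
      "\<And>x. x \<in> Field r \<Longrightarrow> p x * i x = 1\<^sub>m (vdim (interval_module I :: (nat, 'k) pmod) x)"
      using interval_summand_exists[OF r less.prems] by metis
    note mI = module_interval[OF r I]
    obtain C where C: "is_module r C" "isomorphic r M (dsum (interval_module I) C)"
      "\<And>x. x \<in> Field r \<Longrightarrow> vdim M x = vdim (interval_module I :: (nat, 'k) pmod) x + vdim C x"
      by (rule thin_summand_splits[OF less.prems mI _ h]) auto
    obtain k where k: "k \<in> I" "k \<in> Field r"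
      using I type_A_poset_Field[OF r] unfolding closed_intervals_def by fastforce
    have "(\<Sum>x\<in>Field r. vdim C x) < (\<Sum>x\<in>Field r. vdim M x)"
    proof (rule sum_strict_mono_ex1)
      show "finite (Field r)" using type_A_poset_Field[OF r] by simp
      show "\<exists>x\<in>Field r. vdim C x < vdim M x" using k C(3) by (intro bexI[of _ k]) auto
    qed (use C(3) in auto)
    from less.hyps[OF this C(1)] obtain Is where
      Is: "set Is \<subseteq> closed_intervals n" "isomorphic r C (interval_sum Is)" by blast
    note mIs = module_interval_sum[OF r Is(1)]
    have "isomorphic r M (dsum (interval_module I) (interval_sum Is))"
      by (rule isomorphic_trans[OF C(2) dsum_cong[OF isomorphic_refl[OF mI] Is(2) mI mI C(1) mIs]])
        (use less.prems mI mIs C(1) in \<open>auto intro!: module_dsum\<close>)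
    then show ?thesis using I Is(1) by (intro exI[of _ "I # Is"]) auto
  qed
qed

section \<open>Uniqueness of the decomposition\<close>

definition retract :: "'p rel \<Rightarrow> ('p, 'k::field) pmod \<Rightarrow> ('p, 'k) pmod \<Rightarrow> bool" where
  "retract r A M \<longleftrightarrow> (\<exists>u v. is_hom r A M u \<and> is_hom r M A v \<and>
     (\<forall>x\<in>Field r. v x * u x = 1\<^sub>m (vdim A x)))"

lemma retract_trans:
  assumes "retract r A M" "retract r M N"
    and M: "is_module r A" "is_module r M" "is_module r N"
  shows "retract r A N"
proof -
  obtain u v where u: "is_hom r A M u" "is_hom r M A v" "\<And>x. x \<in> Field r \<Longrightarrow> v x * u x = 1\<^sub>m (vdim A x)"
    using assms(1) unfolding retract_def by blast
  obtain u' v' where u': "is_hom r M N u'" "is_hom r N M v'" "\<And>x. x \<in> Field r \<Longrightarrow> v' x * u' x = 1\<^sub>m (vdim M x)"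
    using assms(2) unfolding retract_def by blast
  have "v x * v' x * (u' x * u x) = 1\<^sub>m (vdim A x)" if x: "x \<in> Field r" for x
    using hom_dim[OF u(1) x] hom_dim[OF u(2) x] hom_dim[OF u'(1) x] hom_dim[OF u'(2) x]
    by (simp add: mat_algebra mat_mult_cong_left[OF u'(3)[OF x]] u(3)[OF x])
  then show ?thesis
    unfolding retract_def using hom_comp[OF u(1) u'(1) M] hom_comp[OF u'(2) u(2) M(3,2,1)] by blast
qed

lemma retract_isomorphic: "isomorphic r A M \<Longrightarrow> retract r A M"
  unfolding retract_def by (erule isomorphicE) (intro exI conjI ballI)

lemma retract_dsum_right:
  assumes M: "is_module r A" "is_module r B"
  shows "retract r B (dsum A B)"
  using biproduct_hom[OF biproduct_dsum[OF M]] biproduct_eq(2)[OF biproduct_dsum[OF M]]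
  unfolding retract_def by blast

lemma retract_dsum_cong:
  assumes "retract r B C" and M: "is_module r A" "is_module r B" "is_module r C"
  shows "retract r (dsum A B) (dsum A C)"
proof -
  obtain u v where u: "is_hom r B C u" "is_hom r C B v" "\<And>x. x \<in> Field r \<Longrightarrow> v x * u x = 1\<^sub>m (vdim B x)"
    using assms(1) unfolding retract_def by blast
  obtain i p j q where b: "biproduct r (dsum A B) A B i p j q" using biproduct_dsum[OF M(1,2)] by blast
  obtain i' p' j' q' where c: "biproduct r (dsum A C) A C i' p' j' q'" using biproduct_dsum[OF M(1,3)] by blast
  note D = module_dsum[OF M(1,2)] module_dsum[OF M(1,3)]
  have "is_hom r (dsum A B) (dsum A C) (\<lambda>x. i' x * p x + j' x * (u x * q x))"
    by (intro hom_add hom_comp[OF biproduct_hom(2)[OF b] biproduct_hom(1)[OF c]]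
        hom_comp[OF hom_comp[OF biproduct_hom(4)[OF b] u(1)] biproduct_hom(3)[OF c]] M D)
  moreover have "is_hom r (dsum A C) (dsum A B) (\<lambda>x. i x * p' x + j x * (v x * q' x))"
    by (intro hom_add hom_comp[OF biproduct_hom(2)[OF c] biproduct_hom(1)[OF b]]
        hom_comp[OF hom_comp[OF biproduct_hom(4)[OF c] u(2)] biproduct_hom(3)[OF b]] M D)
  moreover have "(i x * p' x + j x * (v x * q' x)) * (i' x * p x + j' x * (u x * q x)) = 1\<^sub>m (vdim (dsum A B) x)"
    if x: "x \<in> Field r" for x
  proof -
    note d = biproduct_dim[OF b x] biproduct_dim[OF c x] hom_dim[OF u(1) x] hom_dim[OF u(2) x]
    note e = biproduct_eq[OF b x]
    note e' = biproduct_eq[OF c x] biproduct_orthogonal[OF c x] biproduct_orthogonal[OF biproduct_swap[OF c] x]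
    show ?thesis
      using d by (simp add: mat_algebra e' e(3)[simplified] mat_mult_cong_left[OF e'(1)] mat_mult_cong_left[OF e'(2)]
        mat_mult_cong_left[OF e'(4)] mat_mult_cong_left[OF e'(5)] mat_mult_cong_left[OF u(3)[OF x]])
  qed
  ultimately show ?thesis unfolding retract_def by blast
qed

text \<open>The uniqueness proof compares, for every interval I, the numbers of summands whose intervals
  contain I. Those summands form a retract, and restricted to I their sum is a constant module with
  identity maps.\<close>

lemma retract_interval_sum_filter:
  assumes r: "type_A_poset n r" and "set Is \<subseteq> closed_intervals n"
  shows "retract r (interval_sum (filter P Is)) (interval_sum Is :: (nat, 'k::field) pmod)"
  using assms(2)
proof (induction Is)
  case Nil
  then show ?case by (simp add: retract_isomorphic isomorphic_refl)
next
  case (Cons J Js)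
  have mJ: "is_module r (interval_module J :: (nat, 'k) pmod)" using Cons.prems by (intro module_interval[OF r]) auto
  have mJs: "is_module r (interval_sum Js :: (nat, 'k) pmod)" using Cons.prems by (intro module_interval_sum[OF r]) auto
  have mF: "is_module r (interval_sum (filter P Js) :: (nat, 'k) pmod)"
    using Cons.prems by (intro module_interval_sum[OF r]) auto
  have IH: "retract r (interval_sum (filter P Js)) (interval_sum Js :: (nat, 'k) pmod)" using Cons by auto
  show ?case
  proof (cases "P J")
    case True
    then show ?thesis using retract_dsum_cong[OF IH mJ mF mJs] by simp
  next
    case False
    then show ?thesis
      using retract_trans[OF IH retract_dsum_right[OF mJ mJs] mF mJs module_dsum[OF mJ mJs]] by simp
  qed
qed

lemma interval_sum_on_common_part:
  assumes "\<And>J. J \<in> set Js \<Longrightarrow> I \<subseteq> J" "x \<in> I" "y \<in> I"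
  shows "vdim (interval_sum Js :: (nat, 'k::field) pmod) x = length Js"
    "vmap (interval_sum Js :: (nat, 'k) pmod) x y = 1\<^sub>m (length Js)"
proof -
  have d: "vdim (interval_sum Js :: (nat, 'k) pmod) x = length Js" if "x \<in> I" "\<And>J. J \<in> set Js \<Longrightarrow> I \<subseteq> J" for x Js
    using that
  proof (induction Js)
    case (Cons J Js)
    then have "x \<in> J" by auto
    then show ?case using Cons by simp
  qed (simp add: zero_module_def)
  show "vdim (interval_sum Js :: (nat, 'k::field) pmod) x = length Js" by (rule d) (use assms in auto)
  show "vmap (interval_sum Js :: (nat, 'k) pmod) x y = 1\<^sub>m (length Js)"
    using assms(1)
  proof (induction Js)
    case Nil
    then show ?case by (auto simp: zero_module_def)
  next
    case (Cons J Js)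
    then have "x \<in> J" "y \<in> J" using assms(2,3) by auto
    then show ?case using Cons d[of x Js] d[of y Js] assms(2,3) four_block_one_mat[of 1 "length Js"] by simp
  qed
qed

lemma constant_on_interval:
  assumes r: "type_A_poset n r" and I: "I \<in> closed_intervals n"
    and g: "\<And>x y. x \<in> I \<Longrightarrow> y \<in> I \<Longrightarrow> (x, y) \<in> r \<Longrightarrow> g x = g y"
    and x: "x \<in> I" and y: "y \<in> I"
  shows "g x = g y"
proof -
  obtain i j where ij: "I = {i..j}" "1 \<le> i" "j \<le> n" using I unfolding closed_intervals_def by auto
  have gi: "g z = g i" if "i \<le> z" "z \<le> j" for z
    using that
  proof (induction z rule: dec_induct)
    case (step z)
    then have "(z, Suc z) \<in> r \<or> (Suc z, z) \<in> r"
      using ij by (intro type_A_poset_adjacent[OF r]) auto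
    then have "g z = g (Suc z)" using g[of z "Suc z"] g[of "Suc z" z] step ij by auto
    then show ?case using step by simp
  qed simp
  show ?thesis using gi[of x] gi[of y] x y ij(1) by simp
qed

text \<open>The families a and b amount to m-dimensional morphisms into and out of M on I. Their
  composite is constant along I, and a summand whose interval J does not contain I contributes
  zero to it at a point of I outside J. The other summands contribute matrices of rank at most
  one.\<close>

lemma pairing_factors:
  fixes a b :: "nat \<Rightarrow> 'k::field mat"
  assumes r: "type_A_poset n r" and I: "I \<in> closed_intervals n"
    and "set Js \<subseteq> closed_intervals n"
    and "\<And>x. x \<in> I \<Longrightarrow> a x \<in> carrier_mat (vdim (interval_sum Js :: (nat, 'k) pmod) x) m"
    and "\<And>x. x \<in> I \<Longrightarrow> b x \<in> carrier_mat m (vdim (interval_sum Js :: (nat, 'k) pmod) x)"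
    and "\<And>x y. x \<in> I \<Longrightarrow> y \<in> I \<Longrightarrow> (x, y) \<in> r \<Longrightarrow> vmap (interval_sum Js) x y * a x = a y"
    and "\<And>x y. x \<in> I \<Longrightarrow> y \<in> I \<Longrightarrow> (x, y) \<in> r \<Longrightarrow> b y * vmap (interval_sum Js) x y = b x"
  shows "\<exists>P\<in>carrier_mat m (length (filter ((\<subseteq>) I) Js)). \<exists>Q\<in>carrier_mat (length (filter ((\<subseteq>) I) Js)) m.
    \<forall>x\<in>I. b x * a x = P * Q"
  using assms(3-)
proof (induction Js arbitrary: a b)
  case Nil
  have "b x * a x = 0\<^sub>m m 0 * 0\<^sub>m 0 m" if "x \<in> I" for x
    using Nil(2,3)[OF that] by (intro eq_matI) (auto simp: scalar_prod_def zero_module_def)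
  then show ?case by (intro bexI[of _ "0\<^sub>m m 0"] bexI[of _ "0\<^sub>m 0 m"]) auto
next
  case (Cons J Js)
  let ?A = "interval_module J :: (nat, 'k) pmod" and ?B = "interval_sum Js :: (nat, 'k) pmod"
  let ?M = "dsum ?A ?B"
  have mA: "is_module r ?A" using Cons.prems by (intro module_interval[OF r]) auto
  have mB: "is_module r ?B" using Cons.prems by (intro module_interval_sum[OF r]) auto
  note mM = module_dsum[OF mA mB]
  obtain i p j q where bp: "biproduct r ?M ?A ?B i p j q" using biproduct_dsum[OF mA mB] by blast
  note h = biproduct_hom[OF bp]
  have IF: "x \<in> Field r" if "x \<in> I" for x
    using that I type_A_poset_Field[OF r] unfolding closed_intervals_def by auto
  have D: "dim_row (a x) = vdim ?M x" "dim_col (a x) = m" "dim_row (b x) = m" "dim_col (b x) = vdim ?M x"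
    if "x \<in> I" for x using Cons.prems(2,3)[OF that] by (auto simp del: dsum_sel)
  have ca: "vmap ?M x y * a x = a y" and cb: "b y * vmap ?M x y = b x"
    if "x \<in> I" "y \<in> I" "(x, y) \<in> r" for x y
    using Cons.prems(4,5)[OF that] by (simp_all del: dsum_sel)
  have part: "vmap C x y * (t x * a x) = t y * a y" "b y * s y * vmap C x y = b x * s x"
    if xy: "x \<in> I" "y \<in> I" "(x, y) \<in> r" and t: "is_hom r ?M C t" and s: "is_hom r C ?M s"
      and C: "is_module r C"
    for x y t s and C :: "(nat, 'k) pmod"
  proof -
    note d = D[OF xy(1)] D[OF xy(2)] hom_dim[OF t IF[OF xy(1)]] hom_dim[OF t IF[OF xy(2)]]
      hom_dim[OF s IF[OF xy(1)]] hom_dim[OF s IF[OF xy(2)]] module_dim[OF mM xy(3)] module_dim[OF C xy(3)]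
    show "vmap C x y * (t x * a x) = t y * a y"
      using d by (simp add: mat_mult_cong_left[OF hom_commute[OF t xy(3), symmetric]] mat_assoc ca[OF xy] del: dsum_sel)
    show "b y * s y * vmap C x y = b x * s x"
      using d by (simp add: mat_assoc hom_commute[OF s xy(3)] mat_mult_cong_left[OF cb[OF xy]] del: dsum_sel)
  qed
  have "\<exists>P\<in>carrier_mat m (length (filter ((\<subseteq>) I) Js)). \<exists>Q\<in>carrier_mat (length (filter ((\<subseteq>) I) Js)) m.
    \<forall>x\<in>I. (b x * j x) * (q x * a x) = P * Q"
  proof (rule Cons.IH)
    fix x assume x: "x \<in> I"
    note d = D[OF x] biproduct_dim[OF bp IF[OF x]]
    show "q x * a x \<in> carrier_mat (vdim ?B x) m" "b x * j x \<in> carrier_mat m (vdim ?B x)"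
      using d by (auto intro!: carrier_matI)
  qed (use Cons.prems(1) part h mB in auto)
  then obtain P Q where PQ: "P \<in> carrier_mat m (length (filter ((\<subseteq>) I) Js))"
    "Q \<in> carrier_mat (length (filter ((\<subseteq>) I) Js)) m"
    "\<And>x. x \<in> I \<Longrightarrow> (b x * j x) * (q x * a x) = P * Q" by blast
  have sum: "b x * a x = (b x * i x) * (p x * a x) + P * Q" if x: "x \<in> I" for x
  proof -
    note d = D[OF x] biproduct_dim[OF bp IF[OF x]]
    have "b x * a x = b x * ((i x * p x + j x * q x) * a x)"
      using d by (simp add: biproduct_eq(3)[OF bp IF[OF x]] mat_one_left del: dsum_sel)
    also have "\<dots> = (b x * i x) * (p x * a x) + (b x * j x) * (q x * a x)"
      using d by (simp add: mat_assoc mat_distrib_right mat_distrib_left del: dsum_sel)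
    finally show ?thesis by (simp add: PQ(3)[OF x])
  qed
  have const: "(b x * i x) * (p x * a x) = (b y * i y) * (p y * a y)" if "x \<in> I" "y \<in> I" for x y
  proof (rule constant_on_interval[OF r I _ that])
    fix x y assume xy: "x \<in> I" "y \<in> I" "(x, y) \<in> r"
    note pp = part[OF xy h(2,1) mA]
    note d = D[OF xy(1)] D[OF xy(2)] biproduct_dim[OF bp IF[OF xy(1)]] biproduct_dim[OF bp IF[OF xy(2)]]
      module_dim[OF mA xy(3)]
    have "(b x * i x) * (p x * a x) = (b y * i y * vmap ?A x y) * (p x * a x)" by (simp only: pp)
    also have "\<dots> = (b y * i y) * (vmap ?A x y * (p x * a x))"
      using d by (intro mat_assoc) (simp_all del: dsum_sel interval_module_sel)
    also have "\<dots> = (b y * i y) * (p y * a y)" by (simp only: pp)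
    finally show "(b x * i x) * (p x * a x) = (b y * i y) * (p y * a y)" .
  qed
  show ?case
  proof (cases "I \<subseteq> J")
    case False
    then obtain z where z: "z \<in> I" "z \<notin> J" by blast
    have "(b z * i z) * (p z * a z) = 0\<^sub>m m m"
      using D[OF z(1)] biproduct_dim[OF bp IF[OF z(1)]] z(2)
      by (intro eq_matI) (auto simp: scalar_prod_def)
    then have "b x * a x = P * Q" if "x \<in> I" for x
      using sum[OF that] const[OF that z(1)] PQ(1,2) by (simp add: mat_add_zero_left)
    then show ?thesis using False PQ by (intro bexI[of _ P] bexI[of _ Q]) auto
  next
    case True
    obtain z where z: "z \<in> I" using I unfolding closed_intervals_def by fastforce
    then have zJ: "z \<in> J" using True by auto
    define c where "c = length (filter ((\<subseteq>) I) Js)"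
    define P' where "P' = mat m (Suc c) (\<lambda>(s, t). case t of 0 \<Rightarrow> (b z * i z) $$ (s, 0) | Suc t \<Rightarrow> P $$ (s, t))"
    define Q' where "Q' = mat (Suc c) m (\<lambda>(t, s). case t of 0 \<Rightarrow> (p z * a z) $$ (0, s) | Suc t \<Rightarrow> Q $$ (t, s))"
    define R where "R = b z * i z"
    define S where "S = p z * a z"
    have RS: "R \<in> carrier_mat m 1" "S \<in> carrier_mat 1 m"
      using D[OF z] biproduct_dim[OF bp IF[OF z]] zJ by (auto simp: R_def S_def intro!: carrier_matI)
    have "P' * Q' = R * S + P * Q"
    proof (rule eq_matI)
      fix s t assume "s < dim_row (R * S + P * Q)" "t < dim_col (R * S + P * Q)"
      then have st: "s < m" "t < m" using PQ(1,2) by auto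
      have "(P' * Q') $$ (s, t) = (\<Sum>l\<in>{0..<Suc c}. P' $$ (s, l) * Q' $$ (l, t))"
        using st by (simp add: P'_def Q'_def scalar_prod_def)
      also have "\<dots> = P' $$ (s, 0) * Q' $$ (0, t) + (\<Sum>l\<in>{0..<c}. P' $$ (s, Suc l) * Q' $$ (Suc l, t))"
        by (simp only: sum.atLeast0_lessThan_Suc_shift comp_def)
      also have "\<dots> = (R * S + P * Q) $$ (s, t)"
        using st RS PQ(1,2) by (simp add: P'_def Q'_def R_def[symmetric] S_def[symmetric] scalar_prod_def c_def)
      finally show "(P' * Q') $$ (s, t) = (R * S + P * Q) $$ (s, t)" .
    qed (use RS PQ(1,2) in \<open>auto simp: P'_def Q'_def\<close>)
    then have "b x * a x = P' * Q'" if "x \<in> I" for x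
      using sum[OF that] const[OF that z] by (simp add: R_def S_def)
    moreover have "length (filter ((\<subseteq>) I) (J # Js)) = Suc c" using True by (simp add: c_def)
    moreover have "P' \<in> carrier_mat m (Suc c)" "Q' \<in> carrier_mat (Suc c) m" by (auto simp: P'_def Q'_def)
    ultimately show ?thesis by metis
  qed
qed

lemma identity_factors_dim_le:
  fixes P Q :: "'k::field mat"
  assumes P: "P \<in> carrier_mat m c" and Q: "Q \<in> carrier_mat c m" and PQ: "P * Q = 1\<^sub>m m"
  shows "m \<le> c"
proof (rule ccontr)
  assume "\<not> m \<le> c"
  then have c: "c < m" by simp
  \<comment> \<open>padding by zeros gives square matrices with P' Q' = 1 although Q' has a zero row\<close>
  define P' where "P' = mat m m (\<lambda>(s, t). if t < c then P $$ (s, t) else 0)"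
  define Q' where "Q' = mat m m (\<lambda>(t, s). if t < c then Q $$ (t, s) else 0)"
  have "P' * Q' = P * Q"
  proof (rule eq_matI)
    fix s t assume "s < dim_row (P * Q)" "t < dim_col (P * Q)"
    then have st: "s < m" "t < m" using P Q by auto
    have "(P' * Q') $$ (s, t) = (\<Sum>l\<in>{0..<m}. if l < c then P $$ (s, l) * Q $$ (l, t) else 0)"
      using st by (simp add: P'_def Q'_def scalar_prod_def if_distrib cong: if_cong)
    also have "\<dots> = (\<Sum>l\<in>{0..<c}. P $$ (s, l) * Q $$ (l, t))"
      using c by (intro sum.mono_neutral_cong_right) auto
    finally show "(P' * Q') $$ (s, t) = (P * Q) $$ (s, t)"
      using st P Q by (simp add: scalar_prod_def)
  qed (use P Q in \<open>auto simp: P'_def Q'_def\<close>)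
  then have "Q' * P' = 1\<^sub>m m"
    using mat_mult_left_right_inverse[of P' m Q'] PQ by (auto simp: P'_def Q'_def)
  then have "(Q' * P') $$ (c, c) = 1" using c by simp
  moreover have "(Q' * P') $$ (c, c) = 0" using c by (simp add: P'_def Q'_def scalar_prod_def)
  ultimately show False by simp
qed

text \<open>If m of the intervals in Is contain I, then the identity matrix of size m factors through a
  space whose dimension is the number of intervals in Js that contain I.\<close>

lemma superset_count_le:
  assumes r: "type_A_poset n r" and I: "I \<in> closed_intervals n"
    and Is: "set Is \<subseteq> closed_intervals n" and Js: "set Js \<subseteq> closed_intervals n"
    and iso: "isomorphic r (interval_sum Is :: (nat, 'k::field) pmod) (interval_sum Js)"
  shows "length (filter ((\<subseteq>) I) Is) \<le> length (filter ((\<subseteq>) I) Js)"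
proof -
  let ?m = "length (filter ((\<subseteq>) I) Is)"
  let ?F = "interval_sum (filter ((\<subseteq>) I) Is) :: (nat, 'k) pmod"
  let ?J = "interval_sum Js :: (nat, 'k) pmod"
  have "set (filter ((\<subseteq>) I) Is) \<subseteq> closed_intervals n" using Is by auto
  note m = module_interval_sum[OF r this] module_interval_sum[OF r Is] module_interval_sum[OF r Js]
  have "retract r ?F ?J"
    by (rule retract_trans[OF retract_interval_sum_filter[OF r Is] retract_isomorphic[OF iso] m])
  then obtain a b where ab: "is_hom r ?F ?J a" "is_hom r ?J ?F b"
    "\<And>x. x \<in> Field r \<Longrightarrow> b x * a x = 1\<^sub>m (vdim ?F x)"
    unfolding retract_def by blast
  have IF: "x \<in> Field r" if "x \<in> I" for x
    using that I type_A_poset_Field[OF r] unfolding closed_intervals_def by auto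
  have F: "vdim ?F x = ?m" "vmap ?F x y = 1\<^sub>m ?m" if "x \<in> I" "y \<in> I" for x y
    using interval_sum_on_common_part[OF _ that, of "filter ((\<subseteq>) I) Is"] by auto
  have "\<exists>P\<in>carrier_mat ?m (length (filter ((\<subseteq>) I) Js)).
      \<exists>Q\<in>carrier_mat (length (filter ((\<subseteq>) I) Js)) ?m. \<forall>x\<in>I. b x * a x = P * Q"
  proof (rule pairing_factors[OF r I Js])
    fix x assume x: "x \<in> I"
    show "a x \<in> carrier_mat (vdim ?J x) ?m" "b x \<in> carrier_mat ?m (vdim ?J x)"
      using hom_dim[OF ab(1) IF[OF x]] hom_dim[OF ab(2) IF[OF x]] F[OF x x] by (auto intro!: carrier_matI)
  next
    fix x y assume xy: "x \<in> I" "y \<in> I" "(x, y) \<in> r"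
    show "vmap ?J x y * a x = a y"
      using hom_commute[OF ab(1) xy(3)] hom_dim[OF ab(1) IF[OF xy(2)]] F(1)[OF xy(2,2)] F(2)[OF xy(1,2)]
      by (metis mat_one_right)
    show "b y * vmap ?J x y = b x"
      using hom_commute[OF ab(2) xy(3)] hom_dim[OF ab(2) IF[OF xy(1)]] F(1)[OF xy(1,1)] F(2)[OF xy(1,2)]
      by (metis mat_one_left)
  qed
  then obtain P Q where PQ: "P \<in> carrier_mat ?m (length (filter ((\<subseteq>) I) Js))"
    "Q \<in> carrier_mat (length (filter ((\<subseteq>) I) Js)) ?m" "\<forall>x\<in>I. b x * a x = P * Q" by blast
  obtain z where z: "z \<in> I" using I unfolding closed_intervals_def by fastforce
  have "P * Q = 1\<^sub>m ?m" using PQ(3) z ab(3)[OF IF[OF z]] F(1)[OF z z] by auto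
  then show ?thesis by (rule identity_factors_dim_le[OF PQ(1,2)])
qed

lemma finite_closed_intervals: "finite (closed_intervals n)"
  by (rule finite_subset[of _ "Pow {1..n}"]) (auto simp: closed_intervals_def)

lemma length_filter_eq_sum_count:
  assumes "finite C" "set Is \<subseteq> C"
  shows "length (filter P Is) = (\<Sum>J\<in>{J \<in> C. P J}. count (mset Is) J)"
  using assms(2)
proof (induction Is)
  case (Cons I Is)
  have "(\<Sum>J\<in>{J \<in> C. P J}. count (mset (I # Is)) J) =
      (\<Sum>J\<in>{J \<in> C. P J}. count (mset Is) J + (if J = I then 1 else 0))"
    by (rule sum.cong) auto
  also have "\<dots> = (\<Sum>J\<in>{J \<in> C. P J}. count (mset Is) J) + (if P I then 1 else 0)"
    using assms(1) Cons.prems by (subst sum.distrib) (auto simp: sum.delta)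
  finally show ?case using Cons by auto
qed simp

text \<open>The numbers of entries above each interval determine the multiplicities, starting from the
  largest intervals.\<close>

lemma mset_eq_if_superset_counts_eq:
  assumes Is: "set Is \<subseteq> closed_intervals n" and Js: "set Js \<subseteq> closed_intervals n"
    and eq: "\<And>I. I \<in> closed_intervals n \<Longrightarrow> length (filter ((\<subseteq>) I) Is) = length (filter ((\<subseteq>) I) Js)"
  shows "mset Is = mset Js"
proof (rule multiset_eqI)
  fix I
  have "count (mset Is) I = count (mset Js) I" if "I \<in> closed_intervals n"
    using that
  proof (induction "n - card I" arbitrary: I rule: less_induct)
    case less
    let ?S = "{J \<in> closed_intervals n. I \<subseteq> J}"
    have fin: "finite ?S" using finite_closed_intervals by auto
    have split: "length (filter ((\<subseteq>) I) Ks) = count (mset Ks) I + (\<Sum>J\<in>?S - {I}. count (mset Ks) J)"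
      if "set Ks \<subseteq> closed_intervals n" for Ks
      using length_filter_eq_sum_count[OF finite_closed_intervals that, of "(\<subseteq>) I"] less.prems
        sum.remove[OF fin, of I "count (mset Ks)"] by auto
    have "(\<Sum>J\<in>?S - {I}. count (mset Is) J) = (\<Sum>J\<in>?S - {I}. count (mset Js) J)"
    proof (rule sum.cong)
      fix J assume J: "J \<in> ?S - {I}"
      then have Jn: "J \<subseteq> {1..n}" "finite J" by (auto simp: closed_intervals_def)
      have "card I < card J" using J Jn by (intro psubset_card_mono) auto
      moreover have "card J \<le> n" using card_mono[OF _ Jn(1)] by simp
      ultimately show "count (mset Is) J = count (mset Js) J" using J by (intro less.hyps) auto
    qed simp
    then show ?case using split[OF Is] split[OF Js] eq[OF less.prems] by simp
  qed
  moreover have "count (mset Is) I = count (mset Js) I" if "I \<notin> closed_intervals n"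
    using that Is Js by (metis count_mset_0_iff subsetD)
  ultimately show "count (mset Is) I = count (mset Js) I" by blast
qed

theorem interval_decomposition_unique:
  assumes r: "type_A_poset n r"
    and Is: "set Is \<subseteq> closed_intervals n" and Js: "set Js \<subseteq> closed_intervals n"
    and iso: "isomorphic r (interval_sum Is :: (nat, 'k::field) pmod) (interval_sum Js)"
  shows "mset Is = mset Js"
  by (rule mset_eq_if_superset_counts_eq[OF Is Js])
    (intro antisym superset_count_le[OF r _ Is Js iso] superset_count_le[OF r _ Js Is isomorphic_sym[OF iso]])

section \<open>Indecomposable modules\<close>

lemma interval_nonempty_in_Field:
  assumes "type_A_poset n r" "I \<in> closed_intervals n"
  obtains x where "x \<in> I" "x \<in> Field r"
proof -
  obtain i j where "I = {i..j}" "1 \<le> i" "i \<le> j" "j \<le> n"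
    using assms(2) unfolding closed_intervals_def by auto
  then show thesis using that[of i] type_A_poset_Field[OF assms(1)] by auto
qed

lemma isomorphic_interval_sum_singleton:
  assumes r: "type_A_poset n r" and I: "I \<in> closed_intervals n"
  shows "isomorphic r (interval_module I :: (nat, 'k::field) pmod) (interval_sum [I])"
  using dsum_zero_right[OF module_interval[OF r I] module_zero is_zero_zero_module] by simp

lemma isomorphic_interval_sum_append:
  assumes r: "type_A_poset n r" and M: "is_module r A" "is_module r B"
    and Is: "set Is \<subseteq> closed_intervals n" "isomorphic r A (interval_sum Is)"
    and Js: "set Js \<subseteq> closed_intervals n" "isomorphic r B (interval_sum Js)"
  shows "isomorphic r (dsum A B) (interval_sum (Is @ Js))"
proof -
  note m = module_interval_sum[OF r Is(1)] module_interval_sum[OF r Js(1)]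
  have "set (Is @ Js) \<subseteq> closed_intervals n" using Is Js by auto
  note m' = module_interval_sum[OF r this]
  have "isomorphic r (interval_sum (Is @ Js)) (dsum (interval_sum Is) (interval_sum Js))"
    using foldr_dsum_append[of "map interval_module Is" r "map interval_module Js"]
      module_interval[OF r] Is(1) Js(1) by (auto simp del: foldr_append)
  from isomorphic_trans[OF dsum_cong[OF Is(2) Js(2) M(1) m(1) M(2) m(2)] isomorphic_sym[OF this]
      module_dsum[OF M] module_dsum[OF m] m'] show ?thesis .
qed

text \<open>Decompositions of the two summands of an interval module combine to a decomposition of it, which
  by uniqueness has a single entry; so one of the summands has an empty decomposition.\<close>

lemma indecomposable_interval:
  assumes r: "type_A_poset n r" and I: "I \<in> closed_intervals n"
  shows "indecomposable r (interval_module I :: (nat, 'k::field) pmod)"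
  unfolding indecomposable_def
proof (intro conjI allI impI)
  note mI = module_interval[OF r I]
  show "is_module r (interval_module I :: (nat, 'k) pmod)" by (rule mI)
  show "\<not> is_zero r (interval_module I :: (nat, 'k) pmod)"
    using interval_nonempty_in_Field[OF r I] by (auto simp: is_zero_def)
  fix A B :: "(nat, 'k) pmod"
  assume A: "is_module r A" and B: "is_module r B" and iso: "isomorphic r (interval_module I) (dsum A B)"
  obtain As where As: "set As \<subseteq> closed_intervals n" "isomorphic r A (interval_sum As)"
    using interval_decomposition[OF r A] by blast
  obtain Bs where Bs: "set Bs \<subseteq> closed_intervals n" "isomorphic r B (interval_sum Bs)"
    using interval_decomposition[OF r B] by blast
  have s: "set [I] \<subseteq> closed_intervals n" "set (As @ Bs) \<subseteq> closed_intervals n" using I As Bs by auto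
  note m = module_interval_sum[OF r s(1)] module_interval_sum[OF r s(2)]
  have "isomorphic r (interval_module I) (interval_sum (As @ Bs) :: (nat, 'k) pmod)"
    by (rule isomorphic_trans[OF iso isomorphic_interval_sum_append[OF r A B As Bs] mI module_dsum[OF A B] m(2)])
  from isomorphic_trans[OF isomorphic_sym[OF isomorphic_interval_sum_singleton[OF r I]] this m(1) mI m(2)]
  have "mset [I] = mset (As @ Bs)" by (rule interval_decomposition_unique[OF r s])
  then have "size (mset [I]) = size (mset (As @ Bs))" by simp
  then have "length As + length Bs = 1" by simp
  then have "As = [] \<or> Bs = []" by (cases As; cases Bs) auto
  then show "is_zero r A \<or> is_zero r B"
    using is_zero_isomorphic[OF isomorphic_sym[OF As(2)]] is_zero_isomorphic[OF isomorphic_sym[OF Bs(2)]] by auto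
qed

lemma indecomposable_is_interval:
  fixes M :: "(nat, 'k::field) pmod"
  assumes r: "type_A_poset n r" and M: "indecomposable r M"
  obtains I where "I \<in> closed_intervals n" "isomorphic r M (interval_module I)"
proof -
  have mM: "is_module r M" and nz: "\<not> is_zero r M" using M unfolding indecomposable_def by auto
  obtain Is where Is: "set Is \<subseteq> closed_intervals n" "isomorphic r M (interval_sum Is)"
    using interval_decomposition[OF r mM] by blast
  show thesis
  proof (cases Is)
    case Nil
    then show ?thesis
      using nz is_zero_isomorphic[OF isomorphic_sym[OF Is(2)]] by simp
  next
    case (Cons I Js)
    have I: "I \<in> closed_intervals n" and Js: "set Js \<subseteq> closed_intervals n" using Is Cons by auto
    note m = module_interval[OF r I] module_interval_sum[OF r Js]
    have iso: "isomorphic r M (dsum (interval_module I) (interval_sum Js))" using Is Cons by simp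
    then have "is_zero r (interval_module I :: (nat, 'k) pmod) \<or> is_zero r (interval_sum Js :: (nat, 'k) pmod)"
      using M m unfolding indecomposable_def by blast
    moreover have "\<not> is_zero r (interval_module I :: (nat, 'k) pmod)"
      using interval_nonempty_in_Field[OF r I] by (auto simp: is_zero_def)
    ultimately have "is_zero r (interval_sum Js :: (nat, 'k) pmod)" by blast
    from isomorphic_trans[OF iso isomorphic_sym[OF dsum_zero_right[OF m this]] mM module_dsum[OF m] m(1)]
    show ?thesis by (rule that[OF I])
  qed
qed

definition interval_classes :: "nat \<Rightarrow> nat rel \<Rightarrow> (nat, 'k::field) pmod set set" where
  "interval_classes n r = (\<lambda>I. iso_class r (interval_module I)) ` closed_intervals n"

lemma inj_on_interval_class:
  assumes r: "type_A_poset n r"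
  shows "inj_on (\<lambda>I. iso_class r (interval_module I :: (nat, 'k::field) pmod)) (closed_intervals n)"
proof (rule inj_onI)
  fix I J
  assume I: "I \<in> closed_intervals n" and J: "J \<in> closed_intervals n"
    and eq: "iso_class r (interval_module I :: (nat, 'k) pmod) = iso_class r (interval_module J)"
  note mI = module_interval[OF r I] and mJ = module_interval[OF r J]
  have s: "set [I] \<subseteq> closed_intervals n" "set [J] \<subseteq> closed_intervals n" using I J by auto
  note m = module_interval_sum[OF r s(1)] module_interval_sum[OF r s(2)]
  have "isomorphic r (interval_module I :: (nat, 'k) pmod) (interval_module J)"
    using eq iso_class_eq_iff[OF mI mJ] by blast
  from isomorphic_trans[OF isomorphic_sym[OF isomorphic_interval_sum_singleton[OF r I]] this m(1) mI mJ]
  have "isomorphic r (interval_sum [I] :: (nat, 'k) pmod) (interval_module J)" .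
  from isomorphic_trans[OF this isomorphic_interval_sum_singleton[OF r J] m(1) mJ m(2)]
  have "mset [I] = mset [J]" by (rule interval_decomposition_unique[OF r s])
  then show "I = J" by simp
qed

lemma in_add_interval_classes:
  fixes M :: "(nat, 'k::field) pmod"
  assumes r: "type_A_poset n r" and M: "is_module r M"
  shows "in_add r (interval_classes n r) M"
proof -
  obtain Is where Is: "set Is \<subseteq> closed_intervals n" "isomorphic r M (interval_sum Is)"
    using interval_decomposition[OF r M] by blast
  show ?thesis
    unfolding in_add_def using M Is module_interval[OF r]
    by (intro conjI exI[of _ "map interval_module Is"]) (auto simp: interval_classes_def)
qed

section \<open>Relative resolutions\<close>

lemma mult_mat_mat_vec:
  "dim_col A = dim_row B \<Longrightarrow> dim_vec v = dim_col B \<Longrightarrow> (A * B) *\<^sub>v v = A *\<^sub>v (B *\<^sub>v v)"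
  for A B :: "'a::field mat"
  by (rule assoc_mult_mat_vec[of _ "dim_row A" "dim_col A" _ "dim_col B"]) (auto intro!: carrier_vecI)

lemma minimal_approximation_identity:
  assumes M: "is_module r M" and X: "in_add r X M"
  shows "minimal_approximation r X M M (id_mor M)"
  unfolding minimal_approximation_def approximation_def
proof (intro conjI allI impI)
  show "is_hom r M M (id_mor M)" unfolding id_mor_def by (rule hom_id[OF M])
next
  fix Q h assume "in_add r X Q" and h: "is_hom r Q M h"
  have "eq_mor r (comp_mor (id_mor M) h) h"
    using hom_dim[OF h] unfolding eq_mor_def comp_mor_def id_mor_def by (auto simp: mat_one_left)
  then show "\<exists>k. is_hom r Q M k \<and> eq_mor r (comp_mor (id_mor M) k) h" using h by blast
next
  fix g assume g: "is_hom r M M g" and e: "eq_mor r (comp_mor (id_mor M) g) (id_mor M)"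
  have "g x = 1\<^sub>m (vdim M x)" if "x \<in> Field r" for x
    using e hom_dim[OF g that] that unfolding eq_mor_def comp_mor_def id_mor_def by (auto simp: mat_one_left)
  then show "is_iso_mor r M M g" using g by (intro iso_morI[OF g g]) auto
qed (use M X in auto)

lemma zero_kernel_of_identity:
  fixes M :: "('p, 'k::field) pmod"
  assumes M: "is_module r M"
  shows "is_kernel r zero_module M (\<lambda>x. 0\<^sub>m (vdim M x) 0) (id_mor M)"
  unfolding is_kernel_def
proof (intro conjI ballI)
  show "is_hom r zero_module M (\<lambda>x. 0\<^sub>m (vdim M x) 0)"
    using hom_zero[OF module_zero M] by (simp add: zero_module_def)
  show "mono_mor r zero_module (\<lambda>x. 0\<^sub>m (vdim M x) 0)"
    by (auto simp: mono_mor_def zero_module_def intro!: inj_onI)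
  fix x
  have "0\<^sub>m (vdim M x) 0 *\<^sub>v v = 0\<^sub>v (vdim M x)" if "v \<in> carrier_vec 0" for v :: "'k vec"
    using that by (intro eq_vecI) (auto simp: scalar_prod_def)
  moreover have "(0\<^sub>v 0 :: 'k vec) \<in> carrier_vec 0" by simp
  ultimately have "(\<lambda>v. 0\<^sub>m (vdim M x) 0 *\<^sub>v v) ` carrier_vec 0 = {0\<^sub>v (vdim M x) :: 'k vec}"
    by (metis (no_types, lifting) image_cong image_constant)
  then show "(\<lambda>v. 0\<^sub>m (vdim M x) 0 *\<^sub>v v) ` carrier_vec (vdim zero_module x) = mat_kernel (id_mor M x)"
    by (auto simp: zero_module_def mat_kernel_def id_mor_def)
qed simp

lemma minimal_resolution_exists:
  assumes X: "\<And>M. is_module r M \<Longrightarrow> in_add r X M" and M: "is_module r M"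
  shows "\<exists>R. minimal_resolution r X M R"
proof -
  \<comment> \<open>the first approximation is the identity of M, and all kernels are zero\<close>
  let ?L = "\<lambda>j::nat. if j = 0 then M else zero_module"
  have m: "is_module r (?L j)" for j using M by simp
  have "minimal_resolution r X M ?L"
    unfolding minimal_resolution_def
    using minimal_approximation_identity[OF m X[OF m]] zero_kernel_of_identity[OF m]
    by (intro exI[of _ ?L] exI[of _ "\<lambda>j. id_mor (?L j)"] exI[of _ "\<lambda>j x. 0\<^sub>m (vdim (?L j) x) 0"]) auto
  then show ?thesis by blast
qed

text \<open>The identity of M factors through f, so f has a section k. Minimality makes k f invertible, and
  f is injective.\<close>

lemma minimal_approximation_kernel_zero:
  fixes R L M :: "('p, 'k::field) pmod"
  assumes M: "in_add r X M" and f: "minimal_approximation r X R M f" and K: "is_kernel r L R \<iota> f"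
  shows "is_zero r L"
  unfolding is_zero_def
proof
  fix x assume x: "x \<in> Field r"
  have mM: "is_module r M" and mR: "is_module r R" and hf: "is_hom r R M f"
    using f unfolding minimal_approximation_def approximation_def in_add_def by auto
  have hid: "is_hom r M M (id_mor M)" unfolding id_mor_def by (rule hom_id[OF mM])
  then obtain k where k: "is_hom r M R k" "eq_mor r (comp_mor f k) (id_mor M)"
    using f M unfolding minimal_approximation_def approximation_def by blast
  have fk: "f y * k y = 1\<^sub>m (vdim M y)" if "y \<in> Field r" for y
    using k(2) that unfolding eq_mor_def comp_mor_def id_mor_def by auto
  have "eq_mor r (comp_mor f (\<lambda>y. k y * f y)) f"
    unfolding eq_mor_def comp_mor_def
    using hom_dim[OF hf] hom_dim[OF k(1)] by (auto simp: mat_mult_cong_left[OF fk] mat_one_left)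
  moreover have "is_hom r R R (\<lambda>y. k y * f y)" by (rule hom_comp[OF hf k(1) mR mM mR])
  ultimately have "is_iso_mor r R R (\<lambda>y. k y * f y)"
    using f unfolding minimal_approximation_def by blast
  then obtain g where g: "is_hom r R R g" "g x * (k x * f x) = 1\<^sub>m (vdim R x)"
    by (rule iso_morE) (use x in blast)
  note d = hom_dim[OF hf x] hom_dim[OF k(1) x] hom_dim[OF g(1) x]
  have ker: "mat_kernel (f x) \<subseteq> {0\<^sub>v (vdim R x)}"
  proof
    fix v assume "v \<in> mat_kernel (f x)"
    then have v: "v \<in> carrier_vec (vdim R x)" "f x *\<^sub>v v = 0\<^sub>v (vdim M x)"
      using d by (auto simp: mat_kernel_def)
    have "v = (g x * (k x * f x)) *\<^sub>v v" using v by (simp add: g(2))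
    also have "\<dots> = (g x * k x) *\<^sub>v (f x *\<^sub>v v)"
      using d v by (simp add: mat_assoc[symmetric] mult_mat_mat_vec del: assoc_mult_mat_vec assoc_mult_mat)
    also have "\<dots> = 0\<^sub>v (vdim R x)" unfolding v(2) using d by (intro eq_vecI) (auto simp: scalar_prod_def)
    finally show "v \<in> {0\<^sub>v (vdim R x)}" by simp
  qed
  have i: "is_hom r L R \<iota>" "inj_on (\<lambda>v. \<iota> x *\<^sub>v v) (carrier_vec (vdim L x))"
    "(\<lambda>v. \<iota> x *\<^sub>v v) ` carrier_vec (vdim L x) = mat_kernel (f x)"
    using K x unfolding is_kernel_def mono_mor_def by auto
  show "vdim L x = 0"
  proof (rule ccontr)
    assume nz: "vdim L x \<noteq> 0"
    have "\<iota> x *\<^sub>v unit_vec (vdim L x) 0 \<in> mat_kernel (f x)" "\<iota> x *\<^sub>v 0\<^sub>v (vdim L x) \<in> mat_kernel (f x)"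
      using i(3) by auto
    then have "\<iota> x *\<^sub>v unit_vec (vdim L x) 0 = \<iota> x *\<^sub>v 0\<^sub>v (vdim L x)"
      using ker by (metis singletonD subsetD)
    then have "unit_vec (vdim L x) 0 = (0\<^sub>v (vdim L x) :: 'k vec)" using i(2) by (auto dest: inj_onD)
    then have "(unit_vec (vdim L x) 0 :: 'k vec) $ 0 = 0" using nz by simp
    then show False using nz by simp
  qed
qed

text \<open>The zero endomorphism g of R satisfies f g = f and is therefore invertible.\<close>

lemma minimal_approximation_of_zero:
  assumes f: "minimal_approximation r X R L f" and L: "is_zero r L"
  shows "is_zero r R"
  unfolding is_zero_def
proof
  fix x assume x: "x \<in> Field r"
  have mR: "is_module r R" and hf: "is_hom r R L f"
    using f unfolding minimal_approximation_def approximation_def in_add_def by auto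
  let ?g = "\<lambda>y. 0\<^sub>m (vdim R y) (vdim R y)"
  have "eq_mor r (comp_mor f ?g) f"
    unfolding eq_mor_def comp_mor_def
    using hom_dim[OF hf] L by (auto simp: is_zero_def intro!: mat_empty_eq)
  then have "is_iso_mor r R R ?g"
    using f hom_zero[OF mR mR] unfolding minimal_approximation_def by blast
  then obtain g where g: "is_hom r R R g" "g x * ?g x = 1\<^sub>m (vdim R x)"
    by (rule iso_morE) (use x in blast)
  show "vdim R x = 0"
  proof (rule ccontr)
    assume nz: "vdim R x \<noteq> 0"
    then have "(g x * ?g x) $$ (0, 0) = 1" unfolding g(2) by simp
    moreover have "(g x * ?g x) $$ (0, 0) = 0" using nz hom_dim[OF g(1) x] by (simp add: mat_zero_right)
    ultimately show False by simp
  qed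
qed

text \<open>If add X contains all modules, a minimal approximation is injective because it has a section,
  so minimal resolutions stop at once.\<close>

lemma X_dim_not_properly_infinite:
  fixes X :: "('p, 'k::field) pmod set set"
  assumes X: "\<And>M :: ('p, 'k) pmod. is_module r M \<Longrightarrow> in_add r X M"
  shows "\<not> X_dim_properly_infinite r X"
  unfolding X_dim_properly_infinite_def
proof (rule notI, elim exE conjE)
  fix M :: "('p, 'k) pmod"
  assume M: "is_module r M" and inf: "X_dim r X M = \<infinity>"
  define R where "R = (SOME R. minimal_resolution r X M R)"
  have "minimal_resolution r X M R"
    unfolding R_def by (rule someI_ex[OF minimal_resolution_exists[OF X M]])
  then obtain L f \<iota> where L: "L 0 = M" "\<And>j. minimal_approximation r X (R j) (L j) (f j)"
    "\<And>j. is_kernel r (L (Suc j)) (R j) (\<iota> j) (f j)"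
    unfolding minimal_resolution_def by blast
  have "in_add r X (L 0)" using X M L(1) by simp
  then have "is_zero r (L (Suc 0))" by (rule minimal_approximation_kernel_zero[OF _ L(2,3)])
  then have "is_zero r (R (0 + 1))" using minimal_approximation_of_zero[OF L(2)] by simp
  then have "enat 0 \<in> {enat j | j. is_zero r (R (j + 1))}" by blast
  then have "Inf {enat j | j. is_zero r (R (j + 1))} \<le> enat 0" by (rule Inf_lower)
  then show False using inf unfolding X_dim_def R_def[symmetric] Let_def by simp
qed

section \<open>The exact structure is split\<close>

lemma matrix_lift:
  fixes A H :: "'k::field mat"
  assumes A: "A \<in> carrier_mat n m" and H: "H \<in> carrier_mat n l"
    and im: "\<And>v. v \<in> carrier_vec l \<Longrightarrow> H *\<^sub>v v \<in> (\<lambda>w. A *\<^sub>v w) ` carrier_vec m"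
  shows "\<exists>P\<in>carrier_mat m l. A * P = H"
proof -
  have "\<exists>w. w \<in> carrier_vec m \<and> A *\<^sub>v w = col H t" if "t < l" for t
  proof -
    have "H *\<^sub>v unit_vec l t = col H t" using H that by (intro eq_vecI) auto
    then show ?thesis using im[of "unit_vec l t"] by auto
  qed
  then obtain w where w: "\<And>t. t < l \<Longrightarrow> w t \<in> carrier_vec m" "\<And>t. t < l \<Longrightarrow> A *\<^sub>v w t = col H t"
    by metis
  define P where "P = mat m l (\<lambda>(s, t). w t $ s)"
  have "A * P = H"
  proof (rule eq_matI)
    fix s t assume "s < dim_row H" "t < dim_col H"
    then have st: "s < n" "t < l" using H by auto
    have "col P t = w t" using st w(1)[OF st(2)] by (intro eq_vecI) (auto simp: P_def)
    then have "(A * P) $$ (s, t) = (A *\<^sub>v w t) $ s" using st A by (simp add: P_def)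
    then show "(A * P) $$ (s, t) = H $$ (s, t)" using st H w(2)[OF st(2)] by simp
  qed (use A H in \<open>auto simp: P_def\<close>)
  then show ?thesis by (intro bexI[of _ P]) (auto simp: P_def)
qed

lemma injective_matrix_cancel:
  fixes A B C :: "'k::field mat"
  assumes A: "inj_on (\<lambda>v. A *\<^sub>v v) (carrier_vec (dim_col A))" and eq: "A * B = A * C"
    and d: "dim_row B = dim_col A" "dim_row C = dim_col A" "dim_col B = dim_col C"
  shows "B = C"
proof (rule eq_matI)
  fix i j assume ij: "i < dim_row C" "j < dim_col C"
  have "A *\<^sub>v col B j = col (A * B) j" "A *\<^sub>v col C j = col (A * C) j"
    using ij d by (auto intro!: eq_vecI)
  then have "A *\<^sub>v col B j = A *\<^sub>v col C j" using eq by simp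
  moreover have "col B j \<in> carrier_vec (dim_col A)" "col C j \<in> carrier_vec (dim_col A)"
    by (intro carrier_vecI; simp add: d)+
  ultimately have "col B j = col C j" using A by (auto dest: inj_onD)
  then show "B $$ (i, j) = C $$ (i, j)" using ij d by (metis index_col)
qed (use d in auto)

text \<open>With a section k of g, the morphism 1 - k g lands in the kernel of g, and so factors through
  f; this gives the retraction p of f.\<close>

lemma short_exact_section_biproduct:
  fixes N :: "('p, 'k::field) pmod"
  assumes S: "short_exact r M f N g L" and k: "is_hom r L N k"
    and gk: "\<And>x. x \<in> Field r \<Longrightarrow> g x * k x = 1\<^sub>m (vdim L x)"
  shows "\<exists>p. biproduct r N M L f p k g"
proof -
  have m: "is_module r M" "is_module r N" "is_module r L" and f: "is_hom r M N f" and g: "is_hom r N L g"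
    and inj: "\<And>x. x \<in> Field r \<Longrightarrow> inj_on (\<lambda>v. f x *\<^sub>v v) (carrier_vec (vdim M x))"
    and ker: "\<And>x. x \<in> Field r \<Longrightarrow> (\<lambda>v. f x *\<^sub>v v) ` carrier_vec (vdim M x) = mat_kernel (g x)"
    using S unfolding short_exact_def is_kernel_def mono_mor_def by auto
  have D: "dim_row (f x) = vdim N x" "dim_col (f x) = vdim M x" "dim_row (g x) = vdim L x"
    "dim_col (g x) = vdim N x" "dim_row (k x) = vdim N x" "dim_col (k x) = vdim L x" if "x \<in> Field r" for x
    using hom_dim[OF f that] hom_dim[OF g that] hom_dim[OF k that] by auto
  have gf: "g x * f x = 0\<^sub>m (vdim L x) (vdim M x)" if x: "x \<in> Field r" for x
  proof (rule eq_matI)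
    fix i j assume "i < dim_row (0\<^sub>m (vdim L x) (vdim M x) :: 'k mat)" "j < dim_col (0\<^sub>m (vdim L x) (vdim M x) :: 'k mat)"
    then have ij: "i < vdim L x" "j < vdim M x" by auto
    have "f x *\<^sub>v unit_vec (vdim M x) j = col (f x) j" using D[OF x] ij by (intro eq_vecI) auto
    then have "col (f x) j \<in> mat_kernel (g x)" using ker[OF x] by (metis imageI unit_vec_carrier)
    then have "g x *\<^sub>v col (f x) j = 0\<^sub>v (vdim L x)" using D[OF x] by (simp add: mat_kernel_def)
    then have "(g x *\<^sub>v col (f x) j) $ i = 0" using ij by simp
    then show "(g x * f x) $$ (i, j) = 0\<^sub>m (vdim L x) (vdim M x) $$ (i, j)" using D[OF x] ij by simp
  qed (use D[OF x] in auto)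
  have "\<exists>P. P \<in> carrier_mat (vdim M x) (vdim N x) \<and> f x * P + k x * g x = 1\<^sub>m (vdim N x)"
    if x: "x \<in> Field r" for x
  proof -
    let ?H = "1\<^sub>m (vdim N x) - k x * g x"
    have H: "?H \<in> carrier_mat (vdim N x) (vdim N x)" using D[OF x] by (auto intro!: carrier_matI)
    have fc: "f x \<in> carrier_mat (vdim N x) (vdim M x)" and gc: "g x \<in> carrier_mat (vdim L x) (vdim N x)"
      and kc: "k x \<in> carrier_mat (vdim N x) (vdim L x)"
      using D[OF x] by (auto intro!: carrier_matI)
    have "\<exists>P\<in>carrier_mat (vdim M x) (vdim N x). f x * P = ?H"
    proof (rule matrix_lift[OF fc H])
      fix v :: "'k vec" assume v: "v \<in> carrier_vec (vdim N x)"
      have "g x * ?H = g x * 1\<^sub>m (vdim N x) - g x * (k x * g x)"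
        by (rule mult_minus_distrib_mat[OF gc]) (use gc kc in auto)
      also have "\<dots> = 0\<^sub>m (vdim L x) (vdim N x)"
        using D[OF x] by (simp add: mat_mult_cong_left[OF gk[OF x]] mat_one_left mat_one_right minus_r_inv_mat[OF gc])
      finally have "g x *\<^sub>v (?H *\<^sub>v v) = 0\<^sub>m (vdim L x) (vdim N x) *\<^sub>v v"
        using assoc_mult_mat_vec[OF gc H v] by simp
      also have "\<dots> = 0\<^sub>v (vdim L x)"
        using v by (intro eq_vecI) (auto simp: scalar_prod_def)
      finally have "g x *\<^sub>v (?H *\<^sub>v v) = 0\<^sub>v (vdim L x)" .
      then show "?H *\<^sub>v v \<in> (\<lambda>w. f x *\<^sub>v w) ` carrier_vec (vdim M x)"
        unfolding ker[OF x] using H v D[OF x] by (auto simp: mat_kernel_def)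
    qed
    then obtain P where P: "P \<in> carrier_mat (vdim M x) (vdim N x)" "f x * P = ?H" by blast
    have "?H + k x * g x = 1\<^sub>m (vdim N x)" using D[OF x] by (intro eq_matI) auto
    then show ?thesis using P by auto
  qed
  then obtain p where p: "\<And>x. x \<in> Field r \<Longrightarrow> p x \<in> carrier_mat (vdim M x) (vdim N x)"
    "\<And>x. x \<in> Field r \<Longrightarrow> f x * p x + k x * g x = 1\<^sub>m (vdim N x)" by metis
  have Dp: "dim_row (p x) = vdim M x" "dim_col (p x) = vdim N x" if "x \<in> Field r" for x
    using p(1)[OF that] by auto
  have pf: "p x * f x = 1\<^sub>m (vdim M x)" if x: "x \<in> Field r" for x
  proof (rule injective_matrix_cancel[of "f x"])
    have "f x = (f x * p x + k x * g x) * f x" using D[OF x] by (simp add: p(2)[OF x] mat_one_left)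
    also have "\<dots> = f x * (p x * f x)"
      using D[OF x] Dp[OF x] by (simp add: mat_distrib_right mat_assoc gf[OF x] mat_zero_right mat_add_zero_right)
    finally show "f x * (p x * f x) = f x * 1\<^sub>m (vdim M x)" using D[OF x] by (simp add: mat_one_right)
  qed (use D[OF x] Dp[OF x] inj[OF x] in auto)
  have pk: "p x * k x = 0\<^sub>m (vdim M x) (vdim L x)" if x: "x \<in> Field r" for x
    by (rule complementary_matrices_orthogonal[OF pf[OF x] gk[OF x] p(2)[OF x]]) (use D[OF x] Dp[OF x] in auto)
  have hp: "is_hom r N M p"
  proof (rule homI)
    fix x y assume xy: "(x, y) \<in> r" and F: "x \<in> Field r" "y \<in> Field r"
    note d = D[OF F(1)] D[OF F(2)] Dp[OF F(1)] Dp[OF F(2)]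
      module_dim[OF m(1) xy] module_dim[OF m(2) xy] module_dim[OF m(3) xy]
    have "p y * vmap N x y = p y * (vmap N x y * (f x * p x + k x * g x))"
      using d by (simp add: p(2)[OF F(1)] mat_one_right)
    also have "\<dots> = p y * (vmap N x y * (f x * p x)) + p y * (vmap N x y * (k x * g x))"
      using d by (simp add: mat_distrib_left)
    also have "p y * (vmap N x y * (f x * p x)) = vmap M x y * p x"
      using d by (simp add: mat_mult_cong_left[OF hom_commute[OF f xy, symmetric]] mat_assoc
          mat_mult_cong_left[OF pf[OF F(2)]] mat_one_left)
    also have "p y * (vmap N x y * (k x * g x)) = 0\<^sub>m (vdim M y) (vdim N x)"
      using d by (simp add: mat_mult_cong_left[OF hom_commute[OF k xy, symmetric]] mat_assoc
          mat_mult_cong_left[OF pk[OF F(2)]] mat_zero_left)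
    finally show "p y * vmap N x y = vmap M x y * p x" using d by (simp add: mat_add_zero_right)
  qed (simp_all add: Dp)
  have "biproduct r N M L f p k g"
    unfolding biproduct_def using f hp k g pf gk p(2) by blast
  then show ?thesis by blast
qed

lemma lift_from_dsum:
  assumes b: "biproduct r M A B i p j q" and m: "is_module r M" "is_module r A" "is_module r B"
      "is_module r N" "is_module r L" and g: "is_hom r N L g" and h: "is_hom r M L h"
    and A: "\<And>h. is_hom r A L h \<Longrightarrow> \<exists>k. is_hom r A N k \<and> eq_mor r (comp_mor g k) h"
    and B: "\<And>h. is_hom r B L h \<Longrightarrow> \<exists>k. is_hom r B N k \<and> eq_mor r (comp_mor g k) h"
  shows "\<exists>k. is_hom r M N k \<and> eq_mor r (comp_mor g k) h"
proof -
  note bh = biproduct_hom[OF b]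
  obtain k where k: "is_hom r A N k" "\<And>x. x \<in> Field r \<Longrightarrow> g x * k x = h x * i x"
    using A[OF hom_comp[OF bh(1) h m(2,1,5)]] unfolding eq_mor_def comp_mor_def by blast
  obtain l where l: "is_hom r B N l" "\<And>x. x \<in> Field r \<Longrightarrow> g x * l x = h x * j x"
    using B[OF hom_comp[OF bh(3) h m(3,1,5)]] unfolding eq_mor_def comp_mor_def by blast
  have "is_hom r M N (\<lambda>x. k x * p x + l x * q x)"
    by (intro hom_add hom_comp[OF bh(2) k(1)] hom_comp[OF bh(4) l(1)] m)
  moreover have "g x * (k x * p x + l x * q x) = h x" if x: "x \<in> Field r" for x
  proof -
    note d = biproduct_dim[OF b x] hom_dim[OF g x] hom_dim[OF h x] hom_dim[OF k(1) x] hom_dim[OF l(1) x]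
    have "g x * (k x * p x + l x * q x) = h x * (i x * p x + j x * q x)"
      using d by (simp add: mat_distrib_left mat_mult_cong_left[OF k(2)[OF x]]
          mat_mult_cong_left[OF l(2)[OF x]] mat_assoc)
    then show ?thesis using d by (simp add: biproduct_eq(3)[OF b x] mat_one_right)
  qed
  ultimately show ?thesis unfolding eq_mor_def comp_mor_def by blast
qed

text \<open>The exact structure tests lifting along g only for members of X; finite direct sums inherit it.\<close>

lemma lift_from_add:
  fixes N L R :: "('p, 'k::field) pmod"
  assumes R: "in_add r X R" and m: "is_module r N" "is_module r L" and g: "is_hom r N L g"
    and X: "\<And>Q h. is_module r Q \<Longrightarrow> iso_class r Q \<in> X \<Longrightarrow> is_hom r Q L h \<Longrightarrow>
      \<exists>k. is_hom r Q N k \<and> eq_mor r (comp_mor g k) h"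
    and h: "is_hom r R L h"
  shows "\<exists>k. is_hom r R N k \<and> eq_mor r (comp_mor g k) h"
proof -
  obtain Ms where Ms: "\<And>M. M \<in> set Ms \<Longrightarrow> is_module r M \<and> iso_class r M \<in> X"
    and iso: "isomorphic r R (foldr dsum Ms zero_module)" and mR: "is_module r R"
    using R unfolding in_add_def by blast
  have lift: "\<exists>k. is_hom r (foldr dsum Ms zero_module) N k \<and> eq_mor r (comp_mor g k) h"
    if "is_hom r (foldr dsum Ms zero_module) L h" for h
    using that Ms
  proof (induction Ms arbitrary: h)
    case Nil
    have "eq_mor r (comp_mor g (\<lambda>x. 0\<^sub>m (vdim N x) (vdim (zero_module :: ('p, 'k) pmod) x))) h"
      using Nil hom_dim[OF g] hom_dim[of r zero_module L h]
      by (auto simp: eq_mor_def comp_mor_def zero_module_def intro!: mat_empty_eq)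
    then show ?case using hom_zero[OF module_zero m(1)] by auto
  next
    case (Cons M Ms)
    have mM: "is_module r M" "is_module r (foldr dsum Ms zero_module)"
      using Cons.prems(2) by (auto intro: module_foldr_dsum)
    have "\<exists>k. is_hom r (dsum M (foldr dsum Ms zero_module)) N k \<and> eq_mor r (comp_mor g k) h"
    proof (rule lift_from_dsum[OF biproduct_dsum[OF mM] module_dsum[OF mM] mM m g])
      show "is_hom r (dsum M (foldr dsum Ms zero_module)) L h" using Cons.prems(1) by simp
    qed (use Cons X in auto)
    then show ?case by simp
  qed
  obtain s t where st: "is_hom r R (foldr dsum Ms zero_module) s" "is_hom r (foldr dsum Ms zero_module) R t"
    "\<And>x. x \<in> Field r \<Longrightarrow> t x * s x = 1\<^sub>m (vdim R x)"
    using iso by (rule isomorphicE) (rule that)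
  have mS: "is_module r (foldr dsum Ms zero_module)" using Ms by (intro module_foldr_dsum) auto
  obtain k where k: "is_hom r (foldr dsum Ms zero_module) N k" "\<And>x. x \<in> Field r \<Longrightarrow> g x * k x = h x * t x"
    using lift[OF hom_comp[OF st(2) h mS mR m(2)]] unfolding eq_mor_def comp_mor_def by blast
  have "g x * (k x * s x) = h x" if x: "x \<in> Field r" for x
    using hom_dim[OF g x] hom_dim[OF h x] hom_dim[OF k(1) x] hom_dim[OF st(1) x] hom_dim[OF st(2) x]
    by (simp add: mat_mult_cong_left[OF k(2)[OF x]] mat_assoc st(3)[OF x] mat_one_right)
  then show ?thesis
    using hom_comp[OF st(1) k(1) mR mS m(1)] unfolding eq_mor_def comp_mor_def by blast
qed

lemma in_exact_class_splits:
  assumes X: "in_add r X L" and E: "in_exact_class r X M f N g L"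
  shows "isomorphic r N (dsum M L)"
proof -
  have S: "short_exact r M f N g L" using E unfolding in_exact_class_def by blast
  have m: "is_module r M" "is_module r N" "is_module r L" and g: "is_hom r N L g"
    using S unfolding short_exact_def is_kernel_def by auto
  have "\<exists>k. is_hom r L N k \<and> eq_mor r (comp_mor g k) (\<lambda>x. 1\<^sub>m (vdim L x))"
    by (rule lift_from_add[OF X m(2,3) g _ hom_id[OF m(3)]]) (use E in \<open>auto simp: in_exact_class_def\<close>)
  then obtain k where k: "is_hom r L N k" "\<And>x. x \<in> Field r \<Longrightarrow> g x * k x = 1\<^sub>m (vdim L x)"
    unfolding eq_mor_def comp_mor_def by blast
  obtain p where "biproduct r N M L f p k g"
    using short_exact_section_biproduct[OF S k] by blast
  from isomorphic_dsumI[OF this m(2,1,3)] show ?thesis .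
qed

lemma dsum_in_exact_class:
  fixes M L :: "('p, 'k::field) pmod"
  assumes m: "is_module r M" "is_module r L"
  shows "\<exists>f g. in_exact_class r X M f (dsum M L) g L"
proof -
  note D = module_dsum[OF m]
  obtain i p j q where b: "biproduct r (dsum M L) M L i p j q" using biproduct_dsum[OF m] by blast
  note h = biproduct_hom[OF b]
  have "is_kernel r M (dsum M L) i q"
    unfolding is_kernel_def mono_mor_def
  proof (intro conjI ballI h m)
    fix x assume x: "x \<in> Field r"
    note d = biproduct_dim[OF b x] and e = biproduct_eq[OF b x]
    have pi: "p x *\<^sub>v (i x *\<^sub>v v) = v" if "v \<in> carrier_vec (vdim M x)" for v
      using that d by (simp add: mult_mat_mat_vec[symmetric] e del: assoc_mult_mat_vec)
    show "inj_on (\<lambda>v. i x *\<^sub>v v) (carrier_vec (vdim M x))" by (rule inj_on_inverseI[where g = "\<lambda>v. p x *\<^sub>v v"]) (rule pi)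
    show "(\<lambda>v. i x *\<^sub>v v) ` carrier_vec (vdim M x) = mat_kernel (q x)"
    proof (intro equalityI subsetI)
      fix w assume "w \<in> (\<lambda>v. i x *\<^sub>v v) ` carrier_vec (vdim M x)"
      then obtain v where v: "w = i x *\<^sub>v v" "v \<in> carrier_vec (vdim M x)" by blast
      have "q x *\<^sub>v w = (q x * i x) *\<^sub>v v" using v d by (simp add: mult_mat_mat_vec)
      also have "\<dots> = 0\<^sub>v (vdim L x)"
        using v biproduct_orthogonal[OF biproduct_swap[OF b] x] by (simp add: scalar_prod_def) (auto intro!: eq_vecI simp: scalar_prod_def)
      finally show "w \<in> mat_kernel (q x)" using v d by (auto simp: mat_kernel_def intro!: carrier_vecI)
    next
      fix w assume "w \<in> mat_kernel (q x)"
      then have w: "w \<in> carrier_vec (vdim (dsum M L) x)" "q x *\<^sub>v w = 0\<^sub>v (vdim L x)"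
        using d by (auto simp: mat_kernel_def simp del: dsum_sel)
      have "w = (i x * p x + j x * q x) *\<^sub>v w" unfolding e using w by simp
      also have "\<dots> = (i x * p x) *\<^sub>v w + (j x * q x) *\<^sub>v w"
        by (rule add_mult_distrib_mat_vec[of _ "vdim (dsum M L) x" "vdim (dsum M L) x"])
          (use d w in \<open>auto intro!: carrier_matI simp del: dsum_sel\<close>)
      also have "\<dots> = i x *\<^sub>v (p x *\<^sub>v w) + j x *\<^sub>v (q x *\<^sub>v w)" using d w by (simp add: mult_mat_mat_vec del: dsum_sel)
      also have "j x *\<^sub>v (q x *\<^sub>v w) = 0\<^sub>v (vdim (dsum M L) x)"
        unfolding w(2) using d by (intro eq_vecI) (auto simp: scalar_prod_def simp del: dsum_sel)
      also have "i x *\<^sub>v (p x *\<^sub>v w) + 0\<^sub>v (vdim (dsum M L) x) = i x *\<^sub>v (p x *\<^sub>v w)"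
        using d by (intro right_zero_vec) (auto intro!: carrier_vecI simp del: dsum_sel)
      finally show "w \<in> (\<lambda>v. i x *\<^sub>v v) ` carrier_vec (vdim M x)"
        using d by (intro image_eqI[of _ _ "p x *\<^sub>v w"]) (auto intro!: carrier_vecI)
    qed
  qed
  moreover have "epi_mor r (dsum M L) L q"
    unfolding epi_mor_def
  proof (intro ballI equalityI subsetI)
    fix x v assume x: "x \<in> Field r" and v: "v \<in> (\<lambda>v. q x *\<^sub>v v) ` carrier_vec (vdim (dsum M L) x)"
    then show "v \<in> carrier_vec (vdim L x)" using biproduct_dim[OF b x] by (auto intro!: carrier_vecI)
  next
    fix x and v :: "'k vec" assume x: "x \<in> Field r" and v: "v \<in> carrier_vec (vdim L x)"
    note d = biproduct_dim[OF b x] and e = biproduct_eq[OF b x]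
    have "v = q x *\<^sub>v (j x *\<^sub>v v)"
      using v d by (simp add: mult_mat_mat_vec[symmetric] e del: assoc_mult_mat_vec)
    then show "v \<in> (\<lambda>v. q x *\<^sub>v v) ` carrier_vec (vdim (dsum M L) x)"
      using d by (intro image_eqI[of _ _ "j x *\<^sub>v v"]) (auto intro!: carrier_vecI)
  qed
  moreover have "\<exists>k. is_hom r R (dsum M L) k \<and> eq_mor r (comp_mor q k) s"
    if R: "is_module r R" and s: "is_hom r R L s" for R s
  proof -
    have "q x * (j x * s x) = s x" if x: "x \<in> Field r" for x
      using biproduct_dim[OF b x] hom_dim[OF s x]
      by (simp add: mat_mult_cong_left[OF biproduct_eq(2)[OF b x]] mat_one_left)
    then show ?thesis
      using hom_comp[OF s h(3) R m(2) D] unfolding eq_mor_def comp_mor_def by blast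
  qed
  ultimately have "in_exact_class r X M i (dsum M L) q L"
    unfolding in_exact_class_def short_exact_def using D m h by blast
  then show ?thesis by blast
qed

section \<open>Grothendieck groups\<close>

lemma carrier_free_on_classes: "c \<in> carrier (free_on_classes r) \<longleftrightarrow> Poly_Mapping.keys c \<subseteq> iso_classes r"
  by (simp add: free_on_classes_def)

lemma iso_class_in_iso_classes: "is_module r M \<Longrightarrow> iso_class r M \<in> iso_classes r"
  unfolding iso_classes_def by blast

lemma keys_frag_subset_add: "Poly_Mapping.keys a \<subseteq> S \<Longrightarrow> Poly_Mapping.keys b \<subseteq> S \<Longrightarrow> Poly_Mapping.keys (a + b) \<subseteq> S"
  using keys_add[of a b] by blast

lemma keys_frag_subset_diff:
  "Poly_Mapping.keys a \<subseteq> S \<Longrightarrow> Poly_Mapping.keys b \<subseteq> S \<Longrightarrow> Poly_Mapping.keys (a - b) \<subseteq> S"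
  for a b :: "'a \<Rightarrow>\<^sub>0 int"
  using keys_diff[of a b] by blast

lemma subgroup_generate_free_on_classes:
  assumes "\<And>c. c \<in> S \<Longrightarrow> Poly_Mapping.keys c \<subseteq> iso_classes r"
  shows "subgroup (generate (free_on_classes r) S) (free_on_classes r)"
proof -
  interpret group "free_on_classes r" by (simp add: free_on_classes_def)
  show ?thesis using assms by (intro generate_is_subgroup) (auto simp: carrier_free_on_classes)
qed

lemma split_relation_keys:
  assumes "is_module r M" "is_module r N"
  shows "Poly_Mapping.keys (frag_of (iso_class r (dsum M N)) - (frag_of (iso_class r M) + frag_of (iso_class r N)))
    \<subseteq> iso_classes r"
  using assms iso_class_in_iso_classes module_dsum[OF assms]
  by (intro keys_frag_subset_diff keys_frag_subset_add) (auto simp: keys_frag_of)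

lemma subgroup_split_relations: "subgroup (split_relations r) (free_on_classes r)"
  unfolding split_relations_def
  by (rule subgroup_generate_free_on_classes) (use split_relation_keys in blast)

lemma normal_split_relations: "split_relations r \<lhd> free_on_classes r"
proof -
  interpret comm_group "free_on_classes r" unfolding free_on_classes_def by (rule abelian_free_Abelian_group)
  show ?thesis by (rule subgroup_imp_normal[OF subgroup_split_relations])
qed

lemma split_relationsD:
  shows "c \<in> split_relations r \<Longrightarrow> Poly_Mapping.keys c \<subseteq> iso_classes r"
    "0 \<in> split_relations r"
    "c \<in> split_relations r \<Longrightarrow> d \<in> split_relations r \<Longrightarrow> c + d \<in> split_relations r"
    "c \<in> split_relations r \<Longrightarrow> - c \<in> split_relations r"
    "c \<in> split_relations r \<Longrightarrow> d \<in> split_relations r \<Longrightarrow> c - d \<in> split_relations r"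
    "is_module r M \<Longrightarrow> is_module r N \<Longrightarrow>
      frag_of (iso_class r (dsum M N)) - (frag_of (iso_class r M) + frag_of (iso_class r N)) \<in> split_relations r"
proof -
  note S = subgroup_split_relations[of r]
  show k: "Poly_Mapping.keys c \<subseteq> iso_classes r" if "c \<in> split_relations r" for c
    using subgroup.mem_carrier[OF S that] by (simp add: carrier_free_on_classes)
  show "0 \<in> split_relations r"
    using subgroup.one_closed[OF S] by (simp add: free_on_classes_def)
  show add: "c + d \<in> split_relations r" if "c \<in> split_relations r" "d \<in> split_relations r" for c d
    using subgroup.m_closed[OF S that] by (simp add: free_on_classes_def)
  show min: "- c \<in> split_relations r" if "c \<in> split_relations r" for c
    using subgroup.m_inv_closed[OF S that] k[OF that] by (simp add: free_on_classes_def)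
  show "c - d \<in> split_relations r" if "c \<in> split_relations r" "d \<in> split_relations r" for c d
    using add[OF that(1) min[OF that(2)]] by simp
  show "frag_of (iso_class r (dsum M N)) - (frag_of (iso_class r M) + frag_of (iso_class r N)) \<in> split_relations r"
    if "is_module r M" "is_module r N" for M N
    unfolding split_relations_def by (rule generate.incl) (use that in blast)
qed

text \<open>Sequences in the exact structure split and all split sequences belong to it, so both
  generating sets agree up to sign.\<close>

lemma exact_relations_eq_split_relations:
  fixes X :: "('p, 'k::field) pmod set set"
  assumes X: "\<And>M :: ('p, 'k) pmod. is_module r M \<Longrightarrow> in_add r X M"
  shows "exact_relations r X = split_relations r"
proof -
  interpret G: group "free_on_classes r :: (('p, 'k) pmod set \<Rightarrow>\<^sub>0 int) monoid"
    by (simp add: free_on_classes_def)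
  let ?E = "{frag_of (iso_class r M) - frag_of (iso_class r N) + frag_of (iso_class r L)
        | (M :: ('p, 'k) pmod) f N g L. in_exact_class r X M f N g L}"
  let ?S = "{frag_of (iso_class r (dsum M N)) - (frag_of (iso_class r M) + frag_of (iso_class r N))
        | M N :: ('p, 'k) pmod. is_module r M \<and> is_module r N}"
  have ES: "- c \<in> ?S" if "c \<in> ?E" for c
  proof -
    from that obtain M f N g L where
      c: "c = frag_of (iso_class r M) - frag_of (iso_class r N) + frag_of (iso_class r L)"
      and E: "in_exact_class r X (M :: ('p, 'k) pmod) f N g L" by blast
    have m: "is_module r M" "is_module r N" "is_module r L"
      using E unfolding in_exact_class_def short_exact_def is_kernel_def by auto
    have "iso_class r N = iso_class r (dsum M L)"
      using in_exact_class_splits[OF X[OF m(3)] E] iso_class_eq_iff[OF m(2) module_dsum[OF m(1,3)]] by blast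
    then have "- c = frag_of (iso_class r (dsum M L)) - (frag_of (iso_class r M) + frag_of (iso_class r L))"
      unfolding c by (simp add: algebra_simps)
    then show ?thesis using m by blast
  qed
  have SE: "- c \<in> ?E" if "c \<in> ?S" for c
  proof -
    from that obtain M N :: "('p, 'k) pmod" where
      c: "c = frag_of (iso_class r (dsum M N)) - (frag_of (iso_class r M) + frag_of (iso_class r N))"
      and m: "is_module r M" "is_module r N" by blast
    obtain f g where E: "in_exact_class r X M f (dsum M N) g N" using dsum_in_exact_class[OF m] by blast
    have "- c = frag_of (iso_class r M) - frag_of (iso_class r (dsum M N)) + frag_of (iso_class r N)"
      unfolding c by (simp add: algebra_simps)
    then show ?thesis using E by blast
  qed
  have gen: "exact_relations r X = generate (free_on_classes r) ?E"
    "split_relations r = generate (free_on_classes r) ?S"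
    unfolding exact_relations_def split_relations_def by (rule refl)+
  have "?E \<subseteq> split_relations r"
  proof
    fix c assume "c \<in> ?E"
    then have "- c \<in> split_relations r" unfolding gen by (intro generate.incl ES)
    then have "- (- c) \<in> split_relations r" by (rule split_relationsD(4))
    then show "c \<in> split_relations r" by simp
  qed
  then have 1: "exact_relations r X \<subseteq> split_relations r"
    unfolding gen(1) by (rule G.generate_subgroup_incl[OF _ subgroup_split_relations])
  have keys_E: "Poly_Mapping.keys c \<subseteq> iso_classes r" if "c \<in> ?E" for c
    using 1 that split_relationsD(1) unfolding gen(1) by (blast intro: generate.incl)
  then have sE: "subgroup (exact_relations r X) (free_on_classes r)"
    unfolding gen(1) by (rule subgroup_generate_free_on_classes)
  have "?S \<subseteq> exact_relations r X"
  proof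
    fix c assume c: "c \<in> ?S"
    have m: "- c \<in> exact_relations r X" unfolding gen by (intro generate.incl SE c)
    have "Poly_Mapping.keys (- c) \<subseteq> iso_classes r" using keys_E SE[OF c] by blast
    then have "inv\<^bsub>free_on_classes r\<^esub> (- c) = c" by (simp add: free_on_classes_def)
    then show "c \<in> exact_relations r X" using subgroup.m_inv_closed[OF sE m] by simp
  qed
  then have "split_relations r \<subseteq> exact_relations r X"
    unfolding gen(2) by (rule G.generate_subgroup_incl[OF _ sE])
  with 1 show ?thesis by blast
qed

section \<open>Multiplicity vectors\<close>

definition interval_vector :: "nat set list \<Rightarrow> nat set \<Rightarrow>\<^sub>0 int" where
  "interval_vector Is = sum_list (map frag_of Is)"

lemma interval_vector_simps [simp]:
  "interval_vector [] = 0" "interval_vector (I # Is) = frag_of I + interval_vector Is"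
  "interval_vector (Is @ Js) = interval_vector Is + interval_vector Js"
  by (simp_all add: interval_vector_def)

lemma interval_vector_cong: "mset Is = mset Js \<Longrightarrow> interval_vector Is = interval_vector Js"
  unfolding interval_vector_def by (metis mset_map sum_mset_sum_list)

lemma keys_interval_vector: "set Is \<subseteq> S \<Longrightarrow> Poly_Mapping.keys (interval_vector Is) \<subseteq> S"
proof (induction Is)
  case (Cons I Is)
  then show ?case
    using keys_frag_subset_add[of "frag_of I" S "interval_vector Is"] by (simp add: keys_frag_of)
qed simp

text \<open>The choice of the decomposition is immaterial by interval_decomposition_unique.\<close>

definition class_vector :: "nat \<Rightarrow> nat rel \<Rightarrow> (nat, 'k::field) pmod set \<Rightarrow> nat set \<Rightarrow>\<^sub>0 int" where
  "class_vector n r C = interval_vector (SOME Is. set Is \<subseteq> closed_intervals n \<and>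
     (\<exists>M\<in>C. is_module r M \<and> isomorphic r M (interval_sum Is)))"

lemma class_vector_eq:
  fixes M :: "(nat, 'k::field) pmod"
  assumes r: "type_A_poset n r" and M: "is_module r M"
    and Is: "set Is \<subseteq> closed_intervals n" "isomorphic r M (interval_sum Is)"
  shows "class_vector n r (iso_class r M) = interval_vector Is"
proof -
  let ?P = "\<lambda>Is. set Is \<subseteq> closed_intervals n \<and>
     (\<exists>N\<in>iso_class r M. is_module r N \<and> isomorphic r N (interval_sum Is))"
  have "M \<in> iso_class r M" using M isomorphic_refl[OF M] unfolding iso_class_def by blast
  then have "?P Is" using M Is by blast
  then have "?P (SOME Is. ?P Is)" by (rule someI)
  then obtain N where Js: "set (SOME Is. ?P Is) \<subseteq> closed_intervals n" and N: "N \<in> iso_class r M"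
    "isomorphic r N (interval_sum (SOME Is. ?P Is))" by blast
  have N': "is_module r N" "isomorphic r M N" using N unfolding iso_class_def by auto
  note m = module_interval_sum[OF r Is(1)] module_interval_sum[OF r Js]
  have "isomorphic r (interval_sum Is) (interval_sum (SOME Is. ?P Is) :: (nat, 'k) pmod)"
    using isomorphic_trans[OF isomorphic_trans[OF isomorphic_sym[OF Is(2)] N'(2) m(1) M N'(1)] N(2) m(1) N'(1) m(2)] .
  then have "mset Is = mset (SOME Is. ?P Is)" by (rule interval_decomposition_unique[OF r Is(1) Js])
  then show ?thesis unfolding class_vector_def by (rule interval_vector_cong[symmetric])
qed

lemma class_vector_interval:
  assumes r: "type_A_poset n r" and I: "I \<in> closed_intervals n"
  shows "class_vector n r (iso_class r (interval_module I :: (nat, 'k::field) pmod)) = frag_of I"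
  using class_vector_eq[OF r module_interval[OF r I] _ isomorphic_interval_sum_singleton[OF r I]] I by simp

lemma class_vector_dsum:
  fixes M N :: "(nat, 'k::field) pmod"
  assumes r: "type_A_poset n r" and M: "is_module r M" and N: "is_module r N"
  shows "class_vector n r (iso_class r (dsum M N)) = class_vector n r (iso_class r M) + class_vector n r (iso_class r N)"
proof -
  obtain Is where Is: "set Is \<subseteq> closed_intervals n" "isomorphic r M (interval_sum Is)"
    using interval_decomposition[OF r M] by blast
  obtain Js where Js: "set Js \<subseteq> closed_intervals n" "isomorphic r N (interval_sum Js)"
    using interval_decomposition[OF r N] by blast
  have "set (Is @ Js) \<subseteq> closed_intervals n" using Is Js by auto
  from class_vector_eq[OF r module_dsum[OF M N] this isomorphic_interval_sum_append[OF r M N Is Js]]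
  show ?thesis by (simp add: class_vector_eq[OF r M Is] class_vector_eq[OF r N Js])
qed

lemma keys_class_vector:
  assumes r: "type_A_poset n r" and C: "C \<in> iso_classes r"
  shows "Poly_Mapping.keys (class_vector n r (C :: (nat, 'k::field) pmod set)) \<subseteq> closed_intervals n"
proof -
  obtain M where M: "is_module r M" "C = iso_class r M" using C unfolding iso_classes_def by blast
  obtain Is where Is: "set Is \<subseteq> closed_intervals n" "isomorphic r M (interval_sum Is)"
    using interval_decomposition[OF r M(1)] by blast
  show ?thesis unfolding M(2) class_vector_eq[OF r M(1) Is] by (rule keys_interval_vector[OF Is(1)])
qed

abbreviation vector_map :: "nat \<Rightarrow> nat rel \<Rightarrow> ((nat, 'k::field) pmod set \<Rightarrow>\<^sub>0 int) \<Rightarrow> nat set \<Rightarrow>\<^sub>0 int" where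
  "vector_map n r \<equiv> frag_extend (class_vector n r)"

abbreviation interval_class_map :: "nat rel \<Rightarrow> (nat set \<Rightarrow>\<^sub>0 int) \<Rightarrow> (nat, 'k::field) pmod set \<Rightarrow>\<^sub>0 int" where
  "interval_class_map r \<equiv> frag_extend (\<lambda>I. frag_of (iso_class r (interval_module I)))"

lemma keys_vector_map:
  assumes "type_A_poset n r" "Poly_Mapping.keys c \<subseteq> iso_classes r"
  shows "Poly_Mapping.keys (vector_map n r (c :: (nat, 'k::field) pmod set \<Rightarrow>\<^sub>0 int)) \<subseteq> closed_intervals n"
  using keys_frag_extend[of "class_vector n r" c] keys_class_vector[OF assms(1)] assms(2) by blast

lemma keys_interval_class_map:
  assumes r: "type_A_poset n r" and d: "Poly_Mapping.keys d \<subseteq> closed_intervals n"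
  shows "Poly_Mapping.keys (interval_class_map r d :: (nat, 'k::field) pmod set \<Rightarrow>\<^sub>0 int) \<subseteq> iso_classes r"
proof -
  have "iso_class r (interval_module I :: (nat, 'k) pmod) \<in> iso_classes r" if "I \<in> Poly_Mapping.keys d" for I
    using that d module_interval[OF r] by (intro iso_class_in_iso_classes) auto
  then show ?thesis
    using keys_frag_extend[of "\<lambda>I. frag_of (iso_class r (interval_module I :: (nat, 'k) pmod))" d]
    by (fastforce simp: keys_frag_of)
qed

lemma vector_map_interval_class_map:
  assumes r: "type_A_poset n r" and "Poly_Mapping.keys d \<subseteq> closed_intervals n"
  shows "vector_map n r (interval_class_map r d :: (nat, 'k::field) pmod set \<Rightarrow>\<^sub>0 int) = d"
  using assms(2)
  by (rule free_Abelian_group_induct) (auto simp: frag_extend_diff class_vector_interval[OF r])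

lemma vector_map_split_relations:
  fixes c :: "(nat, 'k::field) pmod set \<Rightarrow>\<^sub>0 int"
  assumes r: "type_A_poset n r" and "c \<in> split_relations r"
  shows "vector_map n r c = 0"
proof -
  let ?S = "{frag_of (iso_class r (dsum M N)) - (frag_of (iso_class r M) + frag_of (iso_class r N))
        | M N :: (nat, 'k) pmod. is_module r M \<and> is_module r N}"
  have S: "vector_map n r c = 0 \<and> Poly_Mapping.keys c \<subseteq> iso_classes r" if "c \<in> ?S" for c
    using that split_relation_keys class_vector_dsum[OF r]
    by (fastforce simp: frag_extend_diff frag_extend_add)
  have "c \<in> generate (free_on_classes r) ?S" using assms(2) unfolding split_relations_def .
  then show ?thesis
  proof induction
    case (inv h)
    then show ?case using S[OF inv] by (simp add: free_on_classes_def frag_extend_minus)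
  qed (use S in \<open>auto simp: free_on_classes_def frag_extend_add\<close>)
qed

text \<open>One split relation separates each summand of an interval decomposition. The class of the zero
  module that remains is, up to sign, the relation of the sum of two zero modules.\<close>

lemma interval_class_map_vector_map:
  fixes c :: "(nat, 'k::field) pmod set \<Rightarrow>\<^sub>0 int"
  assumes r: "type_A_poset n r" and c: "Poly_Mapping.keys c \<subseteq> iso_classes r"
  shows "c - interval_class_map r (vector_map n r c) \<in> split_relations r"
  using c
proof (rule free_Abelian_group_induct)
  fix x y :: "(nat, 'k) pmod set \<Rightarrow>\<^sub>0 int"
  assume "x - interval_class_map r (vector_map n r x) \<in> split_relations r"
    "y - interval_class_map r (vector_map n r y) \<in> split_relations r"
  from split_relationsD(5)[OF this]
  show "x - y - interval_class_map r (vector_map n r (x - y)) \<in> split_relations r"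
    by (simp add: frag_extend_diff algebra_simps)
next
  fix C :: "(nat, 'k) pmod set" assume "C \<in> iso_classes r"
  then obtain M :: "(nat, 'k) pmod" where M: "is_module r M" "C = iso_class r M" unfolding iso_classes_def by blast
  obtain Is where Is: "set Is \<subseteq> closed_intervals n" "isomorphic r M (interval_sum Is)"
    using interval_decomposition[OF r M(1)] by blast
  have "frag_of (iso_class r (interval_sum Is :: (nat, 'k) pmod)) - interval_class_map r (interval_vector Is)
      \<in> split_relations r"
    using Is(1)
  proof (induction Is)
    case Nil
    have "iso_class r (dsum zero_module zero_module) = iso_class r (zero_module :: (nat, 'k) pmod)"
      using dsum_zero_left[OF module_zero module_zero is_zero_zero_module]
        iso_class_eq_iff[OF module_zero module_dsum[OF module_zero module_zero]] by metis
    moreover have "frag_of (iso_class r (dsum zero_module zero_module)) -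
        (frag_of (iso_class r zero_module) + frag_of (iso_class r (zero_module :: (nat, 'k) pmod)))
        \<in> split_relations r"
      by (intro split_relationsD(6) module_zero)
    ultimately show ?case using split_relationsD(4) by fastforce
  next
    case (Cons I Is)
    have m: "is_module r (interval_module I :: (nat, 'k) pmod)" "is_module r (interval_sum Is :: (nat, 'k) pmod)"
      using Cons.prems by (auto intro!: module_interval[OF r] module_interval_sum[OF r])
    from Cons split_relationsD(3)[OF split_relationsD(6)[OF m]]
    show ?case by (fastforce simp: frag_extend_add algebra_simps)
  qed
  moreover have "C = iso_class r (interval_sum Is)"
    unfolding M(2) using Is iso_class_eq_iff[OF M(1) module_interval_sum[OF r Is(1)]] by blast
  moreover have "vector_map n r (frag_of C) = interval_vector Is"
    unfolding M(2) frag_extend_of by (rule class_vector_eq[OF r M(1) Is])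
  ultimately show "frag_of C - interval_class_map r (vector_map n r (frag_of C)) \<in> split_relations r"
    by (simp only:)
qed (simp add: split_relationsD(2))

section \<open>The barcode is an isomorphism\<close>

lemma vector_map_hom:
  assumes r: "type_A_poset n r"
  shows "group_hom (free_on_classes r) (interval_group n)
    (vector_map n r :: ((nat, 'k::field) pmod set \<Rightarrow>\<^sub>0 int) \<Rightarrow> _)"
  unfolding group_hom_def group_hom_axioms_def
  by (auto simp: free_on_classes_def interval_group_def hom_def frag_extend_add
      dest!: subsetD[OF keys_vector_map[OF r]])

lemma kernel_vector_map:
  assumes r: "type_A_poset n r"
  shows "Coset.kernel (free_on_classes r) (interval_group n)
    (vector_map n r :: ((nat, 'k::field) pmod set \<Rightarrow>\<^sub>0 int) \<Rightarrow> _) = split_relations r"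
proof (intro equalityI subsetI)
  fix c :: "(nat, 'k) pmod set \<Rightarrow>\<^sub>0 int"
  assume "c \<in> Coset.kernel (free_on_classes r) (interval_group n) (vector_map n r)"
  then have "Poly_Mapping.keys c \<subseteq> iso_classes r" "vector_map n r c = 0"
    by (auto simp: Coset.kernel_def free_on_classes_def interval_group_def)
  then show "c \<in> split_relations r" using interval_class_map_vector_map[OF r, of c] by simp
next
  fix c :: "(nat, 'k) pmod set \<Rightarrow>\<^sub>0 int"
  assume c: "c \<in> split_relations r"
  then show "c \<in> Coset.kernel (free_on_classes r) (interval_group n) (vector_map n r)"
    using split_relationsD(1)[OF c] vector_map_split_relations[OF r c]
    by (simp add: Coset.kernel_def carrier_free_on_classes) (simp add: interval_group_def)
qed

lemma vector_map_surj:
  assumes r: "type_A_poset n r"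
  shows "(vector_map n r :: ((nat, 'k::field) pmod set \<Rightarrow>\<^sub>0 int) \<Rightarrow> _) ` carrier (free_on_classes r)
    = carrier (interval_group n)"
proof (intro equalityI subsetI)
  fix d assume "d \<in> carrier (interval_group n)"
  then have d: "Poly_Mapping.keys d \<subseteq> closed_intervals n" by (simp add: interval_group_def)
  show "d \<in> (vector_map n r :: ((nat, 'k) pmod set \<Rightarrow>\<^sub>0 int) \<Rightarrow> _) ` carrier (free_on_classes r)"
    by (rule image_eqI[where x = "interval_class_map r d"])
      (simp_all add: carrier_free_on_classes keys_interval_class_map[OF r d] vector_map_interval_class_map[OF r d])
qed (auto simp: carrier_free_on_classes interval_group_def dest!: subsetD[OF keys_vector_map[OF r]])

text \<open>The map induced by vector_map on the quotient by the split relations, which are its kernel. It is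
  restricted to the carrier to meet the extensionality in the definition of barcode.\<close>

definition split_barcode :: "nat \<Rightarrow> nat rel \<Rightarrow> ((nat, 'k::field) pmod set \<Rightarrow>\<^sub>0 int) set \<Rightarrow> nat set \<Rightarrow>\<^sub>0 int" where
  "split_barcode n r = restrict (\<lambda>C. the_elem (vector_map n r ` C)) (carrier (K0_split r))"

lemma carrier_K0_split:
  "carrier (K0_split r) = (\<lambda>c. split_relations r #>\<^bsub>free_on_classes r\<^esub> c) ` {c. Poly_Mapping.keys c \<subseteq> iso_classes r}"
  unfolding K0_split_def carrier_FactGroup by (auto simp: carrier_free_on_classes)

lemma group_K0_split: "group (K0_split r)"
  unfolding K0_split_def by (rule normal.factorgroup_is_group[OF normal_split_relations])

lemma restrict_iso:
  assumes h: "h \<in> iso G H" and G: "group G"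
  shows "restrict h (carrier G) \<in> iso G H"
proof -
  have "restrict h (carrier G) \<in> hom G H"
    using h group.is_monoid[OF G] by (auto simp: iso_iff hom_def monoid.m_closed)
  moreover have "inj_on (restrict h (carrier G)) (carrier G)"
    using h by (simp add: iso_iff inj_on_def)
  ultimately show ?thesis using h by (auto simp: iso_iff)
qed

lemma split_barcode_iso:
  assumes r: "type_A_poset n r"
  shows "(split_barcode n r :: ((nat, 'k::field) pmod set \<Rightarrow>\<^sub>0 int) set \<Rightarrow> _) \<in> iso (K0_split r) (interval_group n)"
proof -
  have "(\<lambda>C. the_elem (vector_map n r ` C)) \<in> iso (K0_split r :: ((nat, 'k) pmod set \<Rightarrow>\<^sub>0 int) set monoid) (interval_group n)"
    using group_hom.FactGroup_iso_set[OF vector_map_hom[OF r] vector_map_surj[OF r]]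
    unfolding K0_split_def kernel_vector_map[OF r] .
  then show ?thesis
    unfolding split_barcode_def using group_K0_split by (rule restrict_iso)
qed

lemma split_barcode_coset:
  fixes c :: "(nat, 'k::field) pmod set \<Rightarrow>\<^sub>0 int"
  assumes r: "type_A_poset n r" and c: "Poly_Mapping.keys c \<subseteq> iso_classes r"
  shows "split_barcode n r (split_relations r #>\<^bsub>free_on_classes r\<^esub> c) = vector_map n r c"
proof -
  have "vector_map n r ` (split_relations r #>\<^bsub>free_on_classes r\<^esub> c) = {vector_map n r c}"
    using vector_map_split_relations[OF r] split_relationsD(2)[of r]
    by (auto simp: r_coset_def free_on_classes_def frag_extend_add image_iff)
  then show ?thesis
    unfolding split_barcode_def using c by (auto simp: carrier_K0_split)
qed

lemma coset_eq_if_diff: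
  fixes c d :: "('p, 'k::field) pmod set \<Rightarrow>\<^sub>0 int"
  assumes d: "Poly_Mapping.keys d \<subseteq> iso_classes r" and cd: "c - d \<in> split_relations r"
  shows "split_relations r #>\<^bsub>free_on_classes r\<^esub> c = split_relations r #>\<^bsub>free_on_classes r\<^esub> d"
proof -
  interpret group "free_on_classes r :: (('p, 'k) pmod set \<Rightarrow>\<^sub>0 int) monoid" by (simp add: free_on_classes_def)
  have "c \<in> split_relations r #>\<^bsub>free_on_classes r\<^esub> d"
    using cd unfolding r_coset_def by (force simp: free_on_classes_def)
  then show ?thesis
    using repr_independence[OF _ _ subgroup_split_relations] d by (simp add: carrier_free_on_classes)
qed

text \<open>The classes of interval modules generate the split Grothendieck group, so their images
  determine a homomorphism.\<close>

lemma barcode_eq_split_barcode: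
  assumes r: "type_A_poset n r"
  shows "(barcode n r :: ((nat, 'k::field) pmod set \<Rightarrow>\<^sub>0 int) set \<Rightarrow> _) = split_barcode n r"
  unfolding barcode_def
proof (rule the_equality, intro conjI ballI)
  show "(split_barcode n r :: ((nat, 'k) pmod set \<Rightarrow>\<^sub>0 int) set \<Rightarrow> _) \<in> iso (K0_split r) (interval_group n)"
    by (rule split_barcode_iso[OF r])
  show "(split_barcode n r :: ((nat, 'k) pmod set \<Rightarrow>\<^sub>0 int) set \<Rightarrow> _) \<in> extensional (carrier (K0_split r))"
    unfolding split_barcode_def by simp
  fix I assume I: "I \<in> closed_intervals n"
  show "split_barcode n r (split_class r (interval_module I :: (nat, 'k) pmod)) = frag_of I"
    unfolding split_class_def
    using split_barcode_coset[OF r, of "frag_of (iso_class r (interval_module I :: (nat, 'k) pmod))"]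
      iso_class_in_iso_classes[OF module_interval[OF r I]]
    by (simp add: keys_frag_of class_vector_interval[OF r I])
next
  fix h :: "((nat, 'k) pmod set \<Rightarrow>\<^sub>0 int) set \<Rightarrow> (nat set \<Rightarrow>\<^sub>0 int)"
  assume h: "h \<in> iso (K0_split r) (interval_group n) \<and> h \<in> extensional (carrier (K0_split r)) \<and>
             (\<forall>I\<in>closed_intervals n. h (split_class r (interval_module I)) = frag_of I)"
  let ?G = "free_on_classes r :: ((nat, 'k) pmod set \<Rightarrow>\<^sub>0 int) monoid"
  let ?H = "split_relations r :: ((nat, 'k) pmod set \<Rightarrow>\<^sub>0 int) set"
  have "h \<in> hom (?G Mod ?H) (interval_group n)" using h unfolding iso_def K0_split_def by auto
  from hom_compose[OF normal.r_coset_hom_Mod[OF normal_split_relations] this]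
  have hc: "(\<lambda>c. h (?H #>\<^bsub>?G\<^esub> c)) \<in> hom (free_Abelian_group (iso_classes r)) (free_Abelian_group (closed_intervals n))"
    by (simp add: comp_def free_on_classes_def interval_group_def)
  have val: "h (?H #>\<^bsub>?G\<^esub> interval_class_map r d) = d" if "Poly_Mapping.keys d \<subseteq> closed_intervals n" for d
    using that
  proof (rule free_Abelian_group_induct)
    show "h (?H #>\<^bsub>?G\<^esub> interval_class_map r 0) = 0"
      using hom_frag_diff[OF hc, of 0 0] by simp
    fix x y
    assume k: "Poly_Mapping.keys x \<subseteq> closed_intervals n" "Poly_Mapping.keys y \<subseteq> closed_intervals n"
      and "h (?H #>\<^bsub>?G\<^esub> interval_class_map r x) = x" "h (?H #>\<^bsub>?G\<^esub> interval_class_map r y) = y"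
    then show "h (?H #>\<^bsub>?G\<^esub> interval_class_map r (x - y)) = x - y"
      using hom_frag_diff[OF hc keys_interval_class_map[OF r k(1)] keys_interval_class_map[OF r k(2)]]
      by (simp add: frag_extend_diff)
  qed (use h in \<open>simp add: split_class_def\<close>)
  show "h = split_barcode n r"
  proof (rule extensionalityI)
    show "h \<in> extensional (carrier (K0_split r))" using h by blast
    show "(split_barcode n r :: ((nat, 'k) pmod set \<Rightarrow>\<^sub>0 int) set \<Rightarrow> _) \<in> extensional (carrier (K0_split r))"
      unfolding split_barcode_def by simp
    fix C :: "((nat, 'k) pmod set \<Rightarrow>\<^sub>0 int) set" assume "C \<in> carrier (K0_split r)"
    then obtain c where c: "Poly_Mapping.keys c \<subseteq> iso_classes r" "C = ?H #>\<^bsub>?G\<^esub> c"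
      unfolding carrier_K0_split by blast
    note kv = keys_vector_map[OF r c(1)]
    have "C = ?H #>\<^bsub>?G\<^esub> interval_class_map r (vector_map n r c)"
      unfolding c(2)
      by (rule coset_eq_if_diff[OF keys_interval_class_map[OF r kv] interval_class_map_vector_map[OF r c(1)]])
    then have "h C = vector_map n r c" using val[OF kv] by simp
    then show "h C = split_barcode n r C" unfolding c(2) split_barcode_coset[OF r c(1)] .
  qed
qed

lemma free_Abelian_group_iso_Z_pow:
  assumes "finite S"
  shows "free_Abelian_group S \<cong> Z_pow (card S)"
proof -
  let ?I = "{..<card S}"
  have "S \<approx> ?I" using assms by (simp add: eqpoll_iff_card)
  then have 1: "free_Abelian_group S \<cong> free_Abelian_group ?I" using isomorphic_free_Abelian_groups by blast
  have g: "group (sum_group ?I (\<lambda>_. integer_group))" "group (product_group ?I (\<lambda>_. integer_group))" by simp_all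
  have 2: "free_Abelian_group ?I \<cong> sum_group ?I (\<lambda>_. integer_group)"
    using group.iso_sym[OF g(1) isomorphic_sum_integer_group] .
  have "{x \<in> \<Pi>\<^sub>E i\<in>?I. carrier integer_group. finite {i \<in> ?I. x i \<noteq> \<one>\<^bsub>integer_group\<^esub>}}
      = carrier (product_group ?I (\<lambda>_. integer_group))" by simp
  then have "sum_group ?I (\<lambda>_. integer_group) = Z_pow (card S)"
    unfolding sum_group_def by (simp only: group.subgroup_generated_group_carrier[OF g(2)])
  with iso_trans[OF 1 2] show ?thesis by simp
qed

lemma quotient_map_split:
  assumes eq: "exact_relations r X = split_relations r" and C: "C \<in> carrier (K0_split r)"
  shows "quotient_map r X C = C"
proof -
  obtain c where c: "Poly_Mapping.keys c \<subseteq> iso_classes r" "C = split_relations r #>\<^bsub>free_on_classes r\<^esub> c"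
    using C unfolding carrier_K0_split by blast
  have "split_relations r #>\<^bsub>free_on_classes r\<^esub> d = C" if "d \<in> C" for d
  proof -
    have "d - c \<in> split_relations r" using that unfolding c(2) r_coset_def by (auto simp: free_on_classes_def)
    then show ?thesis unfolding c(2) by (rule coset_eq_if_diff[OF c(1)])
  qed
  moreover have "c \<in> C"
    using split_relationsD(2)[of r] unfolding c(2) r_coset_def by (force simp: free_on_classes_def)
  ultimately have "(\<lambda>c. split_relations r #>\<^bsub>free_on_classes r\<^esub> c) ` C = {C}" by auto
  then show ?thesis unfolding quotient_map_def eq by simp
qed

theorem proposition7p1:
  fixes n :: nat and r :: "nat rel"
  assumes "1 \<le> n" and "type_A_poset n r"
  shows "homological_invariant r (interval_group n)
    (barcode n r :: ((nat, 'k::field) pmod set \<Rightarrow>\<^sub>0 int) set \<Rightarrow> (nat set \<Rightarrow>\<^sub>0 int))"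
proof -
  note r = assms(2)
  \<comment> \<open>all indecomposables are taken as relative projectives, so that relative exactness means splitting\<close>
  let ?X = "interval_classes n r :: (nat, 'k) pmod set set"
  let ?K = "K0_split r :: ((nat, 'k) pmod set \<Rightarrow>\<^sub>0 int) set monoid"
  have X: "in_add r ?X M" if "is_module r M" for M :: "(nat, 'k) pmod"
    by (rule in_add_interval_classes[OF r that])
  have card_X: "card ?X = card (closed_intervals n)"
    unfolding interval_classes_def by (rule card_image[OF inj_on_interval_class[OF r]])
  have eq: "exact_relations r ?X = split_relations r" by (rule exact_relations_eq_split_relations[OF X])
  have K: "K0_rel r ?X = ?K" unfolding K0_rel_def K0_split_def eq ..
  have gK: "group ?K" by (rule group_K0_split)
  have iso: "(barcode n r :: ((nat, 'k) pmod set \<Rightarrow>\<^sub>0 int) set \<Rightarrow> _) \<in> iso ?K (interval_group n)"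
    unfolding barcode_eq_split_barcode[OF r] by (rule split_barcode_iso[OF r])
  have F: "interval_group n \<cong> Z_pow (card (closed_intervals n))"
    unfolding interval_group_def by (rule free_Abelian_group_iso_Z_pow[OF finite_closed_intervals])
  have KZ: "?K \<cong> Z_pow (card (closed_intervals n))"
    using iso F iso_trans unfolding is_iso_def by blast
  have gF: "group (interval_group n)" by (simp add: interval_group_def)
  have inv_b: "is_invariant r (interval_group n) (barcode n r :: ((nat, 'k) pmod set \<Rightarrow>\<^sub>0 int) set \<Rightarrow> _)"
    unfolding is_invariant_def using gF F iso by (auto simp: iso_iff epi_def)
  \<comment> \<open>both groups are quotients by the same subgroup, and the map between them is the identity\<close>
  have q: "quotient_map r ?X C = C" if "C \<in> carrier ?K" for C by (rule quotient_map_split[OF eq that])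
  have inv_q: "is_invariant r (K0_rel r ?X) (quotient_map r ?X)"
    unfolding is_invariant_def K
    using gK KZ q group.is_monoid[OF gK] monoid.m_closed[of ?K] by (auto simp: epi_def hom_def)
  have kb: "Coset.kernel ?K (interval_group n) (barcode n r) = {\<one>\<^bsub>?K\<^esub>}"
    using iso group_hom.inj_iff_trivial_ker[of ?K "interval_group n" "barcode n r"] gK gF
    by (auto simp: group_hom_def group_hom_axioms_def iso_iff)
  have kq: "Coset.kernel ?K (K0_rel r ?X) (quotient_map r ?X) = {\<one>\<^bsub>?K\<^esub>}"
    unfolding Coset.kernel_def K using q group.is_monoid[OF gK] by (auto simp: monoid.one_closed)
  show ?thesis
    unfolding homological_invariant_def
  proof (intro conjI exI[of _ ?X] allI impI)
    show "finite ?X" unfolding interval_classes_def by (rule finite_imageI[OF finite_closed_intervals])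
    show "?X \<subseteq> {iso_class r M | M. indecomposable r M}"
      unfolding interval_classes_def using indecomposable_interval[OF r] by blast
    show "iso_class r M \<in> ?X" if M: "indecomposable r M" for M :: "(nat, 'k) pmod"
    proof -
      obtain I where I: "I \<in> closed_intervals n" "isomorphic r M (interval_module I)"
        using indecomposable_is_interval[OF r M] by blast
      have "is_module r M" using M unfolding indecomposable_def by blast
      then have "iso_class r M = iso_class r (interval_module I)"
        using iso_class_eq_iff[OF _ module_interval[OF r I(1)]] I(2) by blast
      then show ?thesis unfolding interval_classes_def using I(1) by blast
    qed
    show "\<not> X_dim_properly_infinite r ?X" by (rule X_dim_not_properly_infinite[OF X])
    show "K0_rel r ?X \<cong> Z_pow (card ?X)" unfolding K card_X by (rule KZ)
    show "equivalent_invariants r (interval_group n) (barcode n r) (K0_rel r ?X) (quotient_map r ?X)"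
      unfolding equivalent_invariants_def using inv_b inv_q kb kq by simp
  qed (rule inv_b)
qed

end
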